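(* Let $\mathcal{P}$ be a homogeneous Poisson point process on $\mathbb{R}^2$ of intensity $\lambda>0$, let $\mathcal{P}_o=(\mathcal{P}\mid o\in\mathcal{P})$ and $\mathcal{P}_o^!=\mathcal{P}_o\setminus\{o\}$, and let $\Phi_{\rm BS}=\{U(V_{\mathcal{P}_o}(x)) : x\in\mathcal{P}_o^!\}$ be the point process of interfering users at the typical base station, located at the origin $o$. Then the base station/user pair correlation function $g_{\rm BS}$ of $\Phi_{\rm BS}$ with respect to the origin satisfies $$ g_{\rm BS}(r)=\Theta(r^2),\qquad r\to 0 .$$
   Context: Let $o=(0,0)$. $\mathcal{P}_o=(\mathcal{P}\mid o\in\mathcal{P})$ denotes $\mathcal{P}$ conditioned (in the Palm sense) on having a point at $o$; for a homogeneous Poisson process this is equal in distribution to $\mathcal{P}\cup\{o\}$. For $x\in\mathcal{P}_o$, $V_{\mathcal{P}_o}(x)$ denotes the Voronoi cell of $x$ with respect to $\mathcal{P}_o$. For $B\subset\mathbb{R}^2$, $U(B)$ denotes a point chosen uniformly at random from $B$, independently for different $B$ and independently of everything else. Thus $\Phi_{\rm BS}$ is obtained by placing, independently across cells given $\mathcal{P}_o$, one uniformly random point (user) in each Voronoi cell of $\mathcal{P}_o$ other than the cell of $o$. Let $b(o,r)$ be the disk of radius $r$ centered at $o$. Define $K_{\rm BS}(r)=\mathbb{E}\,\Phi_{\rm BS}(b(o,r))$, the expected number of points of $\Phi_{\rm BS}$ in $b(o,r)$, and $g_{\rm BS}(r)=\frac{1}{2\pi r}K_{\rm BS}'(r)$.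 $g_{\rm BS}(r)=\Theta(r^2)$ as $r\to0$ means that there are constants $c_1,c_2,r_0>0$ (possibly depending on $\lambda$) such that $c_1 r^2\le g_{\rm BS}(r)\le c_2 r^2$ for all $0<r<r_0$. *)

theory Defs
  imports "HOL-Probability.Probability"
begin

type_synonym plane = "real ^ 2"

text \<open>Simple point processes are random locally finite subsets of the plane. The \<open>\<sigma>\<close>-algebra on
  configurations is the one generated by the counts of points in bounded Borel sets.\<close>

definition configurations :: "plane set set" where
  "configurations = {A. \<forall>K. bounded K \<longrightarrow> finite (A \<inter> K)}"

definition config_space :: "plane set measure" where
  "config_space = sigma configurations
     {{A \<in> configurations. card (A \<inter> B) = k} | B k. B \<in> sets borel \<and> bounded B}"

definition point_process :: "'w measure \<Rightarrow> ('w \<Rightarrow> plane set) \<Rightarrow> bool" where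
  "point_process M P \<longleftrightarrow> prob_space M \<and> P \<in> measurable M config_space"

text \<open>The Poisson probabilities are written out because \<^const>\<open>poisson_pmf\<close> is specified only for
  positive rates, whereas \<open>B\<close> may be a null set.\<close>

definition poisson_process :: "'w measure \<Rightarrow> real \<Rightarrow> ('w \<Rightarrow> plane set) \<Rightarrow> bool" where
  "poisson_process M lam P \<longleftrightarrow> point_process M P \<and>
     (\<forall>B k. B \<in> sets borel \<longrightarrow> bounded B \<longrightarrow>
        measure M {w \<in> space M. card (P w \<inter> B) = k} =
          (lam * measure lborel B) ^ k / fact k * exp (- (lam * measure lborel B))) \<and>
     (\<forall>(I :: nat set) B. finite I \<longrightarrow> (\<forall>i\<in>I. B i \<in> sets borel \<and> bounded (B i)) \<longrightarrow>
        disjoint_family_on B I \<longrightarrow>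
        prob_space.indep_vars M (\<lambda>_. count_space UNIV) (\<lambda>i w. card (P w \<inter> B i)) I)"

text \<open>\<open>Po\<close> (which may live on another probability space) is the stationary point process \<open>P\<close> of
  intensity \<open>lam\<close> conditioned, in the Palm sense, on having a point at the origin: for every bounded
  Borel set \<open>B\<close> and every event \<open>A\<close>,
  \<open>lam * |B| * Prob (Po \<in> A)\<close> is the expected number of \<open>x \<in> P \<inter> B\<close> with \<open>P - x \<in> A\<close>.\<close>

definition palm_version ::
    "'w measure \<Rightarrow> real \<Rightarrow> ('w \<Rightarrow> plane set) \<Rightarrow> 'v measure \<Rightarrow> ('v \<Rightarrow> plane set) \<Rightarrow> bool" where
  "palm_version M lam P N Po \<longleftrightarrow> point_process N Po \<and>
     (\<forall>B A. B \<in> sets borel \<longrightarrow> bounded B \<longrightarrow> A \<in> sets config_space \<longrightarrow>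
        ennreal (lam * measure lborel B) * emeasure N {v \<in> space N. Po v \<in> A} =
          (\<integral>\<^sup>+ w. of_nat (card {x \<in> P w \<inter> B. (\<lambda>y. y - x) ` P w \<in> A}) \<partial>M))"

definition voronoi_cell :: "plane set \<Rightarrow> plane \<Rightarrow> plane set" where
  "voronoi_cell A x = {y. \<forall>z\<in>A. dist y x \<le> dist y z}"

definition generated_algebra :: "'v measure \<Rightarrow> ('v \<Rightarrow> plane set) \<Rightarrow> 'v measure" where
  "generated_algebra N Po = vimage_algebra (space N) Po config_space"

text \<open>\<open>U v C\<close> is the random point chosen from the set \<open>C\<close>. The condition says that, given \<open>Po\<close>, the
  points chosen from the Voronoi cells of the points of \<open>Po\<close> other than the origin are independent
  and uniformly distributed on their cells. To express this, the points are listed as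
  \<open>X 0, X 1, \<dots>\<close> in an order determined by \<open>Po\<close>; which listing is used is immaterial.
  No requirement is made on \<open>U v C\<close> for other sets \<open>C\<close>, which play no role (an uncountable
  independent family could not be evaluated at a random index).\<close>

definition uniform_in_cells ::
    "'v measure \<Rightarrow> ('v \<Rightarrow> plane set) \<Rightarrow> ('v \<Rightarrow> plane set \<Rightarrow> plane) \<Rightarrow> bool" where
  "uniform_in_cells N Po U \<longleftrightarrow>
     (\<exists>X :: nat \<Rightarrow> 'v \<Rightarrow> plane.
        (\<forall>i. X i \<in> borel_measurable (generated_algebra N Po)) \<and>
        (AE v in N. bij_betw (\<lambda>i. X i v) UNIV (Po v - {0})) \<and>
        (\<forall>i. (\<lambda>v. U v (voronoi_cell (Po v) (X i v))) \<in> borel_measurable N) \<and>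
        (\<forall>n B. (\<forall>i<n. B i \<in> sets borel) \<longrightarrow>
           (AE v in N.
              real_cond_exp N (generated_algebra N Po)
                (indicator {v \<in> space N. \<forall>i<n. U v (voronoi_cell (Po v) (X i v)) \<in> B i}) v =
              (\<Prod>i<n. measure (uniform_measure lborel (voronoi_cell (Po v) (X i v))) (B i)))))"

definition bs_users ::
    "('v \<Rightarrow> plane set) \<Rightarrow> ('v \<Rightarrow> plane set \<Rightarrow> plane) \<Rightarrow> 'v \<Rightarrow> plane set" where
  "bs_users Po U v = {U v (voronoi_cell (Po v) x) | x. x \<in> Po v - {0}}"

text \<open>The count is taken in the extended nonnegative reals, so that infinitely many points in the
  disk count as infinity rather than zero.\<close>

definition expected_count :: "'v measure \<Rightarrow> ('v \<Rightarrow> plane set) \<Rightarrow> real \<Rightarrow> ennreal" where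
  "expected_count N Phi r = (\<integral>\<^sup>+ v. emeasure (count_space UNIV) (Phi v \<inter> cball 0 r) \<partial>N)"

definition K_fun :: "'v measure \<Rightarrow> ('v \<Rightarrow> plane set) \<Rightarrow> real \<Rightarrow> real" where
  "K_fun N Phi r = enn2real (expected_count N Phi r)"

definition pair_correlation :: "'v measure \<Rightarrow> ('v \<Rightarrow> plane set) \<Rightarrow> real \<Rightarrow> real" where
  "pair_correlation N Phi r = deriv (K_fun N Phi) r / (2 * pi * r)"

end

theory Submission
  imports Defs
begin

text \<open>By Slivnyak's theorem the points other than the origin again form a Poisson process. The Mecke formula
  turns the expected number of users in a set \<open>B\<close> into the integral over \<open>B\<close> of
  \<open>h y = \<lambda> \<integral> E (1 (y \<in> V x) / area (V x)) dx\<close>, where \<open>V x\<close> is the cell that \<open>x\<close> would have if it were added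
  to the origin and the process. Invariance under rotations makes \<open>h\<close> radial and
  dominated convergence makes it continuous, so that the pair correlation function is \<open>h\<close> itself.

  If \<open>y \<in> V x\<close> then \<open>x\<close> lies in the disk of radius \<open>|y|\<close> about \<open>y\<close>, whose area is of order \<open>|y|\<^sup>2\<close>; it
  remains to bound the expectation on both sides. From above, the inverse area is at most \<open>16 / (d\<^sub>1 d\<^sub>2)\<close>
  with \<open>d\<^sub>1 \<le> d\<^sub>2\<close> the distances (cut off at 1) from \<open>x\<close> to the nearest two points of the process, and this
  is integrable uniformly in \<open>x\<close>. (The distance to the single nearest point would give \<open>d\<^sub>1\<^sup>-\<^sup>2\<close>, whose
  expectation diverges.) From below, the disk is empty with probability
  close to 1, and the mean area of a cell is bounded.\<close>

section \<open>Configurations\<close>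

text \<open>The Poisson hypothesis speaks of counts over disjoint bounded Borel sets, and the events
  that it describes are not closed under intersection. Resolving finitely many sets into disjoint
  pieces overcomes this; uniqueness of the Poisson law and the Mecke formula both rest on it. The
  Palm version is given by a sum over the points of \<open>P\<close>, so the Mecke formula evaluates
  it and Slivnyak's theorem follows.

  A second obstacle is that the event of an empty disk and the area of a cell are dependent. The
  lower bound replaces \<open>1 / v\<close> by a tangent line, so that only two separate
  expectations enter and no conditioning is required.

  Finally \<open>bs_users\<close> is a set, in which coinciding users count once. The users are
  therefore shown to be almost surely distinct before their number is written as a sum over the
  cells.\<close>

lemma space_config_space [simp]: "space config_space = configurations"
  unfolding config_space_def by (rule space_measure_of) auto

lemma sets_config_space:
  "sets config_space = sigma_sets configurations
     {{A \<in> configurations. card (A \<inter> B) = k} | B k. B \<in> sets borel \<and> bounded B}"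
  unfolding config_space_def by (rule sets_measure_of) auto

lemma configurations_finite: "A \<in> configurations \<Longrightarrow> bounded B \<Longrightarrow> finite (A \<inter> B)"
  by (simp add: configurations_def)

lemma configurationsI: "(\<And>K. bounded K \<Longrightarrow> finite (A \<inter> K)) \<Longrightarrow> A \<in> configurations"
  by (simp add: configurations_def)

lemma configurations_subset: "A \<in> configurations \<Longrightarrow> B \<subseteq> A \<Longrightarrow> B \<in> configurations"
  by (intro configurationsI) (rule finite_subset[OF Int_mono[OF _ subset_refl] configurations_finite])

lemma configurations_insert: "A \<in> configurations \<Longrightarrow> insert x A \<in> configurations"
  by (intro configurationsI) (simp add: Int_insert_left configurations_finite)

lemma measurable_card_config:
  assumes "B \<in> sets borel" "bounded B"
  shows "(\<lambda>A. card (A \<inter> B)) \<in> config_space \<rightarrow>\<^sub>M count_space UNIV"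
proof (subst measurable_count_space_eq_countable, simp, safe)
  fix k
  show "(\<lambda>A. card (A \<inter> B)) -` {k} \<inter> space config_space \<in> sets config_space"
    unfolding sets_config_space
    by (rule sigma_sets.Basic) (use assms in \<open>auto intro!: exI[of _ B] exI[of _ k]\<close>)
qed simp

lemma measurable_config_spaceI:
  assumes F: "\<And>s. s \<in> space S \<Longrightarrow> F s \<in> configurations"
    and card: "\<And>B. B \<in> sets borel \<Longrightarrow> bounded B \<Longrightarrow> (\<lambda>s. card (F s \<inter> B)) \<in> S \<rightarrow>\<^sub>M count_space UNIV"
  shows "F \<in> S \<rightarrow>\<^sub>M config_space"
  unfolding config_space_def
proof (rule measurable_sigma_sets[OF sets_measure_of])
  fix X assume "X \<in> {{A \<in> configurations. card (A \<inter> B) = k} | B k. B \<in> sets borel \<and> bounded B}"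
  then obtain B k where X: "X = {A \<in> configurations. card (A \<inter> B) = k}" "B \<in> sets borel" "bounded B"
    by auto
  have "F -` X \<inter> space S = (\<lambda>s. card (F s \<inter> B)) -` {k} \<inter> space S"
    using F by (auto simp: X(1))
  also have "\<dots> \<in> sets S"
    by (rule measurable_sets[OF card[OF X(2,3)]]) simp
  finally show "F -` X \<inter> space S \<in> sets S" .
qed (use F in auto)

lemma measurable_config_spaceI':
  assumes F: "\<And>s. s \<in> space S \<Longrightarrow> F s \<in> configurations"
    and card: "\<And>B. B \<in> sets borel \<Longrightarrow> bounded B \<Longrightarrow>
      (\<lambda>s. of_nat (card (F s \<inter> B)) :: ennreal) \<in> borel_measurable S"
  shows "F \<in> S \<rightarrow>\<^sub>M config_space"
proof (rule measurable_config_spaceI[OF F])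
  fix B :: "plane set" assume B: "B \<in> sets borel" "bounded B"
  have "(\<lambda>s. card (F s \<inter> B)) -` {k} \<inter> space S \<in> sets S" for k
  proof -
    have "(\<lambda>s. card (F s \<inter> B)) -` {k} \<inter> space S =
       (\<lambda>s. of_nat (card (F s \<inter> B)) :: ennreal) -` {of_nat k} \<inter> space S"
      by auto
    then show ?thesis using measurable_sets[OF card[OF B]] by simp
  qed
  then show "(\<lambda>s. card (F s \<inter> B)) \<in> S \<rightarrow>\<^sub>M count_space UNIV"
    by (subst measurable_count_space_eq_countable) auto
qed

section \<open>Sums over the points of a configuration\<close>

lemma nn_integral_count_space_restrict:
  fixes f :: "'a \<Rightarrow> ennreal"
  shows "(\<integral>\<^sup>+x. indicator B x * f x \<partial>count_space A) = (\<integral>\<^sup>+x. f x \<partial>count_space (A \<inter> B))"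
proof -
  have "count_space (A \<inter> B) = restrict_space (count_space A) B"
    by (simp add: restrict_count_space Int_commute)
  then show ?thesis
    by (simp add: nn_integral_restrict_space mult.commute)
qed

lemma nn_integral_count_space_card:
  "finite (A \<inter> B) \<Longrightarrow> (\<integral>\<^sup>+x. indicator B x \<partial>count_space A) = ennreal (card (A \<inter> B))"
  using nn_integral_count_space_restrict[where f = "\<lambda>_. 1" and B = B and A = A]
  by (simp add: ennreal_of_nat_eq_real_of_nat)

text \<open>Integration against a sub-probability kernel is measurable, but the counting measure on
  \<open>A \<inter> D\<close> has unbounded mass. Dividing by \<open>1 + card (A \<inter> D)\<close>
  turns it into such a kernel \<open>L\<close>; the divisor is a measurable function of
  \<open>A\<close> and is multiplied back at the end. The summand 1 keeps the divisor positive when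
  \<open>D\<close> contains no point.\<close>

lemma measurable_sum_config_bounded:
  fixes f :: "'s \<times> plane \<Rightarrow> ennreal"
  assumes f [measurable]: "f \<in> borel_measurable (S \<Otimes>\<^sub>M borel)" and D: "D \<in> sets borel" "bounded D"
  shows "(\<lambda>(s, A). \<integral>\<^sup>+y. f (s, y) \<partial>count_space (A \<inter> D)) \<in> borel_measurable (S \<Otimes>\<^sub>M config_space)"
proof -
  define c :: "plane set \<Rightarrow> ennreal" where "c A = inverse (1 + of_nat (card (A \<inter> D)))" for A
  define L :: "plane set \<Rightarrow> plane measure" where
    "L A = scale_measure (c A) (distr (count_space (A \<inter> D)) borel (\<lambda>x. x))" for A
  note [measurable] = measurable_card_config[OF D]
  have cc: "(1 + of_nat (card (A \<inter> D))) * c A = 1" for A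
  proof -
    have "(1 + of_nat (card (A \<inter> D)) :: ennreal) = ennreal (1 + real (card (A \<inter> D)))"
      by (simp add: ennreal_of_nat_eq_real_of_nat flip: ennreal_1)
    then show ?thesis
      unfolding c_def divide_ennreal_def[symmetric] by (simp add: divide_ennreal)
  qed
  have em: "emeasure (L A) B = c A * of_nat (card (A \<inter> D \<inter> B))"
    if "A \<in> configurations" "B \<in> sets borel" for A B
  proof -
    have "emeasure (count_space (A \<inter> D)) (A \<inter> D \<inter> B) = of_nat (card (A \<inter> D \<inter> B))"
      by (subst emeasure_count_space_finite)
         (auto simp: intro!: finite_subset[OF _ configurations_finite[OF that(1) D(2)]])
    then show ?thesis using that
      by (simp add: L_def emeasure_distr Int_ac)
  qed
  have sp: "space (L A) = UNIV" for A
    unfolding L_def by (simp add: space_scale_measure)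
  have L [measurable]: "L \<in> config_space \<rightarrow>\<^sub>M subprob_algebra borel"
  proof (rule measurable_subprob_algebra)
    fix A assume A: "A \<in> space config_space"
    have "emeasure (L A) (space (L A)) \<le> 1"
    proof -
      have "emeasure (L A) (space (L A)) = c A * of_nat (card (A \<inter> D))"
        using em[of A UNIV] A unfolding sp by simp
      also have "\<dots> \<le> c A * (1 + of_nat (card (A \<inter> D)))"
        by (intro mult_left_mono) auto
      also have "\<dots> = 1"
        using cc by (simp add: mult.commute)
      finally show ?thesis .
    qed
    then show "subprob_space (L A)" by (intro subprob_spaceI) (auto simp: sp)
    show "sets (L A) = sets borel" by (simp add: L_def)
  next
    fix B :: "plane set" assume B: "B \<in> sets borel"
    then have "D \<inter> B \<in> sets borel" "bounded (D \<inter> B)" using D by (auto intro: bounded_subset)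
    note [measurable] = measurable_card_config[OF this]
    have "(\<lambda>A. c A * of_nat (card (A \<inter> (D \<inter> B)))) \<in> borel_measurable config_space"
      unfolding c_def by measurable
    then show "(\<lambda>A. emeasure (L A) B) \<in> borel_measurable config_space"
      by (rule subst[OF measurable_cong, rotated]) (use B in \<open>simp add: em Int_assoc\<close>)
  qed
  have "(\<lambda>z. (1 + of_nat (card (snd z \<inter> D))) * (\<integral>\<^sup>+y. f (fst z, y) \<partial>L (snd z)))
      \<in> borel_measurable (S \<Otimes>\<^sub>M config_space)"
  proof -
    have "(\<lambda>z. integral\<^sup>N (L (snd z)) (\<lambda>y. f (fst z, y))) \<in> borel_measurable (S \<Otimes>\<^sub>M config_space)"
      by (rule nn_integral_measurable_subprob_algebra2[where N = borel]) measurable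
    then show ?thesis by measurable
  qed
  then show ?thesis
  proof (rule subst[OF measurable_cong, rotated])
    fix z assume z: "z \<in> space (S \<Otimes>\<^sub>M config_space)"
    obtain s A where zz: "z = (s, A)" and s: "s \<in> space S" and A: "A \<in> configurations"
      using z by (auto simp: space_pair_measure)
    have [measurable]: "(\<lambda>y. f (s, y)) \<in> borel_measurable borel"
      using s by measurable
    have "(\<integral>\<^sup>+y. f (s, y) \<partial>L A) = c A * (\<integral>\<^sup>+y. f (s, y) \<partial>count_space (A \<inter> D))"
      unfolding L_def by (simp add: nn_integral_scale_measure nn_integral_distr)
    then have "(1 + of_nat (card (A \<inter> D))) * (\<integral>\<^sup>+y. f (s, y) \<partial>L A)
      = ((1 + of_nat (card (A \<inter> D))) * c A) * (\<integral>\<^sup>+y. f (s, y) \<partial>count_space (A \<inter> D))"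
      by (simp add: mult.assoc)
    also have "(1 + of_nat (card (A \<inter> D))) * c A = 1"
      by (rule cc)
    finally show "(1 + of_nat (card (snd z \<inter> D))) * (\<integral>\<^sup>+y. f (fst z, y) \<partial>L (snd z)) =
       (case z of (s, A) \<Rightarrow> \<integral>\<^sup>+y. f (s, y) \<partial>count_space (A \<inter> D))"
      by (simp add: zz)
  qed
qed

text \<open>Disks of integer radius exhaust the plane, so monotone convergence reduces the sum to
  the bounded case.\<close>

lemma measurable_sum_config:
  fixes f :: "'s \<times> plane \<Rightarrow> ennreal"
  assumes f [measurable]: "f \<in> borel_measurable (S \<Otimes>\<^sub>M borel)"
  shows "(\<lambda>(s, A). \<integral>\<^sup>+y. f (s, y) \<partial>count_space A) \<in> borel_measurable (S \<Otimes>\<^sub>M config_space)"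
proof -
  have "(SUP n. \<integral>\<^sup>+y. f (s, y) \<partial>count_space (A \<inter> cball 0 (real n))) =
      (\<integral>\<^sup>+y. f (s, y) \<partial>count_space A)" for s A
  proof -
    have *: "(SUP n. indicator (cball 0 (real n)) y * f (s, y)) = f (s, y)" for y
    proof (rule antisym)
      obtain n where "norm y \<le> real n" using real_arch_simple by blast
      then show "f (s, y) \<le> (SUP n. indicator (cball 0 (real n)) y * f (s, y))"
        by (intro SUP_upper2[of n]) auto
    qed (auto intro!: SUP_least simp: indicator_def)
    have "(\<integral>\<^sup>+y. f (s, y) \<partial>count_space A)
        = (\<integral>\<^sup>+y. (SUP n. indicator (cball 0 (real n)) y * f (s, y)) \<partial>count_space A)"
      by (simp add: *)
    also have "\<dots> = (SUP n. \<integral>\<^sup>+y. indicator (cball 0 (real n)) y * f (s, y) \<partial>count_space A)"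
      by (rule nn_integral_monotone_convergence_SUP)
         (auto simp: incseq_def le_fun_def indicator_def)
    finally show ?thesis by (simp only: nn_integral_count_space_restrict)
  qed
  moreover have "(\<lambda>z. SUP n. (case z of (s, A) \<Rightarrow> \<integral>\<^sup>+y. f (s, y) \<partial>count_space (A \<inter> cball 0 (real n))))
      \<in> borel_measurable (S \<Otimes>\<^sub>M config_space)"
  proof (rule borel_measurable_SUP)
    fix n :: nat
    have "cball (0::plane) (real n) \<in> sets borel" "bounded (cball (0::plane) (real n))"
      by simp_all
    from measurable_sum_config_bounded[OF f this]
    show "(\<lambda>z. case z of (s, A) \<Rightarrow> \<integral>\<^sup>+y. f (s, y) \<partial>count_space (A \<inter> cball 0 (real n)))
      \<in> borel_measurable (S \<Otimes>\<^sub>M config_space)" .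
  qed simp
  ultimately show ?thesis
    by (elim subst[OF measurable_cong, rotated]) (auto split: prod.split)
qed

lemma measurable_sum_config' [measurable (raw)]:
  fixes f :: "'s \<Rightarrow> plane \<Rightarrow> ennreal"
  assumes [measurable]: "(\<lambda>(s, y). f s y) \<in> borel_measurable (S \<Otimes>\<^sub>M borel)"
    "F \<in> S \<rightarrow>\<^sub>M config_space"
  shows "(\<lambda>s. \<integral>\<^sup>+y. f s y \<partial>count_space (F s)) \<in> borel_measurable S"
proof -
  have "(\<lambda>s. (case (s, F s) of (s, A) \<Rightarrow> \<integral>\<^sup>+y. (\<lambda>(s, y). f s y) (s, y) \<partial>count_space A)) \<in> borel_measurable S"
    by (rule measurable_compose[OF _ measurable_sum_config]) measurable
  then show ?thesis by simp
qed

section \<open>Configurations obtained from other configurations\<close>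

lemma measurable_config_Collect:
  assumes [measurable]: "Measurable.pred (S \<Otimes>\<^sub>M borel) (\<lambda>(s, y). R s y)"
    and F [measurable]: "F \<in> S \<rightarrow>\<^sub>M config_space"
  shows "(\<lambda>s. {y \<in> F s. R s y}) \<in> S \<rightarrow>\<^sub>M config_space"
proof (rule measurable_config_spaceI')
  show "{y \<in> F s. R s y} \<in> configurations" if "s \<in> space S" for s
    using measurable_space[OF F that] by (auto intro: configurations_subset)
  fix B :: "plane set" assume B [measurable]: "B \<in> sets borel" and "bounded B"
  have "(\<lambda>s. \<integral>\<^sup>+y. indicator {y \<in> B. R s y} y \<partial>count_space (F s)) \<in> borel_measurable S"
    by measurable
  then show "(\<lambda>s. of_nat (card ({y \<in> F s. R s y} \<inter> B)) :: ennreal) \<in> borel_measurable S"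
  proof (rule subst[OF measurable_cong, rotated])
    fix s assume "s \<in> space S"
    then have F: "F s \<in> configurations" using measurable_space[OF F] by auto
    have "F s \<inter> {y \<in> B. R s y} = {y \<in> F s. R s y} \<inter> B" by auto
    with nn_integral_count_space_card[of "F s" "{y \<in> B. R s y}"] configurations_finite[OF F \<open>bounded B\<close>]
    show "(\<integral>\<^sup>+y. indicator {y \<in> B. R s y} y \<partial>count_space (F s)) = of_nat (card ({y \<in> F s. R s y} \<inter> B))"
      by (metis (no_types, lifting) ennreal_of_nat_eq_real_of_nat finite_subset inf.cobounded1 inf.cobounded2
          le_inf_iff  mem_Collect_eq subsetI subset_trans)
  qed
qed

lemma measurable_config_remove [measurable (raw)]:
  assumes [measurable]: "F \<in> S \<rightarrow>\<^sub>M config_space" "g \<in> S \<rightarrow>\<^sub>M borel"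
  shows "(\<lambda>s. F s - {g s}) \<in> S \<rightarrow>\<^sub>M config_space"
proof -
  have "(\<lambda>s. {y \<in> F s. y \<noteq> g s}) \<in> S \<rightarrow>\<^sub>M config_space"
    by (rule measurable_config_Collect) measurable
  also have "(\<lambda>s. {y \<in> F s. y \<noteq> g s}) = (\<lambda>s. F s - {g s})" by auto
  finally show ?thesis .
qed

text \<open>Boundedness of preimages keeps the image locally finite. Injectivity makes the count of
  the image in \<open>B\<close> equal to the count of \<open>F s\<close> in the preimage of
  \<open>B\<close>, which is a measurable sum.\<close>

lemma measurable_config_image:
  assumes [measurable]: "(\<lambda>(s, y). T s y) \<in> S \<Otimes>\<^sub>M borel \<rightarrow>\<^sub>M borel"
    and F [measurable]: "F \<in> S \<rightarrow>\<^sub>M config_space"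
    and inj: "\<And>s. s \<in> space S \<Longrightarrow> inj (T s)"
    and bdd: "\<And>s B. s \<in> space S \<Longrightarrow> bounded B \<Longrightarrow> bounded (T s -` B)"
  shows "(\<lambda>s. T s ` F s) \<in> S \<rightarrow>\<^sub>M config_space"
proof (rule measurable_config_spaceI')
  fix s assume s: "s \<in> space S"
  show "T s ` F s \<in> configurations"
  proof (rule configurationsI)
    fix K :: "plane set" assume "bounded K"
    then have "finite (F s \<inter> T s -` K)"
      using measurable_space[OF F s] bdd[OF s] by (auto intro!: configurations_finite)
    moreover have "T s ` F s \<inter> K = T s ` (F s \<inter> T s -` K)" by auto
    ultimately show "finite (T s ` F s \<inter> K)" by simp
  qed
next
  fix B :: "plane set" assume B [measurable]: "B \<in> sets borel" and "bounded B"
  have "(\<lambda>s. \<integral>\<^sup>+y. indicator (T s -` B) y \<partial>count_space (F s)) \<in> borel_measurable S"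
    unfolding indicator_vimage by measurable
  then show "(\<lambda>s. of_nat (card (T s ` F s \<inter> B)) :: ennreal) \<in> borel_measurable S"
  proof (rule subst[OF measurable_cong, rotated])
    fix s assume s: "s \<in> space S"
    then have F: "F s \<in> configurations" using measurable_space[OF F] by auto
    have "T s ` F s \<inter> B = T s ` (F s \<inter> T s -` B)" by auto
    then have "card (T s ` F s \<inter> B) = card (F s \<inter> T s -` B)"
      using inj[OF s] by (simp add: card_image inj_on_def)
    with nn_integral_count_space_card[OF configurations_finite[OF F bdd[OF s \<open>bounded B\<close>]]]
    show "(\<integral>\<^sup>+y. indicator (T s -` B) y \<partial>count_space (F s)) = of_nat (card (T s ` F s \<inter> B))"
      by (simp add: ennreal_of_nat_eq_real_of_nat)
  qed
qed

section \<open>Measures on configurations\<close>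

abbreviation bounded_borel :: "plane set \<Rightarrow> bool" where
  "bounded_borel B \<equiv> B \<in> sets borel \<and> bounded B"

text \<open>The prescribed counts are indexed by the sets themselves, so that refining or
  transforming a family of sets requires no renumbering.\<close>

definition count_event :: "plane set set \<Rightarrow> (plane set \<Rightarrow> nat) \<Rightarrow> plane set set" where
  "count_event \<A> m = {A \<in> configurations. \<forall>a\<in>\<A>. card (A \<inter> a) = m a}"

lemma sets_count_event:
  assumes "finite \<A>" "\<And>a. a \<in> \<A> \<Longrightarrow> bounded_borel a"
  shows "count_event \<A> m \<in> sets config_space"
proof -
  have "{A \<in> space config_space. \<forall>a\<in>\<A>. card (A \<inter> a) = m a} \<in> sets config_space"
  proof (rule sets.sets_Collect_finite_All[OF _ assms(1)])
    fix a assume "a \<in> \<A>"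
    with assms(2)[OF this] have [measurable]: "(\<lambda>A. card (A \<inter> a)) \<in> config_space \<rightarrow>\<^sub>M count_space UNIV"
      by (simp add: measurable_card_config)
    show "{A \<in> space config_space. card (A \<inter> a) = m a} \<in> sets config_space" by measurable
  qed
  then show ?thesis by (simp add: count_event_def)
qed

text \<open>Each new set \<open>B\<close> cuts every old piece into its parts inside and outside
  \<open>B\<close>, and what is left of \<open>B\<close> becomes one more piece. Counts on
  overlapping sets thus become sums of counts on disjoint ones.\<close>

lemma finite_disjoint_refinement:
  assumes "finite \<B>" "\<And>B. B \<in> \<B> \<Longrightarrow> bounded_borel B"
  obtains \<A> where "finite \<A>" "disjoint \<A>" "\<And>a. a \<in> \<A> \<Longrightarrow> bounded_borel a"
    "\<And>B. B \<in> \<B> \<Longrightarrow> B = \<Union>{a \<in> \<A>. a \<subseteq> B}"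
proof -
  have "\<exists>\<A>. finite \<A> \<and> disjoint \<A> \<and> (\<forall>a\<in>\<A>. bounded_borel a) \<and> (\<forall>B\<in>\<B>. B \<subseteq> \<Union>{a \<in> \<A>. a \<subseteq> B})"
    using assms
  proof (induction \<B>)
    case empty
    then show ?case by (intro exI[of _ "{}"]) (simp add: disjoint_def)
  next
    case (insert B \<B>)
    obtain \<A> where A: "finite \<A>" "disjoint \<A>" "\<forall>a\<in>\<A>. bounded_borel a" "\<forall>B\<in>\<B>. B \<subseteq> \<Union>{a \<in> \<A>. a \<subseteq> B}"
      using insert.IH insert.prems by auto
    have dis: "x \<in> a \<Longrightarrow> x \<in> b \<Longrightarrow> a \<in> \<A> \<Longrightarrow> b \<in> \<A> \<Longrightarrow> a = b" for a b x
      using A(2) by (auto simp: disjoint_def)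
    define \<A>' where "\<A>' = (\<lambda>a. a \<inter> B) ` \<A> \<union> (\<lambda>a. a - B) ` \<A> \<union> {B - \<Union>\<A>}"
    have "finite \<A>'" using A(1) by (simp add: \<A>'_def)
    moreover have "disjoint \<A>'"
    proof (rule disjointI)
      fix a b assume ab: "a \<in> \<A>'" "b \<in> \<A>'" "a \<noteq> b"
      show "a \<inter> b = {}"
      proof (rule equals0I)
        fix x assume x: "x \<in> a \<inter> b"
        show False
        proof (cases "x \<in> \<Union>\<A>")
          case True
          then obtain c where c: "c \<in> \<A>" "x \<in> c" by blast
          \<comment> \<open>A piece is determined by any one of its points; two pieces with a common
            point therefore coincide.\<close>
          have "d = (if x \<in> B then c \<inter> B else c - B)" if "d \<in> \<A>'" "x \<in> d" for d
          proof -
            from that(1) consider a where "a \<in> \<A>" "d = a \<inter> B" | a where "a \<in> \<A>" "d = a - B" | "d = B - \<Union>\<A>"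
              unfolding \<A>'_def by blast
            then show ?thesis
            proof cases
              case 1
              then have "a = c" using that(2) c by (intro dis[of x]) auto
              then show ?thesis using 1 that(2) by simp
            next
              case 2
              then have "a = c" using that(2) c by (intro dis[of x]) auto
              then show ?thesis using 2 that(2) by simp
            next
              case 3
              then show ?thesis using that(2) True by simp
            qed
          qed
          from this[of a] this[of b] ab x show False by simp
        next
          case False
          have "d = B - \<Union>\<A>" if "d \<in> \<A>'" "x \<in> d" for d
            using that False unfolding \<A>'_def by blast
          from this[of a] this[of b] ab x show False by simp
        qed
      qed
    qed
    moreover have "\<forall>a\<in>\<A>'. bounded_borel a"
      using A(1,3) insert.prems(1)[of B] unfolding \<A>'_def
      by (auto intro: bounded_subset intro!: sets.Diff sets.finite_Union)
    moreover have "\<forall>B'\<in>insert B \<B>. B' \<subseteq> \<Union>{a \<in> \<A>'. a \<subseteq> B'}"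
    proof (intro ballI subsetI)
      fix B' x assume B': "B' \<in> insert B \<B>" and x: "x \<in> B'"
      show "x \<in> \<Union>{a \<in> \<A>'. a \<subseteq> B'}"
      proof (cases "B' = B")
        case True
        with x show ?thesis
          unfolding \<A>'_def by (cases "x \<in> \<Union>\<A>") auto
      next
        case False
        with B' x A(4) obtain a where a: "a \<in> \<A>" "a \<subseteq> B'" "x \<in> a" by blast
        then show ?thesis
          unfolding \<A>'_def by (cases "x \<in> B") auto
      qed
    qed
    ultimately show ?case by blast
  qed
  then obtain \<A> where "finite \<A>" "disjoint \<A>" "\<forall>a\<in>\<A>. bounded_borel a" "\<forall>B\<in>\<B>. B \<subseteq> \<Union>{a \<in> \<A>. a \<subseteq> B}"
    by blast
  then show thesis by (intro that[of \<A>]) auto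
qed

text \<open>Allowing the refinement to resolve a given set \<open>C\<close> makes the criterion applicable to
  measures whose values are only known on events with this property.\<close>

lemma config_measure_eqI:
  fixes \<mu> \<nu> :: "plane set measure"
  assumes sets: "sets \<mu> = sets config_space" "sets \<nu> = sets config_space"
    and C: "bounded_borel C"
    and eq: "\<And>\<A> m. \<lbrakk>finite \<A>; disjoint \<A>; \<And>a. a \<in> \<A> \<Longrightarrow> bounded_borel a; C = \<Union>{a \<in> \<A>. a \<subseteq> C}\<rbrakk> \<Longrightarrow>
       emeasure \<mu> (count_event \<A> m) = emeasure \<nu> (count_event \<A> m)"
    and fin: "emeasure \<mu> configurations \<noteq> \<infinity>"
  shows "\<mu> = \<nu>"
proof -
  \<comment> \<open>\<open>S\<close> is a set of prescriptions and may contradict itself. Hence an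
    intersection of two such events is simply the event of the union of the prescriptions, which
    makes \<open>E\<close> intersection-stable.\<close>
  define ev where "ev S = {A \<in> configurations. \<forall>(B, k)\<in>S. card (A \<inter> B) = k}" for S :: "(plane set \<times> nat) set"
  define E where "E = {ev S | S. finite S \<and> (\<forall>(B, k)\<in>S. bounded_borel B)}"
  have E_sets: "E \<subseteq> sets config_space"
  proof
    fix X assume "X \<in> E"
    then obtain S where X: "X = ev S" and S: "finite S" "\<forall>(B, k)\<in>S. bounded_borel B" by (auto simp: E_def)
    have "{A \<in> space config_space. \<forall>p\<in>S. card (A \<inter> fst p) = snd p} \<in> sets config_space"
    proof (rule sets.sets_Collect_finite_All[OF _ S(1)])
      fix p assume "p \<in> S"
      then have [measurable]: "(\<lambda>A. card (A \<inter> fst p)) \<in> config_space \<rightarrow>\<^sub>M count_space UNIV"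
        using S(2) by (intro measurable_card_config) auto
      show "{A \<in> space config_space. card (A \<inter> fst p) = snd p} \<in> sets config_space" by measurable
    qed
    then show "X \<in> sets config_space" by (simp add: X ev_def case_prod_beta')
  qed
  have sigma_E: "sets config_space = sigma_sets configurations E"
  proof (rule antisym)
    show "sigma_sets configurations E \<subseteq> sets config_space"
      using sets.sigma_sets_subset[OF E_sets] by simp
    have "{{A \<in> configurations. card (A \<inter> B) = k} | B k. B \<in> sets borel \<and> bounded B} \<subseteq> E"
    proof safe
      fix B :: "plane set" and k assume B: "B \<in> sets borel" "bounded B"
      show "{A \<in> configurations. card (A \<inter> B) = k} \<in> E"
        unfolding E_def by (rule CollectI, rule exI[of _ "{(B, k)}"]) (use B in \<open>auto simp: ev_def\<close>)
    qed
    then show "sets config_space \<subseteq> sigma_sets configurations E"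
      unfolding sets_config_space by (rule sigma_sets_mono')
  qed
  have empty: "configurations \<in> E"
    unfolding E_def by (rule CollectI, rule exI[of _ "{}"]) (simp add: ev_def)
  show ?thesis
  proof (rule measure_eqI_generator_eq[where \<Omega> = configurations and E = E and A = "\<lambda>_. configurations"])
    show "Int_stable E"
    proof (rule Int_stableI)
      fix X Y assume "X \<in> E" "Y \<in> E"
      then obtain S T where "X = ev S" "finite S" "\<forall>(B, k)\<in>S. bounded_borel B"
        "Y = ev T" "finite T" "\<forall>(B, k)\<in>T. bounded_borel B" by (auto simp: E_def)
      then show "X \<inter> Y \<in> E"
        unfolding E_def by (intro CollectI exI[of _ "S \<union> T"]) (auto simp: ev_def ball_Un)
    qed
    show "E \<subseteq> Pow configurations" by (auto simp: E_def ev_def)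
    show "sets \<mu> = sigma_sets configurations E" "sets \<nu> = sigma_sets configurations E"
      using sets sigma_E by simp_all
    show "range (\<lambda>_. configurations) \<subseteq> E" using empty by auto
    show "emeasure \<mu> configurations \<noteq> \<infinity>" by fact
    fix X assume "X \<in> E"
    then obtain S where X: "X = ev S" and S: "finite S" "\<forall>(B, k)\<in>S. bounded_borel B" by (auto simp: E_def)
    have finC: "finite (insert C (fst ` S))" using S(1) by simp
    have bddC: "bounded_borel B" if "B \<in> insert C (fst ` S)" for B
    proof -
      from that have "B = C \<or> (\<exists>k. (B, k) \<in> S)" by force
      then show ?thesis using C S(2) by blast
    qed
    obtain \<A> where A: "finite \<A>" "disjoint \<A>" "\<And>a. a \<in> \<A> \<Longrightarrow> bounded_borel a"
      "\<And>B. B \<in> insert C (fst ` S) \<Longrightarrow> B = \<Union>{a \<in> \<A>. a \<subseteq> B}"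
      by (rule finite_disjoint_refinement[OF finC bddC], assumption, rule that)
    \<comment> \<open>The counts on the pieces that are compatible with \<open>S\<close>.
      Extensionality makes \<open>I\<close> countable and ensures that two different members differ
      on some piece, so that their events are disjoint.\<close>
    define I where "I = {m \<in> \<A> \<rightarrow>\<^sub>E (UNIV :: nat set). \<forall>(B, k)\<in>S. (\<Sum>a | a \<in> \<A> \<and> a \<subseteq> B. m a) = k}"
    have "countable I"
      unfolding I_def by (rule countable_subset[OF _ countable_PiE[OF A(1)]]) auto
    have card: "card (K \<inter> B) = (\<Sum>a | a \<in> \<A> \<and> a \<subseteq> B. card (K \<inter> a))"
      if "K \<in> configurations" "(B, k) \<in> S" for K B k
    proof -
      have "B \<in> insert C (fst ` S)" using that(2) by force
      from A(4)[OF this] have "K \<inter> B = (\<Union>a\<in>{a \<in> \<A>. a \<subseteq> B}. K \<inter> a)" by blast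
      also have "card \<dots> = (\<Sum>a | a \<in> \<A> \<and> a \<subseteq> B. card (K \<inter> a))"
      proof (rule card_UN_disjoint)
        show "\<forall>i\<in>{a \<in> \<A>. a \<subseteq> B}. \<forall>j\<in>{a \<in> \<A>. a \<subseteq> B}. i \<noteq> j \<longrightarrow> K \<inter> i \<inter> (K \<inter> j) = {}"
          using A(2) unfolding disjoint_def by blast
      qed (use A(1,3) that(1) in \<open>auto intro!: configurations_finite\<close>)
      finally show ?thesis .
    qed
    have ev_eq: "ev S = (\<Union>m\<in>I. count_event \<A> m)"
    proof (intro equalityI subsetI)
      fix K assume K: "K \<in> ev S"
      have "restrict (\<lambda>a. card (K \<inter> a)) \<A> \<in> I"
        unfolding I_def using K card[of K] by (fastforce simp: ev_def)
      then show "K \<in> (\<Union>m\<in>I. count_event \<A> m)"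
        using K by (intro UN_I) (auto simp: count_event_def ev_def)
    next
      fix K assume "K \<in> (\<Union>m\<in>I. count_event \<A> m)"
      then obtain m where m: "m \<in> I" "K \<in> configurations" "\<And>a. a \<in> \<A> \<Longrightarrow> card (K \<inter> a) = m a"
        by (auto simp: count_event_def)
      have "card (K \<inter> B) = k" if "(B, k) \<in> S" for B k
      proof -
        have "card (K \<inter> B) = (\<Sum>a | a \<in> \<A> \<and> a \<subseteq> B. m a)"
          unfolding card[OF m(2) that] by (rule sum.cong) (auto simp: m(3))
        also have "\<dots> = k" using m(1) that by (auto simp: I_def)
        finally show ?thesis .
      qed
      with m(2) show "K \<in> ev S" by (auto simp: ev_def)
    qed
    have dis: "disjoint_family_on (count_event \<A>) I"
      unfolding disjoint_family_on_def
    proof (intro ballI impI)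
      fix m n assume mn: "m \<in> I" "n \<in> I" "m \<noteq> n"
      then obtain a where "a \<in> \<A>" "m a \<noteq> n a"
        unfolding I_def by (metis (no_types, lifting) PiE_ext mem_Collect_eq)
      then show "count_event \<A> m \<inter> count_event \<A> n = {}" by (auto simp: count_event_def)
    qed
    have "emeasure \<mu> (ev S) = (\<integral>\<^sup>+m. emeasure \<mu> (count_event \<A> m) \<partial>count_space I)"
      unfolding ev_eq by (rule emeasure_UN_countable[OF _ \<open>countable I\<close> dis])
        (auto simp: sets intro!: sets_count_event A)
    also have "\<dots> = (\<integral>\<^sup>+m. emeasure \<nu> (count_event \<A> m) \<partial>count_space I)"
      by (intro nn_integral_cong eq A) auto
    also have "\<dots> = emeasure \<nu> (ev S)"
      unfolding ev_eq by (rule emeasure_UN_countable[symmetric, OF _ \<open>countable I\<close> dis])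
        (auto simp: sets intro!: sets_count_event A)
    finally show "emeasure \<mu> X = emeasure \<nu> X" by (simp add: X)
  qed auto
qed

section \<open>The Poisson law\<close>

definition poisson_prob :: "real \<Rightarrow> nat \<Rightarrow> real" where
  "poisson_prob t k = t ^ k / fact k * exp (- t)"

lemma poisson_prob_nonneg: "0 \<le> t \<Longrightarrow> 0 \<le> poisson_prob t k"
  by (simp add: poisson_prob_def)

text \<open>The analytic core of the Mecke formula: choosing and removing one of
  \<open>Suc k\<close> points leaves the weight of \<open>k\<close> points, multiplied by the mean
  \<open>t\<close>.\<close>

lemma poisson_prob_Suc: "real (Suc k) * poisson_prob t (Suc k) = t * poisson_prob t k"
  by (simp add: poisson_prob_def divide_simps del: of_nat_Suc)

text \<open>Everything is stated for a law on configurations, since \<open>P\<close> and its Palm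
  version may live on different probability spaces and can only be compared through their
  laws.\<close>

locale poisson_law = prob_space D for D :: "plane set measure" +
  fixes lam :: real
  assumes lam: "lam > 0"
    and sets_D [measurable_cong]: "sets D = sets config_space"
    and counts: "\<And>\<A> m. \<lbrakk>finite \<A>; disjoint \<A>; \<And>a. a \<in> \<A> \<Longrightarrow> bounded_borel a\<rbrakk> \<Longrightarrow>
      prob (count_event \<A> m) = (\<Prod>a\<in>\<A>. poisson_prob (lam * measure lborel a) (m a))"

lemma poisson_process_law:
  assumes "lam > 0" "poisson_process M lam P"
  shows "poisson_law (distr M config_space P) lam"
proof -
  interpret prob_space M using assms(2) by (simp add: poisson_process_def point_process_def)
  have P [measurable]: "P \<in> M \<rightarrow>\<^sub>M config_space"
    using assms(2) by (simp add: poisson_process_def point_process_def)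
  interpret D: prob_space "distr M config_space P" by (rule prob_space_distr) fact
  show ?thesis
  proof
    fix \<A> m assume A: "finite \<A>" "disjoint \<A>" "\<And>a. a \<in> \<A> \<Longrightarrow> bounded_borel a"
    have "measure (distr M config_space P) (count_event \<A> m) = prob (P -` count_event \<A> m \<inter> space M)"
      by (intro measure_distr P sets_count_event A) auto
    also have "\<dots> = (\<Prod>a\<in>\<A>. poisson_prob (lam * measure lborel a) (m a))"
    \<comment> \<open>An intersection over an empty index set would be the whole type instead of
      \<open>space M\<close>, so the empty family is treated apart.\<close>
    proof (cases "\<A> = {}")
      case True
      have "P -` count_event {} m \<inter> space M = space M"
        using measurable_space[OF P] by (auto simp: count_event_def)
      then show ?thesis using True by (simp add: prob_space)
    next
      case False
      obtain B where B: "bij_betw B {0..<card \<A>} \<A>"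
        using ex_bij_betw_nat_finite[OF A(1)] by blast
      let ?I = "{0..<card \<A>}"
      have BA: "B i \<in> \<A>" if "i \<in> ?I" for i using B that by (auto simp: bij_betw_def)
      have "disjoint_family_on B ?I"
        unfolding disjoint_family_on_def
      proof (intro ballI impI)
        fix i j assume ij: "i \<in> ?I" "j \<in> ?I" "i \<noteq> j"
        then have "B i \<noteq> B j" using B by (auto simp: bij_betw_def inj_on_def)
        with BA ij A(2) show "B i \<inter> B j = {}" by (auto simp: disjoint_def)
      qed
      moreover have "\<forall>i\<in>?I. bounded_borel (B i)" using BA A(3) by simp
      moreover have "\<forall>(I :: nat set) B. finite I \<longrightarrow> (\<forall>i\<in>I. bounded_borel (B i)) \<longrightarrow>
          disjoint_family_on B I \<longrightarrow> indep_vars (\<lambda>_. count_space UNIV) (\<lambda>i w. card (P w \<inter> B i)) I"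
        using assms(2) unfolding poisson_process_def by simp
      ultimately have ind: "indep_vars (\<lambda>_. count_space UNIV) (\<lambda>i w. card (P w \<inter> B i)) ?I"
        by simp
      have "P -` count_event \<A> m \<inter> space M = (\<Inter>i\<in>?I. (\<lambda>w. card (P w \<inter> B i)) -` {m (B i)} \<inter> space M)"
      proof (rule set_eqI)
        fix w
        have "?I \<noteq> {}" using False A(1) by (auto simp: card_gt_0_iff)
        then have "w \<in> (\<Inter>i\<in>?I. (\<lambda>w. card (P w \<inter> B i)) -` {m (B i)} \<inter> space M) \<longleftrightarrow>
            w \<in> space M \<and> (\<forall>a\<in>B ` ?I. card (P w \<inter> a) = m a)" by auto
        also have "B ` ?I = \<A>" using B by (simp add: bij_betw_def)
        also have "w \<in> space M \<and> (\<forall>a\<in>\<A>. card (P w \<inter> a) = m a) \<longleftrightarrow> w \<in> P -` count_event \<A> m \<inter> space M"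
          using measurable_space[OF P, of w] by (auto simp: count_event_def)
        finally show "w \<in> P -` count_event \<A> m \<inter> space M \<longleftrightarrow>
            w \<in> (\<Inter>i\<in>?I. (\<lambda>w. card (P w \<inter> B i)) -` {m (B i)} \<inter> space M)" by simp
      qed
      also have "prob \<dots> = (\<Prod>i\<in>?I. prob ((\<lambda>w. card (P w \<inter> B i)) -` {m (B i)} \<inter> space M))"
        using False A(1) by (intro indep_varsD_finite[OF ind]) (auto simp: card_gt_0_iff)
      also have "\<dots> = (\<Prod>i\<in>?I. poisson_prob (lam * measure lborel (B i)) (m (B i)))"
      proof (intro prod.cong refl)
        fix i assume "i \<in> ?I"
        then have "bounded_borel (B i)" using BA A(3) by blast
        moreover have "(\<lambda>w. card (P w \<inter> B i)) -` {m (B i)} \<inter> space M = {w \<in> space M. card (P w \<inter> B i) = m (B i)}"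
          by auto
        ultimately show "prob ((\<lambda>w. card (P w \<inter> B i)) -` {m (B i)} \<inter> space M) =
            poisson_prob (lam * measure lborel (B i)) (m (B i))"
          using assms(2) unfolding poisson_process_def poisson_prob_def by simp
      qed
      also have "\<dots> = (\<Prod>a\<in>\<A>. poisson_prob (lam * measure lborel a) (m a))"
        by (rule prod.reindex_bij_betw[OF B])
      finally show ?thesis .
    qed
    finally show "measure (distr M config_space P) (count_event \<A> m) =
       (\<Prod>a\<in>\<A>. poisson_prob (lam * measure lborel a) (m a))" .
  qed (use assms(1) in auto)
qed

section \<open>The Mecke formula\<close>

text \<open>The reduced Campbell measure of point process theory. The Mecke formula says that for a
  Poisson law it is a multiple of a product measure, which is a statement about rectangles.\<close>

definition reduced_campbell :: "plane set measure \<Rightarrow> (plane \<times> plane set) measure" where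
  "reduced_campbell D = measure_of (UNIV \<times> configurations) (sets (borel \<Otimes>\<^sub>M config_space))
     (\<lambda>W. \<integral>\<^sup>+A. \<integral>\<^sup>+x. indicator W (x, A - {x}) \<partial>count_space A \<partial>D)"

lemma space_reduced_campbell: "space (reduced_campbell D) = UNIV \<times> configurations"
  unfolding reduced_campbell_def
  by (rule space_measure_of) (use sets.space_closed in \<open>fastforce simp: space_pair_measure\<close>)

lemma sets_reduced_campbell [measurable_cong]: "sets (reduced_campbell D) = sets (borel \<Otimes>\<^sub>M config_space)"
  unfolding reduced_campbell_def
  using sets.sets_measure_of_eq[of "borel \<Otimes>\<^sub>M config_space"] by (simp add: space_pair_measure)

lemma emeasure_reduced_campbell:
  assumes [measurable_cong]: "sets D = sets config_space" and W: "W \<in> sets (borel \<Otimes>\<^sub>M config_space)"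
  shows "emeasure (reduced_campbell D) W = (\<integral>\<^sup>+A. \<integral>\<^sup>+x. indicator W (x, A - {x}) \<partial>count_space A \<partial>D)"
proof (rule emeasure_measure_of[OF reduced_campbell_def])
  show "sets (borel \<Otimes>\<^sub>M config_space) \<subseteq> Pow (UNIV \<times> configurations)"
    using sets.space_closed[of "borel \<Otimes>\<^sub>M config_space"] by (simp add: space_pair_measure)
  show "W \<in> sets (reduced_campbell D)" using W by (simp add: sets_reduced_campbell)
  show "positive (sets (reduced_campbell D)) (\<lambda>W. \<integral>\<^sup>+A. \<integral>\<^sup>+x. indicator W (x, A - {x}) \<partial>count_space A \<partial>D)"
    by (simp add: positive_def)
  show "countably_additive (sets (reduced_campbell D)) (\<lambda>W. \<integral>\<^sup>+A. \<integral>\<^sup>+x. indicator W (x, A - {x}) \<partial>count_space A \<partial>D)"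
  proof (rule countably_additiveI)
    fix F :: "nat \<Rightarrow> (plane \<times> plane set) set"
    assume F: "range F \<subseteq> sets (reduced_campbell D)" "disjoint_family F"
    have [measurable]: "F i \<in> sets (borel \<Otimes>\<^sub>M config_space)" for i
      using F(1) by (auto simp: sets_reduced_campbell)
    have "(\<Sum>i. \<integral>\<^sup>+A. \<integral>\<^sup>+x. indicator (F i) (x, A - {x}) \<partial>count_space A \<partial>D)
        = (\<integral>\<^sup>+A. (\<Sum>i. \<integral>\<^sup>+x. indicator (F i) (x, A - {x}) \<partial>count_space A) \<partial>D)"
      by (rule nn_integral_suminf[symmetric]) measurable
    also have "\<dots> = (\<integral>\<^sup>+A. \<integral>\<^sup>+x. (\<Sum>i. indicator (F i) (x, A - {x})) \<partial>count_space A \<partial>D)"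
      by (simp add: nn_integral_suminf)
    also have "\<dots> = (\<integral>\<^sup>+A. \<integral>\<^sup>+x. indicator (\<Union>i. F i) (x, A - {x}) \<partial>count_space A \<partial>D)"
      by (simp add: suminf_indicator[OF F(2)])
    finally show "(\<Sum>i. \<integral>\<^sup>+A. \<integral>\<^sup>+x. indicator (F i) (x, A - {x}) \<partial>count_space A \<partial>D) =
       (\<integral>\<^sup>+A. \<integral>\<^sup>+x. indicator (\<Union>i. F i) (x, A - {x}) \<partial>count_space A \<partial>D)" .
  qed
qed

lemma emeasure_bounded_eq: "bounded_borel B \<Longrightarrow> emeasure lborel B = ennreal (measure lborel B)"
  by (rule emeasure_eq_ennreal_measure)
     (use emeasure_bounded_finite[of B] in auto)

context poisson_law
begin

lemma space_D [simp]: "space D = configurations"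
  using sets_eq_imp_space_eq[OF sets_D] by simp

lemma configurations_nonempty: "emeasure D configurations = 1"
  using emeasure_space_1 by simp

lemma emeasure_count_event:
  assumes "finite \<A>" "disjoint \<A>" "\<And>a. a \<in> \<A> \<Longrightarrow> bounded_borel a"
  shows "emeasure D (count_event \<A> m) = ennreal (\<Prod>a\<in>\<A>. poisson_prob (lam * measure lborel a) (m a))"
  using counts[OF assms, of m] by (simp add: emeasure_eq_measure)

text \<open>Split \<open>C\<close> into its pieces \<open>a\<close>. Removing a point of
  \<open>a\<close> lowers the count in \<open>a\<close> by one and leaves the other counts alone, so
  the sum over the points in \<open>a\<close> is \<open>Suc (m a)\<close> times the indicator of the
  event with the count of \<open>a\<close> raised by one. Then \<open>poisson_prob_Suc\<close>
  restores the original event at the price of a factor \<open>lam\<close> times the area of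
  \<open>a\<close>.\<close>

lemma reduced_campbell_rectangle_count_event:
  assumes A: "finite \<A>" "disjoint \<A>" "\<And>a. a \<in> \<A> \<Longrightarrow> bounded_borel a" and C: "C = \<Union>{a \<in> \<A>. a \<subseteq> C}"
  shows "emeasure (reduced_campbell D) (C \<times> count_event \<A> m) =
     ennreal lam * emeasure lborel C * emeasure D (count_event \<A> m)"
proof -
  define J where "J = {a \<in> \<A>. a \<subseteq> C}"
  have J: "finite J" "J \<subseteq> \<A>" "\<And>a. a \<in> J \<Longrightarrow> bounded_borel a" "disjoint_family_on (\<lambda>a. a) J"
    using A by (auto simp: J_def disjoint_family_on_def disjoint_def)
  have C_eq: "C = (\<Union>a\<in>J. a)" using C by (simp add: J_def)
  have [measurable]: "C \<in> sets borel" unfolding C_eq using J by auto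
  have ev [measurable]: "count_event \<A> m \<in> sets config_space" for m by (rule sets_count_event) (use A in auto)
  have ind_C: "indicator C x = (\<Sum>a\<in>J. indicator a x :: ennreal)" for x
    unfolding C_eq by (rule indicator_UN_disjoint[OF J(1,4)])
  have step: "(\<integral>\<^sup>+x. indicator a x * indicator (count_event \<A> m) (K - {x}) \<partial>count_space K)
     = of_nat (Suc (m a)) * indicator (count_event \<A> (m(a := Suc (m a)))) K"
    if K: "K \<in> configurations" and a: "a \<in> J" for K a
  proof -
    have a': "a \<in> \<A>" "bounded a" using a J A by auto
    have fin: "finite (K \<inter> a)" by (rule configurations_finite) fact+
    have "indicator (count_event \<A> m) (K - {x}) = (indicator (count_event \<A> (m(a := Suc (m a)))) K :: ennreal)"
      if x: "x \<in> K \<inter> a" for x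
    proof -
      have "card (K \<inter> a) > 0" using x fin by (auto simp: card_gt_0_iff)
      then have 1: "card ((K - {x}) \<inter> a) = m a \<longleftrightarrow> card (K \<inter> a) = Suc (m a)"
        using x by (simp add: Int_Diff[symmetric] Diff_Int_distrib2 card_Diff_singleton) arith
      have 2: "(K - {x}) \<inter> b = K \<inter> b" if "b \<in> \<A>" "b \<noteq> a" for b
        using that a' x A(2) by (auto simp: disjoint_def)
      have "K - {x} \<in> configurations" using K by (rule configurations_subset) auto
      moreover have "card ((K - {x}) \<inter> b) = m b \<longleftrightarrow> card (K \<inter> b) = (m(a := Suc (m a))) b" if "b \<in> \<A>" for b
        using 1 2[OF that] by (cases "b = a") simp_all
      ultimately have "K - {x} \<in> count_event \<A> m \<longleftrightarrow> K \<in> count_event \<A> (m(a := Suc (m a)))"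
        using K unfolding count_event_def by simp
      then show ?thesis by (simp add: indicator_def)
    qed
    then have "(\<integral>\<^sup>+x. indicator a x * indicator (count_event \<A> m) (K - {x}) \<partial>count_space K)
       = (\<integral>\<^sup>+x. indicator (count_event \<A> (m(a := Suc (m a)))) K \<partial>count_space (K \<inter> a))"
      unfolding nn_integral_count_space_restrict by (intro nn_integral_cong) simp
    also have "\<dots> = of_nat (card (K \<inter> a)) * indicator (count_event \<A> (m(a := Suc (m a)))) K"
      using fin by (simp add: mult.commute)
    also have "\<dots> = of_nat (Suc (m a)) * indicator (count_event \<A> (m(a := Suc (m a)))) K"
      using a' by (auto simp: indicator_def count_event_def)
    finally show ?thesis .
  qed
  have summand: "of_nat (Suc (m a)) * emeasure D (count_event \<A> (m(a := Suc (m a)))) =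
     ennreal lam * emeasure lborel a * emeasure D (count_event \<A> m)" if a: "a \<in> J" for a
  proof -
    have a': "a \<in> \<A>" using a J by auto
    let ?t = "\<lambda>a. lam * measure lborel a"
    have "real (Suc (m a)) * (\<Prod>b\<in>\<A>. poisson_prob (?t b) ((m(a := Suc (m a))) b))
       = (real (Suc (m a)) * poisson_prob (?t a) (Suc (m a))) * (\<Prod>b\<in>\<A> - {a}. poisson_prob (?t b) ((m(a := Suc (m a))) b))"
      by (subst prod.remove[OF A(1) a']) simp
    also have "(\<Prod>b\<in>\<A> - {a}. poisson_prob (?t b) ((m(a := Suc (m a))) b)) = (\<Prod>b\<in>\<A> - {a}. poisson_prob (?t b) (m b))"
      by (rule prod.cong) auto
    also have "(real (Suc (m a)) * poisson_prob (?t a) (Suc (m a))) * \<dots> = ?t a * (\<Prod>b\<in>\<A>. poisson_prob (?t b) (m b))"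
      unfolding poisson_prob_Suc by (subst prod.remove[OF A(1) a']) simp
    finally have eq: "real (Suc (m a)) * (\<Prod>b\<in>\<A>. poisson_prob (?t b) ((m(a := Suc (m a))) b))
       = ?t a * (\<Prod>b\<in>\<A>. poisson_prob (?t b) (m b))" .
    have nn: "0 \<le> (\<Prod>b\<in>\<A>. poisson_prob (?t b) (n b))" for n
      using lam by (intro prod_nonneg ballI poisson_prob_nonneg) simp
    have "of_nat (Suc (m a)) * emeasure D (count_event \<A> (m(a := Suc (m a)))) =
        ennreal (real (Suc (m a)) * (\<Prod>b\<in>\<A>. poisson_prob (?t b) ((m(a := Suc (m a))) b)))"
      using nn by (simp only: emeasure_count_event[OF A] ennreal_of_nat_eq_real_of_nat ennreal_mult of_nat_0_le_iff)
    also have "\<dots> = ennreal lam * emeasure lborel a * emeasure D (count_event \<A> m)"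
      using nn lam unfolding eq by (simp add: emeasure_count_event[OF A] ennreal_mult emeasure_bounded_eq J(3)[OF a])
    finally show ?thesis .
  qed
  have "emeasure (reduced_campbell D) (C \<times> count_event \<A> m) =
     (\<integral>\<^sup>+K. \<integral>\<^sup>+x. indicator C x * indicator (count_event \<A> m) (K - {x}) \<partial>count_space K \<partial>D)"
    by (subst emeasure_reduced_campbell[OF sets_D]) (auto simp: indicator_times)
  also have "\<dots> = (\<integral>\<^sup>+K. (\<Sum>a\<in>J. \<integral>\<^sup>+x. indicator a x * indicator (count_event \<A> m) (K - {x}) \<partial>count_space K) \<partial>D)"
    unfolding ind_C sum_distrib_right by (subst nn_integral_sum) auto
  also have "\<dots> = (\<integral>\<^sup>+K. (\<Sum>a\<in>J. of_nat (Suc (m a)) * indicator (count_event \<A> (m(a := Suc (m a)))) K) \<partial>D)"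
    by (intro nn_integral_cong sum.cong step) auto
  also have "\<dots> = (\<Sum>a\<in>J. \<integral>\<^sup>+K. of_nat (Suc (m a)) * indicator (count_event \<A> (m(a := Suc (m a)))) K \<partial>D)"
    by (rule nn_integral_sum) measurable
  also have "\<dots> = (\<Sum>a\<in>J. of_nat (Suc (m a)) * emeasure D (count_event \<A> (m(a := Suc (m a)))))"
    by (intro sum.cong refl nn_integral_cmult_indicator) (simp add: sets_D ev)
  also have "\<dots> = (\<Sum>a\<in>J. ennreal lam * emeasure lborel a * emeasure D (count_event \<A> m))"
    by (intro sum.cong refl summand)
  also have "\<dots> = ennreal lam * (\<Sum>a\<in>J. emeasure lborel a) * emeasure D (count_event \<A> m)"
    by (simp add: sum_distrib_left sum_distrib_right)
  also have "(\<Sum>a\<in>J. emeasure lborel a) = emeasure lborel C"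
    unfolding C_eq by (rule sum_emeasure) (use J in auto)
  finally show ?thesis .
qed

text \<open>For fixed \<open>C\<close> both sides are measures in \<open>E\<close>, called
  \<open>\<mu>\<close> and \<open>\<nu>\<close> in the proof, and \<open>config_measure_eqI\<close>
  asks for agreement only on count events whose pieces resolve \<open>C\<close>. These are the
  events for which the identity is already known.\<close>

lemma reduced_campbell_rectangle:
  assumes C: "bounded_borel C" and E: "E \<in> sets config_space"
  shows "emeasure (reduced_campbell D) (C \<times> E) = ennreal lam * emeasure lborel C * emeasure D E"
proof -
  have [measurable]: "C \<in> sets borel" using C by simp
  define \<mu> where "\<mu> = distr (density (reduced_campbell D) (indicator (C \<times> configurations))) config_space snd"
  define \<nu> where "\<nu> = scale_measure (ennreal lam * emeasure lborel C) D"
  have [measurable]: "configurations \<in> sets config_space"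
    using sets.top[of config_space] by simp
  have \<mu>: "emeasure \<mu> E = emeasure (reduced_campbell D) (C \<times> E)" if [measurable]: "E \<in> sets config_space" for E
  proof -
    have "snd -` E \<inter> space (density (reduced_campbell D) (indicator (C \<times> configurations))) = UNIV \<times> E"
      using sets.sets_into_space[OF that] by (auto simp: space_reduced_campbell)
    moreover have "UNIV \<times> E \<in> sets (reduced_campbell D)"
      by (simp add: sets_reduced_campbell)
    moreover have "(C \<times> configurations) \<inter> (UNIV \<times> E) = C \<times> E"
      using sets.sets_into_space[OF that] by auto
    moreover have "C \<times> configurations \<in> sets (reduced_campbell D)" by (simp add: sets_reduced_campbell)
    ultimately show ?thesis
      unfolding \<mu>_def by (subst emeasure_distr) (simp_all add: emeasure_density flip: indicator_inter_arith)
  qed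
  have "\<mu> = \<nu>"
  proof (rule config_measure_eqI[OF _ _ C])
    show "sets \<mu> = sets config_space" "sets \<nu> = sets config_space"
      by (simp_all add: \<mu>_def \<nu>_def sets_D)
    fix \<A> m assume "finite \<A>" "disjoint \<A>" "\<And>a. a \<in> \<A> \<Longrightarrow> bounded_borel a" "C = \<Union>{a \<in> \<A>. a \<subseteq> C}"
    note A = this
    have ev: "count_event \<A> m \<in> sets config_space" for m by (rule sets_count_event) (use A in auto)
    show "emeasure \<mu> (count_event \<A> m) = emeasure \<nu> (count_event \<A> m)"
      unfolding \<mu>[OF ev] \<nu>_def by (simp add: reduced_campbell_rectangle_count_event[OF A])
  next
    \<comment> \<open>The total mass is the mean number of points in \<open>C\<close>. To see that
      it is finite, decompose the configurations by this number and use the known identity on each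
      part.\<close>
    have "emeasure \<mu> (count_event {C} (\<lambda>_. k)) = emeasure \<nu> (count_event {C} (\<lambda>_. k))" for k
    proof -
      have "finite {C}" "disjoint {C}" "\<And>a. a \<in> {C} \<Longrightarrow> bounded_borel a" "C = \<Union>{a \<in> {C}. a \<subseteq> C}"
        using C by (auto simp: disjoint_def)
      note A = this
      have ev: "count_event {C} m \<in> sets config_space" for m by (rule sets_count_event) (use A in auto)
      show ?thesis
        unfolding \<mu>[OF ev] \<nu>_def using reduced_campbell_rectangle_count_event[of "{C}" C "\<lambda>_. k"] A by simp
    qed
    moreover have "emeasure \<rho> configurations = (\<Sum>k. emeasure \<rho> (count_event {C} (\<lambda>_. k)))"
      if "sets \<rho> = sets config_space" for \<rho>
    proof -
      have "range (\<lambda>k. count_event {C} (\<lambda>_. k)) \<subseteq> sets \<rho>"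
        using C by (auto simp: that intro!: sets_count_event)
      moreover have "disjoint_family (\<lambda>k. count_event {C} (\<lambda>_. k))"
        by (auto simp: disjoint_family_on_def count_event_def)
      ultimately have "(\<Sum>k. emeasure \<rho> (count_event {C} (\<lambda>_. k))) = emeasure \<rho> (\<Union>k. count_event {C} (\<lambda>_. k))"
        by (rule suminf_emeasure)
      also have "(\<Union>k. count_event {C} (\<lambda>_. k)) = configurations" by (auto simp: count_event_def)
      finally show ?thesis by simp
    qed
    ultimately have "emeasure \<mu> configurations = emeasure \<nu> configurations"
      by (simp add: \<mu>_def \<nu>_def sets_D)
    also have "\<dots> = ennreal lam * emeasure lborel C"
      by (simp add: \<nu>_def configurations_nonempty)
    finally show "emeasure \<mu> configurations \<noteq> \<infinity>"
      using emeasure_bounded_eq[OF C] by (simp add: ennreal_mult_eq_top_iff)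
  qed
  with \<mu>[OF E] show ?thesis by (simp add: \<nu>_def)
qed

text \<open>Rectangles over bounded Borel sets are intersection-stable and generate the product
  \<open>\<sigma>\<close>-algebra. Their first sides are bounded so that all masses are finite, and
  growing disks exhaust the plane.\<close>

lemma reduced_campbell_eq: "reduced_campbell D = scale_measure (ennreal lam) (lborel \<Otimes>\<^sub>M D)"
proof (rule measure_eqI_generator_eq[where \<Omega> = "UNIV \<times> configurations" and A = "\<lambda>n. cball 0 (real n) \<times> configurations"
      and E = "{C \<times> E | C E. bounded_borel C \<and> E \<in> sets config_space}"])
  let ?E = "{C \<times> E | C E. bounded_borel C \<and> E \<in> sets config_space}"
  have conf [simp]: "configurations \<in> sets config_space"
    using sets.top[of config_space] by simp
  show "Int_stable ?E"
  proof (rule Int_stableI)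
    fix X Y assume "X \<in> ?E" "Y \<in> ?E"
    then obtain C E C' E' where "X = C \<times> E" "Y = C' \<times> E'" "bounded_borel C" "bounded_borel C'"
      "E \<in> sets config_space" "E' \<in> sets config_space" by auto
    then show "X \<inter> Y \<in> ?E"
      by (intro CollectI exI[of _ "C \<inter> C'"] exI[of _ "E \<inter> E'"]) (auto intro: bounded_subset)
  qed
  show E_sub: "?E \<subseteq> Pow (UNIV \<times> configurations)"
    using sets.sets_into_space[where M = config_space] by fastforce
  have *: "sets (borel \<Otimes>\<^sub>M config_space) = sigma_sets (UNIV \<times> configurations) ?E"
  proof (rule antisym)
    show "sigma_sets (UNIV \<times> configurations) ?E \<subseteq> sets (borel \<Otimes>\<^sub>M config_space)"
    proof -
      have "?E \<subseteq> sets (borel \<Otimes>\<^sub>M config_space)" by auto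
      from sets.sigma_sets_subset[OF this] show ?thesis by (simp add: space_pair_measure)
    qed
    interpret S: sigma_algebra "UNIV \<times> configurations" "sigma_sets (UNIV \<times> configurations) ?E"
      by (rule sigma_algebra_sigma_sets[OF E_sub])
    have "C \<times> E \<in> sigma_sets (UNIV \<times> configurations) ?E"
      if "C \<in> sets borel" "E \<in> sets config_space" for C :: "plane set" and E
    proof -
      have "C \<times> E = (\<Union>n. (C \<inter> cball 0 (real n)) \<times> E)"
        using real_arch_simple by fastforce
      also have "\<dots> \<in> sigma_sets (UNIV \<times> configurations) ?E"
      proof (intro S.countable_UN sigma_sets.Basic image_subsetI)
        fix n :: nat
        have "bounded_borel (C \<inter> cball 0 (real n))" using that by (auto intro: bounded_subset)
        with that show "(C \<inter> cball 0 (real n)) \<times> E \<in> ?E" by blast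
      qed
      finally show ?thesis .
    qed
    then have "{a \<times> b | a b. a \<in> sets (borel :: plane measure) \<and> b \<in> sets config_space} \<subseteq>
        sigma_sets (UNIV \<times> configurations) ?E" by blast
    from S.sigma_sets_subset[OF this]
    show "sets (borel \<Otimes>\<^sub>M config_space) \<subseteq> sigma_sets (UNIV \<times> configurations) ?E"
      by (simp add: sets_pair_measure)
  qed
  show "sets (reduced_campbell D) = sigma_sets (UNIV \<times> configurations) ?E"
    using * by (simp add: sets_reduced_campbell)
  have "sets (lborel \<Otimes>\<^sub>M D) = sets (borel \<Otimes>\<^sub>M config_space)"
    by (intro sets_pair_measure_cong) (simp_all add: sets_D)
  from trans[OF this *]
  show "sets (scale_measure (ennreal lam) (lborel \<Otimes>\<^sub>M D)) = sigma_sets (UNIV \<times> configurations) ?E"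
    by (simp only: sets_scale_measure)
  show "range (\<lambda>n. cball 0 (real n) \<times> configurations) \<subseteq> ?E"
  proof (rule image_subsetI)
    fix n :: nat
    have "bounded_borel (cball 0 (real n))" by simp
    with conf show "cball 0 (real n) \<times> configurations \<in> ?E" by blast
  qed
  show "(\<Union>n. cball (0::plane) (real n) \<times> configurations) = UNIV \<times> configurations"
    using real_arch_simple by fastforce
  show "emeasure (reduced_campbell D) (cball 0 (real n) \<times> configurations) \<noteq> \<infinity>" for n
    by (subst reduced_campbell_rectangle)
       (simp_all add: configurations_nonempty emeasure_bounded_eq ennreal_mult_eq_top_iff)
  fix X assume "X \<in> ?E"
  then obtain C E where X: "X = C \<times> E" "bounded_borel C" "E \<in> sets config_space" by auto
  then show "emeasure (reduced_campbell D) X = emeasure (scale_measure (ennreal lam) (lborel \<Otimes>\<^sub>M D)) X"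
    by (simp add: reduced_campbell_rectangle emeasure_pair_measure_Times sets_D mult.assoc)
qed

theorem mecke:
  fixes f :: "plane \<times> plane set \<Rightarrow> ennreal"
  assumes "f \<in> borel_measurable (borel \<Otimes>\<^sub>M config_space)"
  shows "(\<integral>\<^sup>+A. \<integral>\<^sup>+x. f (x, A - {x}) \<partial>count_space A \<partial>D) =
    ennreal lam * (\<integral>\<^sup>+x. \<integral>\<^sup>+A. f (x, A) \<partial>D \<partial>lborel)"
proof -
  have sets_eq: "sets (lborel \<Otimes>\<^sub>M D) = sets (borel \<Otimes>\<^sub>M config_space)"
    by (intro sets_pair_measure_cong) (simp_all add: sets_D)
  have f: "f \<in> borel_measurable (lborel \<Otimes>\<^sub>M D)"
    using assms by (simp only: measurable_cong_sets[OF sets_eq refl])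
  have "(\<integral>\<^sup>+A. \<integral>\<^sup>+x. f (x, A - {x}) \<partial>count_space A \<partial>D) = integral\<^sup>N (reduced_campbell D) f"
    using assms
  proof (induction f rule: borel_measurable_induct)
    case (cong f g)
    have "(\<integral>\<^sup>+A. \<integral>\<^sup>+x. f (x, A - {x}) \<partial>count_space A \<partial>D) = (\<integral>\<^sup>+A. \<integral>\<^sup>+x. g (x, A - {x}) \<partial>count_space A \<partial>D)"
      by (intro nn_integral_cong cong) (auto simp: space_pair_measure intro: configurations_subset)
    moreover have "integral\<^sup>N (reduced_campbell D) f = integral\<^sup>N (reduced_campbell D) g"
      by (intro nn_integral_cong cong) (auto simp: space_pair_measure space_reduced_campbell)
    ultimately show ?case using cong by simp
  next
    case (set W)
    then show ?case by (simp add: emeasure_reduced_campbell[OF sets_D] sets_reduced_campbell)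
  next
    case (mult f c)
    note [measurable] = mult(2)
    show ?case by (simp add: nn_integral_cmult mult)
  next
    case (add f g)
    note [measurable] = add(1) add(3)
    show ?case by (simp add: nn_integral_add add)
  next
    case (seq F)
    note [measurable] = seq(1)
    have inc2: "incseq (\<lambda>i A. \<integral>\<^sup>+x. F i (x, A - {x}) \<partial>count_space A)"
      using seq(3) by (auto simp: incseq_def le_fun_def intro!: nn_integral_mono)
    have "(\<integral>\<^sup>+A. \<integral>\<^sup>+x. (SUP i. F i) (x, A - {x}) \<partial>count_space A \<partial>D) =
       (\<integral>\<^sup>+A. (SUP i. \<integral>\<^sup>+x. F i (x, A - {x}) \<partial>count_space A) \<partial>D)"
      unfolding SUP_apply
      by (intro nn_integral_cong nn_integral_monotone_convergence_SUP)
         (use seq(3) in \<open>auto simp: incseq_def le_fun_def\<close>)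
    also have "\<dots> = (SUP i. \<integral>\<^sup>+A. \<integral>\<^sup>+x. F i (x, A - {x}) \<partial>count_space A \<partial>D)"
      by (rule nn_integral_monotone_convergence_SUP[OF inc2]) measurable
    also have "\<dots> = (SUP i. integral\<^sup>N (reduced_campbell D) (F i))"
      by (simp add: seq)
    also have "\<dots> = (\<integral>\<^sup>+z. (SUP i. F i z) \<partial>reduced_campbell D)"
      by (rule nn_integral_monotone_convergence_SUP[symmetric, OF seq(3)]) measurable
    finally show ?case by (simp add: SUP_apply image_comp)
  qed
  also have "\<dots> = ennreal lam * integral\<^sup>N (lborel \<Otimes>\<^sub>M D) f"
    unfolding reduced_campbell_eq by (rule nn_integral_scale_measure[OF f])
  also have "integral\<^sup>N (lborel \<Otimes>\<^sub>M D) f = (\<integral>\<^sup>+x. \<integral>\<^sup>+A. f (x, A) \<partial>D \<partial>lborel)"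
    by (rule nn_integral_fst[symmetric, OF f])
  finally show ?thesis .
qed

end

section \<open>Invariance and the Palm version\<close>

text \<open>Uniqueness turns an invariance of counts into an invariance of the law. The choice
  \<open>C = {}\<close> imposes no condition on the refinement.\<close>

lemma poisson_law_unique:
  assumes "poisson_law D lam" "poisson_law D' lam"
  shows "D = D'"
proof -
  interpret D: poisson_law D lam by fact
  interpret D': poisson_law D' lam by fact
  show ?thesis
  proof (rule config_measure_eqI[where C = "{}"])
    show "sets D = sets config_space" by (rule D.sets_D)
    show "sets D' = sets config_space" by (rule D'.sets_D)
    show "emeasure D configurations \<noteq> \<infinity>" by (simp add: D.configurations_nonempty)
    show "emeasure D (count_event \<A> m) = emeasure D' (count_event \<A> m)"
      if "finite \<A>" "disjoint \<A>" "\<And>a. a \<in> \<A> \<Longrightarrow> bounded_borel a" for \<A> m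
      using D.emeasure_count_event[OF that] D'.emeasure_count_event[OF that] by simp
  qed simp
qed

lemma distr_lborel_translation: "distr lborel borel (\<lambda>y. y - x) = (lborel :: plane measure)"
proof -
  have "(\<lambda>y. y - x) = (+) (- x)" by auto
  then show ?thesis using lborel_distr_plus[of "- x"] by simp
qed

lemma borel_measurable_orthogonal:
  fixes T :: "plane \<Rightarrow> plane"
  assumes "orthogonal_transformation T"
  shows "T \<in> borel_measurable borel"
  using orthogonal_transformation_linear[OF assms]
  by (intro borel_measurable_continuous_onI linear_continuous_on linear_linear[THEN iffD2])

lemma bounded_vimage_orthogonal:
  assumes "orthogonal_transformation T" "bounded B"
  shows "bounded (T -` B)"
  using orthogonal_transformation_norm[OF assms(1)] assms(2) by (fastforce simp: bounded_iff)

lemma distr_lborel_orthogonal: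
  fixes T :: "plane \<Rightarrow> plane"
  assumes T: "orthogonal_transformation T"
  shows "distr lborel borel T = lborel"
proof (rule lborel_eqI[symmetric])
  note [measurable] = borel_measurable_orthogonal[OF T]
  have bij: "bij T" using T by (rule orthogonal_transformation_bij)
  have T': "orthogonal_transformation (inv T)" using T by (rule orthogonal_transformation_inv)
  fix l u :: plane assume le: "\<And>b. b \<in> Basis \<Longrightarrow> l \<bullet> b \<le> u \<bullet> b"
  have eq: "T -` box l u = inv T ` box l u" using bij by (rule bij_vimage_eq_inv_image)
  have borel: "T -` box l u \<in> sets borel" using measurable_sets[of T borel borel "box l u"] by simp
  have lm: "inv T ` box l u \<in> lmeasurable" "measure lebesgue (inv T ` box l u) = measure lebesgue (box l u)"
    using measurable_orthogonal_image[OF T', of "box l u"] measure_orthogonal_image[OF T', of "box l u"] by auto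
  have "emeasure (distr lborel borel T) (box l u) = emeasure lebesgue (T -` box l u)"
    using borel by (subst emeasure_distr) auto
  also have "\<dots> = ennreal (measure lebesgue (box l u))"
    unfolding eq using lm by (simp add: emeasure_eq_measure2)
  also have "\<dots> = emeasure lborel (box l u)"
    using emeasure_bounded_eq[of "box l u"] by simp
  also have "\<dots> = (\<Prod>b\<in>Basis. (u - l) \<bullet> b)"
    using le by (rule emeasure_lborel_box)
  finally show "emeasure (distr lborel borel T) (box l u) = (\<Prod>b\<in>Basis. (u - l) \<bullet> b)" .
qed simp

context poisson_law
begin

text \<open>Disjoint bounded Borel sets have preimages under \<open>T\<close> of the same kind and
  of the same area, so the image process has the same Poisson counts and uniqueness applies.\<close>

lemma distr_image:
  assumes bij: "bij T" and T [measurable]: "T \<in> borel_measurable borel"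
    and bdd: "\<And>B. bounded B \<Longrightarrow> bounded (T -` B)"
    and leb: "distr lborel borel T = lborel"
  shows "distr D config_space (image T) = D"
proof (rule poisson_law_unique)
  have meas [measurable]: "image T \<in> config_space \<rightarrow>\<^sub>M config_space"
    using measurable_config_image[of "\<lambda>_. T" config_space "\<lambda>A. A"] bij bdd
    by (simp add: bij_is_inj)
  interpret D': prob_space "distr D config_space (image T)"
    by (rule prob_space_distr) (simp add: sets_D cong: measurable_cong_sets)
  show "poisson_law (distr D config_space (image T)) lam"
  proof
    show "0 < lam" by (rule lam)
    fix \<A> m assume A: "finite \<A>" "disjoint \<A>" "\<And>a. a \<in> \<A> \<Longrightarrow> bounded_borel a"
    define \<B> where "\<B> = (\<lambda>a. T -` a) ` \<A>"
    have inj: "inj_on (\<lambda>a. T -` a) \<A>"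
      using bij by (intro inj_onI) (metis bij_is_surj surj_image_vimage_eq)
    have B: "finite \<B>" using A by (simp add: \<B>_def)
    have disj: "disjoint \<B>"
    proof (rule disjointI)
      fix b c assume "b \<in> \<B>" "c \<in> \<B>" "b \<noteq> c"
      then obtain a a' where "a \<in> \<A>" "a' \<in> \<A>" "a \<noteq> a'" "b = T -` a" "c = T -` a'"
        by (auto simp: \<B>_def)
      moreover from this A(2) have "a \<inter> a' = {}" by (auto simp: disjoint_def)
      ultimately show "b \<inter> c = {}" by auto
    qed
    have bb: "bounded_borel b" if "b \<in> \<B>" for b
      using that A(3) bdd measurable_sets[OF T] by (auto simp: \<B>_def)
    have card: "card (T ` K \<inter> a) = card (K \<inter> T -` a)" for K a
    proof -
      have "T ` K \<inter> a = T ` (K \<inter> T -` a)" by auto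
      moreover have "inj_on T (K \<inter> T -` a)" using bij by (auto simp: bij_def inj_on_def)
      ultimately show ?thesis by (simp add: card_image)
    qed
    have Ta: "T ` (T -` a) = a" for a using bij by (simp add: bij_is_surj surj_image_vimage_eq)
    have "image T -` count_event \<A> m \<inter> space D = count_event \<B> (\<lambda>b. m (T ` b))"
      using measurable_space[OF meas] bij_is_surj[OF bij]
      by (auto simp: count_event_def \<B>_def card Ta)
    then have "measure (distr D config_space (image T)) (count_event \<A> m) = prob (count_event \<B> (\<lambda>b. m (T ` b)))"
      by (subst measure_distr) (auto simp: sets_D intro!: sets_count_event A cong: measurable_cong_sets)
    also have "\<dots> = (\<Prod>b\<in>\<B>. poisson_prob (lam * measure lborel b) (m (T ` b)))"
      by (rule counts[OF B disj bb])
    also have "\<dots> = (\<Prod>a\<in>\<A>. poisson_prob (lam * measure lborel (T -` a)) (m a))"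
      unfolding \<B>_def by (subst prod.reindex[OF inj]) (simp add: Ta bij_is_surj[OF bij])
    also have "\<dots> = (\<Prod>a\<in>\<A>. poisson_prob (lam * measure lborel a) (m a))"
    proof (intro prod.cong refl)
      fix a assume "a \<in> \<A>"
      then have "measure (distr lborel borel T) a = measure lborel (T -` a)"
        using A(3) by (subst measure_distr) auto
      then show "poisson_prob (lam * measure lborel (T -` a)) (m a) = poisson_prob (lam * measure lborel a) (m a)"
        by (simp add: leb)
    qed
    finally show "measure (distr D config_space (image T)) (count_event \<A> m) =
       (\<Prod>a\<in>\<A>. poisson_prob (lam * measure lborel a) (m a))" .
  qed simp
qed unfold_locales

lemma distr_translation: "distr D config_space (image (\<lambda>y. y - x)) = D"
proof (rule distr_image)
  show "bij (\<lambda>y. y - x)" by (rule bij_betw_byWitness[where f' = "\<lambda>y. y + x"]) auto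
  fix B :: "plane set" assume "bounded B"
  then have "bounded ((+) x ` B)" by (rule bounded_translation)
  moreover have "(\<lambda>y. y - x) -` B = (+) x ` B"
    by (auto simp: image_iff intro!: bexI[where x = "_ - x"])
  ultimately show "bounded ((\<lambda>y. y - x) -` B)" by simp
qed (simp_all add: distr_lborel_translation)

lemma distr_orthogonal:
  assumes T: "orthogonal_transformation T"
  shows "distr D config_space (image T) = D"
proof (rule distr_image)
  show "bij T" using T by (rule orthogonal_transformation_bij)
  show "T \<in> borel_measurable borel" using T by (rule borel_measurable_orthogonal)
  show "bounded (T -` B)" if "bounded B" for B using T that by (rule bounded_vimage_orthogonal)
qed (rule distr_lborel_orthogonal[OF T])

text \<open>Slivnyak's theorem. The Palm identity is tested on the unit disk and on the event
  \<open>E'\<close> that the configuration without the origin lies in \<open>E\<close>. The Mecke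
  formula computes the resulting sum over points, translation invariance makes the inner expectation
  independent of \<open>x\<close>, and the common factor \<open>lam * pi\<close> cancels.\<close>

lemma palm_law:
  assumes D: "D = distr M config_space P" and P [measurable]: "P \<in> M \<rightarrow>\<^sub>M config_space"
    and palm: "palm_version M lam P N Po"
  shows "distr N config_space (\<lambda>v. Po v - {0}) = D"
proof (rule measure_eqI)
  have Po [measurable]: "Po \<in> N \<rightarrow>\<^sub>M config_space"
    using palm by (simp add: palm_version_def point_process_def)
  show "sets (distr N config_space (\<lambda>v. Po v - {0})) = sets D" by (simp add: sets_D)
  fix E assume "E \<in> sets (distr N config_space (\<lambda>v. Po v - {0}))"
  then have E [measurable]: "E \<in> sets config_space" by simp
  define B where "B = (cball 0 1 :: plane set)"
  have B: "bounded_borel B" and [measurable]: "B \<in> sets borel" by (simp_all add: B_def)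
  have volB: "emeasure lborel B = ennreal pi" "measure lborel B = pi"
    by (simp_all add: B_def emeasure_cball content_cball unit_ball_vol_numeral)
  define E' where "E' = {A \<in> space config_space. A - {0} \<in> E}"
  have E' [measurable]: "E' \<in> sets config_space" unfolding E'_def by measurable
  have shift [measurable]: "(\<lambda>z. (\<lambda>y. y - fst z) ` snd z) \<in> borel \<Otimes>\<^sub>M config_space \<rightarrow>\<^sub>M config_space"
  proof (rule measurable_config_image[where T = "\<lambda>z y. y - fst z" and F = snd])
    fix z :: "plane \<times> plane set" and B :: "plane set" assume "bounded B"
    then have "bounded ((+) (fst z) ` B)" by (rule bounded_translation)
    moreover have "(\<lambda>y. y - fst z) -` B = (+) (fst z) ` B"
      by (auto simp: image_iff intro!: bexI[where x = "_ - fst z"])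
    ultimately show "bounded ((\<lambda>y. y - fst z) -` B)" by simp
  qed (auto simp: inj_def)
  define f :: "plane \<times> plane set \<Rightarrow> ennreal" where
    "f z = indicator B (fst z) * indicator E ((\<lambda>y. y - fst z) ` snd z)" for z
  have f [measurable]: "f \<in> borel_measurable (borel \<Otimes>\<^sub>M config_space)" unfolding f_def by measurable
  have "of_nat (card {x \<in> A \<inter> B. (\<lambda>y. y - x) ` A \<in> E'}) = (\<integral>\<^sup>+x. f (x, A - {x}) \<partial>count_space A)"
    if A: "A \<in> configurations" for A
  proof -
    \<comment> \<open>The shift moves \<open>x\<close> to the origin, so deleting the origin after
      the shift amounts to deleting \<open>x\<close> before it. This puts the summand into the form
      of the Mecke formula.\<close>
    have iff: "(\<lambda>y. y - x) ` A \<in> E' \<longleftrightarrow> (\<lambda>y. y - x) ` (A - {x}) \<in> E" for x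
    proof -
      have "(\<lambda>y. y - x) ` A \<in> space config_space"
        using measurable_space[OF shift, of "(x, A)"] A by (simp add: space_pair_measure)
      moreover have "(\<lambda>y. y - x) ` A - {0} = (\<lambda>y. y - x) ` (A - {x})" by auto
      ultimately show ?thesis by (simp add: E'_def)
    qed
    have fin: "finite (A \<inter> B)" using A B by (auto intro: configurations_finite)
    have "(\<integral>\<^sup>+x. f (x, A - {x}) \<partial>count_space A) =
        (\<integral>\<^sup>+x. indicator {x \<in> B. (\<lambda>y. y - x) ` A \<in> E'} x \<partial>count_space A)"
      by (intro nn_integral_cong) (simp add: f_def iff indicator_def)
    also have "\<dots> = ennreal (card (A \<inter> {x \<in> B. (\<lambda>y. y - x) ` A \<in> E'}))"
      by (rule nn_integral_count_space_card) (rule finite_subset[OF _ fin], auto)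
    also have "A \<inter> {x \<in> B. (\<lambda>y. y - x) ` A \<in> E'} = {x \<in> A \<inter> B. (\<lambda>y. y - x) ` A \<in> E'}" by auto
    finally show ?thesis by (simp add: ennreal_of_nat_eq_real_of_nat)
  qed
  note cards = this
  have "ennreal (lam * pi) * emeasure N {v \<in> space N. Po v \<in> E'} =
      (\<integral>\<^sup>+w. of_nat (card {x \<in> P w \<inter> B. (\<lambda>y. y - x) ` P w \<in> E'}) \<partial>M)"
    using palm B E' unfolding palm_version_def volB(2)[symmetric] by blast
  also have "\<dots> = (\<integral>\<^sup>+w. \<integral>\<^sup>+x. f (x, P w - {x}) \<partial>count_space (P w) \<partial>M)"
    using measurable_space[OF P] by (intro nn_integral_cong cards) auto
  also have "\<dots> = (\<integral>\<^sup>+A. \<integral>\<^sup>+x. f (x, A - {x}) \<partial>count_space A \<partial>D)"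
    unfolding D by (subst nn_integral_distr) measurable
  also have "\<dots> = ennreal lam * (\<integral>\<^sup>+x. \<integral>\<^sup>+A. f (x, A) \<partial>D \<partial>lborel)"
    by (rule mecke[OF f])
  also have "(\<integral>\<^sup>+x. \<integral>\<^sup>+A. f (x, A) \<partial>D \<partial>lborel) = (\<integral>\<^sup>+x. emeasure D E * indicator B x \<partial>lborel)"
  proof (intro nn_integral_cong)
    fix x :: plane
    have [measurable]: "(`) (\<lambda>y. y - x) \<in> config_space \<rightarrow>\<^sub>M config_space"
      using measurable_compose[OF measurable_Pair1'[of x borel config_space] shift] by simp
    have "(\<integral>\<^sup>+A. f (x, A) \<partial>D) = indicator B x * (\<integral>\<^sup>+A. indicator E ((\<lambda>y. y - x) ` A) \<partial>D)"
      unfolding f_def fst_conv snd_conv by (rule nn_integral_cmult) measurable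
    also have "(\<integral>\<^sup>+A. indicator E ((\<lambda>y. y - x) ` A) \<partial>D) =
        (\<integral>\<^sup>+A. indicator E A \<partial>distr D config_space (image (\<lambda>y. y - x)))"
      by (subst nn_integral_distr) measurable
    also have "\<dots> = emeasure D E" by (simp add: distr_translation sets_D)
    finally show "(\<integral>\<^sup>+A. f (x, A) \<partial>D) = emeasure D E * indicator B x" by (simp add: mult.commute)
  qed
  also have "\<dots> = emeasure D E * ennreal pi"
    by (simp add: nn_integral_cmult_indicator volB)
  finally have "ennreal (lam * pi) * emeasure N {v \<in> space N. Po v \<in> E'} = ennreal (lam * pi) * emeasure D E"
    using lam by (simp add: ennreal_mult mult_ac)
  then have "emeasure N {v \<in> space N. Po v \<in> E'} = emeasure D E"
    using lam by (subst (asm) ennreal_mult_cancel_left) auto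
  moreover have "{v \<in> space N. Po v \<in> E'} = (\<lambda>v. Po v - {0}) -` E \<inter> space N"
    using measurable_space[OF Po] by (auto simp: E'_def)
  ultimately show "emeasure (distr N config_space (\<lambda>v. Po v - {0})) E = emeasure D E"
    by (simp add: emeasure_distr)
qed

end

text \<open>For \<open>x\<close> in \<open>P\<close> the shifted configuration \<open>P - x\<close>
  always contains the origin. The Palm identity, applied to the event that the origin is missing,
  therefore has a vanishing right-hand side.\<close>

lemma palm_origin:
  assumes "lam > 0" and palm: "palm_version M lam P N Po"
  shows "AE v in N. 0 \<in> Po v"
proof -
  have Po [measurable]: "Po \<in> N \<rightarrow>\<^sub>M config_space"
    using palm by (simp add: palm_version_def point_process_def)
  define A where "A = {A \<in> configurations. card (A \<inter> {0}) = 0}"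
  have A: "A \<in> sets config_space"
    unfolding sets_config_space by (rule sigma_sets.Basic) (auto simp: A_def intro!: exI[of _ "{0}"] exI[of _ 0])
  have "ennreal (lam * measure lborel (cball 0 1 :: plane set)) * emeasure N {v \<in> space N. Po v \<in> A} =
      (\<integral>\<^sup>+w. of_nat (card {x \<in> P w \<inter> cball 0 1. (\<lambda>y. y - x) ` P w \<in> A}) \<partial>M)"
  proof -
    have "\<forall>B A. B \<in> sets borel \<longrightarrow> bounded B \<longrightarrow> A \<in> sets config_space \<longrightarrow>
        ennreal (lam * measure lborel B) * emeasure N {v \<in> space N. Po v \<in> A} =
          (\<integral>\<^sup>+ w. of_nat (card {x \<in> P w \<inter> B. (\<lambda>y. y - x) ` P w \<in> A}) \<partial>M)"
      using palm unfolding palm_version_def by simp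
    from this[rule_format, of "cball 0 1" A] A show ?thesis by simp
  qed
  also have "\<dots> = (\<integral>\<^sup>+w. 0 \<partial>M)"
  proof (intro nn_integral_cong)
    fix w
    have "0 \<in> (\<lambda>y. y - x) ` P w" if "x \<in> P w" for x using that by force
    then have "{x \<in> P w \<inter> cball 0 1. (\<lambda>y. y - x) ` P w \<in> A} = {}"
      by (auto simp: A_def)
    then show "of_nat (card {x \<in> P w \<inter> cball 0 1. (\<lambda>y. y - x) ` P w \<in> A}) = (0::ennreal)"
      by (simp only: card.empty of_nat_0)
  qed
  finally have "emeasure N {v \<in> space N. Po v \<in> A} = 0"
    using assms(1) by (simp add: content_cball unit_ball_vol_numeral)
  then have "AE v in N. Po v \<notin> A"
    using A by (subst AE_iff_measurable[OF _ refl]) simp_all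
  then show ?thesis
    by (rule AE_mp) (use measurable_space[OF Po] in \<open>auto simp: A_def intro!: AE_I2\<close>)
qed

section \<open>Voronoi cells\<close>

lemma closed_voronoi_cell: "closed (voronoi_cell A x)"
proof -
  have "voronoi_cell A x = (\<Inter>z\<in>A. {y. dist y x \<le> dist y z})"
    by (auto simp: voronoi_cell_def)
  also have "closed \<dots>"
    by (intro closed_INT ballI closed_Collect_le continuous_intros)
  finally show ?thesis .
qed

lemma voronoi_cell_sets [simp, measurable]: "voronoi_cell A x \<in> sets borel"
  using closed_voronoi_cell by (rule borel_closed)

text \<open>Thus quantities attached to the cell of a point of \<open>A\<close> depend only on the remaining points, which
  is the form required by the Mecke formula.\<close>

lemma voronoi_cell_remove: "voronoi_cell (insert 0 (A - {x})) x = voronoi_cell (insert 0 A) x"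
  by (auto simp: voronoi_cell_def)

text \<open>Replaces a quantifier over the random points by an equation for a sum, whose
  measurability is known.\<close>

lemma sum_config_eq_0_iff:
  fixes f :: "plane \<Rightarrow> ennreal"
  shows "(\<integral>\<^sup>+y. f y \<partial>count_space A) = 0 \<longleftrightarrow> (\<forall>y\<in>A. f y = 0)"
  by (simp add: nn_integral_0_iff_AE AE_count_space)

lemma measurable_in_voronoi_cell [measurable (raw)]:
  assumes [measurable]: "x \<in> S \<rightarrow>\<^sub>M borel" "y \<in> S \<rightarrow>\<^sub>M borel" "F \<in> S \<rightarrow>\<^sub>M config_space"
  shows "Measurable.pred S (\<lambda>s. y s \<in> voronoi_cell (insert 0 (F s)) (x s))"
proof -
  have "y s \<in> voronoi_cell (insert 0 (F s)) (x s) \<longleftrightarrow> dist (y s) (x s) \<le> dist (y s) 0 \<and>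
      (\<integral>\<^sup>+z. indicator {z. dist (y s) z < dist (y s) (x s)} z \<partial>count_space (F s)) = 0" for s
    by (auto simp: sum_config_eq_0_iff voronoi_cell_def indicator_def not_less)
  moreover have "Measurable.pred S (\<lambda>s. dist (y s) (x s) \<le> dist (y s) 0 \<and>
      (\<integral>\<^sup>+z. indicator {z. dist (y s) z < dist (y s) (x s)} z \<partial>count_space (F s)) = 0)"
    by measurable
  ultimately show ?thesis by simp
qed

section \<open>Cell areas and the uniform density on a cell\<close>

definition cell_area :: "plane set \<Rightarrow> plane \<Rightarrow> ennreal" where
  "cell_area A x = emeasure lborel (voronoi_cell (insert 0 A) x)"

lemma measurable_cell_area [measurable (raw)]:
  assumes [measurable]: "x \<in> S \<rightarrow>\<^sub>M borel" "F \<in> S \<rightarrow>\<^sub>M config_space"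
  shows "(\<lambda>s. cell_area (F s) (x s)) \<in> borel_measurable S"
proof -
  have "(\<lambda>s. \<integral>\<^sup>+y. indicator (voronoi_cell (insert 0 (F s)) (x s)) y \<partial>lborel) \<in> borel_measurable S"
    by measurable
  then show ?thesis by (simp add: cell_area_def)
qed

text \<open>In \<open>ennreal\<close> this stays meaningful in degenerate cases: an infinite area
  gives density 0, and on a cell of area 0 the value is infinite. Almost surely neither occurs at a
  point of the process, see \<open>AE_cell_area\<close>.\<close>

definition cell_density :: "plane set \<Rightarrow> plane \<Rightarrow> plane \<Rightarrow> ennreal" where
  "cell_density A x y = indicator (voronoi_cell (insert 0 A) x) y * inverse (cell_area A x)"

lemma measurable_cell_density [measurable (raw)]:
  assumes [measurable]: "x \<in> S \<rightarrow>\<^sub>M borel" "y \<in> S \<rightarrow>\<^sub>M borel" "F \<in> S \<rightarrow>\<^sub>M config_space"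
  shows "(\<lambda>s. cell_density (F s) (x s) (y s)) \<in> borel_measurable S"
  unfolding cell_density_def by measurable

lemma measurable_cell_density_point [measurable]: "cell_density A x \<in> borel_measurable borel"
  unfolding cell_density_def[abs_def] by measurable

lemma cell_density_remove: "cell_density (A - {x}) x y = cell_density A x y"
  by (simp add: cell_density_def cell_area_def voronoi_cell_remove)

lemma nn_integral_cell_density:
  assumes [measurable]: "B \<in> sets borel"
  shows "(\<integral>\<^sup>+y. cell_density A x y * indicator B y \<partial>lborel) =
    emeasure lborel (voronoi_cell (insert 0 A) x \<inter> B) / cell_area A x"
proof -
  have "(\<integral>\<^sup>+y. cell_density A x y * indicator B y \<partial>lborel) =
      (\<integral>\<^sup>+y. inverse (cell_area A x) * indicator (voronoi_cell (insert 0 A) x \<inter> B) y \<partial>lborel)"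
    by (intro nn_integral_cong) (auto simp: cell_density_def indicator_def)
  also have "\<dots> = inverse (cell_area A x) * emeasure lborel (voronoi_cell (insert 0 A) x \<inter> B)"
    by (rule nn_integral_cmult_indicator) simp
  finally show ?thesis by (simp add: divide_ennreal_def mult.commute)
qed

lemma cell_density_orthogonal:
  assumes T: "orthogonal_transformation T"
  shows "cell_density (T ` A) (T x) (T y) = cell_density A x y"
proof -
  have lin: "linear T" using T by (rule orthogonal_transformation_linear)
  note [measurable] = borel_measurable_orthogonal[OF T]
  have dist: "dist (T a) (T b) = dist a b" for a b
    using T by (simp add: orthogonal_transformation_isometry)
  have T0: "T 0 = 0" using lin by (rule linear_0)
  have cell: "T w \<in> voronoi_cell (insert 0 (T ` A)) (T x) \<longleftrightarrow> w \<in> voronoi_cell (insert 0 A) x" for w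
    using dist[of w 0] by (simp add: voronoi_cell_def dist T0)
  have "cell_area (T ` A) (T x) = emeasure (distr lborel borel T) (voronoi_cell (insert 0 (T ` A)) (T x))"
    by (simp add: cell_area_def distr_lborel_orthogonal[OF T])
  also have "\<dots> = emeasure lborel (T -` voronoi_cell (insert 0 (T ` A)) (T x))"
    by (simp add: emeasure_distr)
  also have "T -` voronoi_cell (insert 0 (T ` A)) (T x) = voronoi_cell (insert 0 A) x"
    using cell by auto
  finally have "cell_area (T ` A) (T x) = cell_area A x" by (simp add: cell_area_def)
  then show ?thesis by (simp add: cell_density_def cell indicator_def)
qed

context poisson_law
begin

text \<open>The function \<open>h\<close> of the overview.\<close>

definition user_density :: "plane \<Rightarrow> ennreal" where
  "user_density y = ennreal lam * (\<integral>\<^sup>+x. \<integral>\<^sup>+A. cell_density A x y \<partial>D \<partial>lborel)"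

lemma measurable_user_density [measurable]: "user_density \<in> borel_measurable borel"
  unfolding user_density_def by measurable

text \<open>The share of a cell that falls in \<open>B\<close> is unchanged when its own nucleus is
  deleted from the configuration, so the Mecke formula applies to it. Writing the share as an
  integral of \<open>cell_density\<close> and using Fubini's theorem brings the integration over
  \<open>y\<close> to the outside.\<close>

lemma sum_cell_density:
  assumes B [measurable]: "B \<in> sets borel"
  shows "(\<integral>\<^sup>+A. \<integral>\<^sup>+x. emeasure lborel (voronoi_cell (insert 0 A) x \<inter> B) / cell_area A x \<partial>count_space A \<partial>D) =
    (\<integral>\<^sup>+y. user_density y * indicator B y \<partial>lborel)"
proof -
  interpret PS: pair_sigma_finite lborel D ..
  define f where "f z = (\<integral>\<^sup>+y. cell_density (snd z) (fst z) y * indicator B y \<partial>lborel)" for z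
  have f [measurable]: "f \<in> borel_measurable (borel \<Otimes>\<^sub>M config_space)"
    unfolding f_def by measurable
  have "(\<integral>\<^sup>+A. \<integral>\<^sup>+x. emeasure lborel (voronoi_cell (insert 0 A) x \<inter> B) / cell_area A x \<partial>count_space A \<partial>D) =
      (\<integral>\<^sup>+A. \<integral>\<^sup>+x. f (x, A - {x}) \<partial>count_space A \<partial>D)"
    by (simp add: f_def cell_density_remove nn_integral_cell_density[OF B])
  also have "\<dots> = ennreal lam * (\<integral>\<^sup>+x. \<integral>\<^sup>+A. f (x, A) \<partial>D \<partial>lborel)"
    by (rule mecke[OF f])
  also have "(\<integral>\<^sup>+x. \<integral>\<^sup>+A. f (x, A) \<partial>D \<partial>lborel) =
      (\<integral>\<^sup>+x. \<integral>\<^sup>+y. \<integral>\<^sup>+A. cell_density A x y * indicator B y \<partial>D \<partial>lborel \<partial>lborel)"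
    unfolding f_def fst_conv snd_conv
    by (intro nn_integral_cong PS.Fubini') measurable
  also have "\<dots> = (\<integral>\<^sup>+y. \<integral>\<^sup>+x. \<integral>\<^sup>+A. cell_density A x y * indicator B y \<partial>D \<partial>lborel \<partial>lborel)"
    by (rule lborel_pair.Fubini') measurable
  also have "\<dots> = (\<integral>\<^sup>+y. (\<integral>\<^sup>+x. \<integral>\<^sup>+A. cell_density A x y \<partial>D \<partial>lborel) * indicator B y \<partial>lborel)"
    by (simp add: nn_integral_multc)
  also have "ennreal lam * \<dots> = (\<integral>\<^sup>+y. user_density y * indicator B y \<partial>lborel)"
    unfolding user_density_def mult.assoc by (rule nn_integral_cmult[symmetric]) measurable
  finally show ?thesis .
qed

lemma user_density_orthogonal:
  assumes T: "orthogonal_transformation T"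
  shows "user_density (T y) = user_density y"
proof -
  note [measurable] = borel_measurable_orthogonal[OF T]
  have image [measurable]: "image T \<in> config_space \<rightarrow>\<^sub>M config_space"
    using measurable_config_image[of "\<lambda>_. T" config_space "\<lambda>A. A"] orthogonal_transformation_bij[OF T]
      bounded_vimage_orthogonal[OF T] by (simp add: bij_is_inj)
  have "(\<integral>\<^sup>+x. \<integral>\<^sup>+A. cell_density A x (T y) \<partial>D \<partial>lborel) =
     (\<integral>\<^sup>+x. \<integral>\<^sup>+A. cell_density A x (T y) \<partial>D \<partial>distr lborel borel T)"
    by (simp add: distr_lborel_orthogonal[OF T])
  also have "\<dots> = (\<integral>\<^sup>+x. \<integral>\<^sup>+A. cell_density A (T x) (T y) \<partial>D \<partial>lborel)"
    by (subst nn_integral_distr) measurable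
  also have "\<dots> = (\<integral>\<^sup>+x. \<integral>\<^sup>+A. cell_density A (T x) (T y) \<partial>distr D config_space (image T) \<partial>lborel)"
    by (simp add: distr_orthogonal[OF T])
  also have "\<dots> = (\<integral>\<^sup>+x. \<integral>\<^sup>+A. cell_density (T ` A) (T x) (T y) \<partial>D \<partial>lborel)"
    by (subst nn_integral_distr) measurable
  finally show ?thesis by (simp add: user_density_def cell_density_orthogonal[OF T])
qed

lemma user_density_radial: "norm y = norm z \<Longrightarrow> user_density y = user_density z"
  by (metis orthogonal_transformation_exists user_density_orthogonal)

end

section \<open>A bound for the inverse area of a cell\<close>

text \<open>The two nearest points may be placed so badly that the cell is a thin wedge, or a thin strip.
  Choose orthogonal unit directions \<open>u\<close> and \<open>w\<close> such that \<open>u\<close> points away from both of them and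
  \<open>w\<close> points away from \<open>c\<close>. Then the rectangle spanned by \<open>\<tau> / 4\<close> times \<open>u\<close> and \<open>\<sigma> / 4\<close> times \<open>w\<close>
  lies in the cell. The distance of \<open>c\<close> does not enter: this is what makes the bound integrable.\<close>

lemma voronoi_cell_area_ge:
  fixes x c e :: plane
  assumes A: "\<And>z. z \<in> A \<Longrightarrow> z = c \<or> z = e \<or> \<tau> \<le> dist x z"
    and e: "\<sigma> \<le> dist x e" and pos: "0 < \<sigma>" "\<sigma> \<le> \<tau>"
  shows "ennreal (\<sigma> * \<tau> / 16) \<le> emeasure lborel (voronoi_cell A x)"
proof -
  define a where "a = c - x"
  define b where "b = e - x"
  \<comment> \<open>If \<open>c\<close> coincides with \<open>x\<close> there is no direction to
    avoid, and a fixed unit vector is taken.\<close>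
  define w where "w = (if a = 0 then axis 2 1 else - (1 / norm a) *\<^sub>R a)"
  have sym: "norm (axis 2 1 :: plane) = norm w" by (simp add: w_def norm_axis_1)
  obtain T :: "plane \<Rightarrow> plane" where T: "orthogonal_transformation T" and Tw: "T (axis 2 1) = w"
    by (rule orthogonal_transformation_exists[OF sym]) (rule that)
  define u where "u = T (axis 1 1)"
  have lin: "linear T" using T by (rule orthogonal_transformation_linear)
  note [measurable] = borel_measurable_orthogonal[OF T]
  have "u \<bullet> w = axis 1 1 \<bullet> (axis 2 1 :: plane)"
    using T by (simp add: u_def Tw[symmetric] orthogonal_transformation_def)
  then have uw: "u \<bullet> w = 0" by (simp add: inner_axis_axis)
  have a_eq: "a = - norm a *\<^sub>R w" by (simp add: w_def)
  have ua: "u \<bullet> a = 0" by (subst a_eq) (simp add: uw)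
  have wa: "w \<bullet> a \<le> 0" by (simp add: w_def)
  have nw: "norm w = 1" by (simp add: w_def norm_axis_1)
  have Tv: "T v = v $ 1 *\<^sub>R u + v $ 2 *\<^sub>R w" for v
  proof -
    have "v = v $ 1 *\<^sub>R axis 1 1 + v $ 2 *\<^sub>R axis 2 1"
      by (simp add: vec_eq_iff axis_def forall_2)
    then have "T v = T (v $ 1 *\<^sub>R axis 1 1 + v $ 2 *\<^sub>R axis 2 1)" by simp
    then show ?thesis using lin by (simp add: linear_add linear_scale u_def Tw)
  qed
  \<comment> \<open>The rectangle extends from \<open>x\<close> along \<open>u\<close> or along
    \<open>-u\<close>, whichever does not lead towards \<open>e\<close>.\<close>
  define l where "l = (if u \<bullet> b \<le> 0 then 0 else - \<tau> / 4)"
  define R :: "plane set" where "R = cbox (vector [l, 0]) (vector [l + \<tau> / 4, \<sigma> / 4])"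
  have R: "l \<le> v $ 1" "v $ 1 \<le> l + \<tau> / 4" "0 \<le> v $ 2" "v $ 2 \<le> \<sigma> / 4" if "v \<in> R" for v
    using that by (simp_all add: R_def mem_box_cart forall_2 vector_2)
  have area_R: "measure lborel R = (\<tau> / 4) * (\<sigma> / 4)"
  proof -
    have "R \<noteq> {}"
      unfolding R_def interval_ne_empty_cart using pos by (simp add: forall_2 vector_2)
    then show ?thesis
      unfolding R_def by (subst content_cbox_cart) (simp_all add: UNIV_2 vector_2)
  qed
  have "emeasure lborel R = ennreal (measure lborel R)"
    by (rule emeasure_bounded_eq) (simp add: R_def)
  then have eR: "emeasure lborel R = ennreal (\<sigma> * \<tau> / 16)"
    by (simp add: area_R mult.commute)
  have "x + T v \<in> voronoi_cell A x" if v: "v \<in> R" for v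
    unfolding voronoi_cell_def
  proof (intro CollectI ballI)
    fix z assume z: "z \<in> A"
    define d where "d = z - x"
    \<comment> \<open>Expanding squares, this says that \<open>x + T v\<close> is at least as close
      to \<open>x\<close> as to \<open>z\<close>.\<close>
    have "2 * (T v \<bullet> d) \<le> d \<bullet> d"
      using A[OF z]
    proof (elim disjE)
      assume "z = c"
      then have "T v \<bullet> d = v $ 2 * (w \<bullet> a)" by (simp add: d_def a_def[symmetric] Tv inner_add_left ua)
      also have "\<dots> \<le> 0" using R[OF v] wa by (simp add: mult_nonneg_nonpos)
      finally show ?thesis using inner_ge_zero[of d] by linarith
    next
      assume "z = e"
      then have d: "d = b" by (simp add: d_def b_def)
      have nb: "\<sigma> \<le> norm b" using e by (simp add: b_def dist_norm norm_minus_commute)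
      \<comment> \<open>By the choice of \<open>l\<close> the part along \<open>u\<close> cannot
        bring the point closer to \<open>e\<close>. The part along \<open>w\<close> has length at
        most \<open>\<sigma> / 4\<close>, hence at most a quarter of the distance of
        \<open>e\<close>.\<close>
      have 1: "v $ 1 * (u \<bullet> b) \<le> 0"
        using R[OF v] by (auto simp: l_def mult_nonneg_nonpos mult_nonpos_nonneg split: if_splits)
      have "w \<bullet> b \<le> norm b" using norm_cauchy_schwarz[of w b] nw by simp
      then have "v $ 2 * (w \<bullet> b) \<le> v $ 2 * norm b" using R[OF v] by (intro mult_left_mono)
      also have "\<dots> \<le> (norm b / 4) * norm b" using R[OF v] nb by (intro mult_right_mono) auto
      finally have "T v \<bullet> d \<le> norm b * norm b / 4" using 1 by (simp add: d Tv inner_add_left)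
      moreover have "0 \<le> norm b * norm b" by simp
      moreover have "d \<bullet> d = norm b * norm b" by (simp add: d dot_square_norm power2_eq_square)
      ultimately show ?thesis by linarith
    next
      assume "\<tau> \<le> dist x z"
      then have nd: "\<tau> \<le> norm d" by (simp add: d_def dist_norm norm_minus_commute)
      \<comment> \<open>Both sides of the rectangle are at most \<open>\<tau> / 4\<close>, so its
        points are within \<open>\<tau> / 2\<close> of \<open>x\<close>, at most half the distance
        of \<open>z\<close>.\<close>
      have "norm (T v) = norm v" using T by (rule orthogonal_transformation_norm)
      also have "\<dots> \<le> \<bar>v $ 1\<bar> + \<bar>v $ 2\<bar>" using norm_le_l1_cart[of v] by (simp add: UNIV_2)
      also have "\<dots> \<le> \<tau> / 2" using R[OF v] pos by (auto simp: l_def split: if_splits)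
      finally have "norm (T v) \<le> norm d / 2" using nd by simp
      then have "norm (T v) * norm d \<le> norm d / 2 * norm d" by (intro mult_right_mono) auto
      with norm_cauchy_schwarz[of "T v" d] show ?thesis by (simp add: dot_square_norm power2_eq_square)
    qed
    then have "T v \<bullet> T v \<le> (T v - d) \<bullet> (T v - d)"
      by (simp add: inner_diff_left inner_diff_right inner_commute)
    then have "norm (T v) \<le> norm (T v - d)" by (simp add: norm_le)
    then show "dist (x + T v) x \<le> dist (x + T v) z" by (simp add: dist_norm d_def algebra_simps)
  qed
  then have sub: "R \<subseteq> (\<lambda>v. T v - (- x)) -` voronoi_cell A x" by (auto simp: add.commute)
  have "distr lborel borel (\<lambda>v. T v - (- x)) = distr (distr lborel borel T) borel (\<lambda>y. y - (- x))"
    by (subst distr_distr) (auto simp: o_def)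
  then have leb: "distr lborel borel (\<lambda>v. T v - (- x)) = lborel"
    by (simp only: distr_lborel_orthogonal[OF T] distr_lborel_translation)
  have "emeasure lborel R \<le> emeasure lborel ((\<lambda>v. T v - (- x)) -` voronoi_cell A x)"
  proof (rule emeasure_mono[OF sub])
    have "(\<lambda>v. T v - (- x)) \<in> borel_measurable borel" by measurable
    from measurable_sets[OF this voronoi_cell_sets[of A x]]
    show "(\<lambda>v. T v - (- x)) -` voronoi_cell A x \<in> sets lborel" by simp
  qed
  also have "\<dots> = emeasure (distr lborel borel (\<lambda>v. T v - (- x))) (voronoi_cell A x)"
    by (subst emeasure_distr) auto
  finally show ?thesis by (simp only: leb eR)
qed

section \<open>Domination of the inverse area by sums over nearby points\<close>

definition inv_dist :: "plane \<Rightarrow> plane \<Rightarrow> ennreal" where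
  "inv_dist x z = indicator (cball x 1) z * inverse (ennreal (dist x z))"

lemma measurable_inv_dist [measurable (raw)]:
  assumes [measurable]: "f \<in> S \<rightarrow>\<^sub>M borel" "g \<in> S \<rightarrow>\<^sub>M borel"
  shows "(\<lambda>s. inv_dist (f s) (g s)) \<in> borel_measurable S"
  unfolding inv_dist_def cball_def by measurable

definition near_sum :: "plane \<Rightarrow> plane set \<Rightarrow> ennreal" where
  "near_sum x A = (\<integral>\<^sup>+z. inv_dist x z \<partial>count_space A)"

text \<open>A sum over ordered pairs of distinct points. It dominates the single term
  \<open>1 / (d\<^sub>1 d\<^sub>2)\<close>, and unlike that term it has a mean that the Mecke
  formula computes exactly.\<close>

definition near_pair_sum :: "plane \<Rightarrow> plane set \<Rightarrow> ennreal" where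
  "near_pair_sum x A = (\<integral>\<^sup>+z. inv_dist x z * near_sum x (A - {z}) \<partial>count_space A)"

text \<open>The three summands serve the cases of no point, one point and at least two points within
  distance 1 of \<open>x\<close>.\<close>

definition area_bound :: "plane \<Rightarrow> plane set \<Rightarrow> ennreal" where
  "area_bound x A = 16 * (1 + near_sum x A + near_pair_sum x A)"

lemma measurable_near_sum [measurable (raw)]:
  assumes [measurable]: "x \<in> S \<rightarrow>\<^sub>M borel" "F \<in> S \<rightarrow>\<^sub>M config_space"
  shows "(\<lambda>s. near_sum (x s) (F s)) \<in> borel_measurable S"
  unfolding near_sum_def by measurable

lemma measurable_near_pair_sum [measurable (raw)]:
  assumes [measurable]: "x \<in> S \<rightarrow>\<^sub>M borel" "F \<in> S \<rightarrow>\<^sub>M config_space"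
  shows "(\<lambda>s. near_pair_sum (x s) (F s)) \<in> borel_measurable S"
  unfolding near_pair_sum_def by measurable

lemma measurable_area_bound [measurable (raw)]:
  assumes [measurable]: "x \<in> S \<rightarrow>\<^sub>M borel" "F \<in> S \<rightarrow>\<^sub>M config_space"
  shows "(\<lambda>s. area_bound (x s) (F s)) \<in> borel_measurable S"
  unfolding area_bound_def by measurable

lemma inverse_le_of_ge:
  assumes "ennreal (a / 16) \<le> v" "0 < a" "inverse (ennreal a) \<le> s"
  shows "inverse v \<le> 16 * (s :: ennreal)"
proof -
  have "inverse v \<le> inverse (ennreal (a / 16))" 
  proof (cases v)
    case (real r)
    then have "a / 16 \<le> r" using assms(1) by simp
    moreover from this have "inverse r \<le> inverse (a / 16)"
      using assms(2) by (intro le_imp_inverse_le) auto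
    ultimately show ?thesis
      using assms(2) real by (simp only: inverse_ennreal ennreal_leI)
  qed simp
  also have "\<dots> = ennreal 16 * inverse (ennreal a)"
  proof -
    have "inverse (ennreal (a / 16)) = ennreal (16 * inverse a)"
    proof -
      have "inverse (ennreal (a / 16)) = ennreal (inverse (a / 16))"
        using assms(2) by (intro inverse_ennreal) simp
      also have "inverse (a / 16) = 16 * inverse a" by (simp add: field_simps)
      finally show ?thesis .
    qed
    also have "\<dots> = ennreal 16 * ennreal (inverse a)"
      using assms(2) by (intro ennreal_mult) auto
    finally show ?thesis using assms(2) by (simp only: inverse_ennreal)
  qed
  also have "\<dots> \<le> 16 * s" using assms(3) by (auto intro: mult_left_mono)
  finally show ?thesis .
qed

text \<open>The origin may be arbitrarily close to \<open>x\<close> and plays the part of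
  \<open>c\<close>, whose distance is irrelevant. The nearest point of \<open>A\<close> within
  distance 1 plays the part of \<open>e\<close>, and \<open>\<tau>\<close> is the distance of the
  second nearest, or 1. If \<open>x\<close> itself belongs to \<open>A\<close>, the term
  \<open>inv_dist x x\<close> is infinite and there is nothing to prove.\<close>

lemma inverse_cell_area_le:
  assumes "A \<in> configurations"
  shows "inverse (cell_area A x) \<le> area_bound x A"
proof (cases "x \<in> A")
  case True
  have "inv_dist x x \<le> near_sum x A"
    unfolding near_sum_def using True by (rule nn_integral_ge_point)
  then have "near_sum x A = \<infinity>" by (simp add: inv_dist_def top_unique)
  then show ?thesis by (simp add: area_bound_def ennreal_mult_top)
next
  case False
  define F where "F = A \<inter> cball x 1"
  have fin: "finite F" unfolding F_def using assms by (rule configurations_finite) simp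
  have pos: "0 < dist x z" if "z \<in> A" for z using that False by auto
  have far: "1 \<le> dist x z" if "z \<in> A" "z \<notin> F" for z using that by (auto simp: F_def)
  have near: "dist x z \<le> 1" "z \<in> A" if "z \<in> F" for z using that by (auto simp: F_def)
  have near_inv: "inv_dist x z = inverse (ennreal (dist x z))" if "z \<in> F" for z
    using near[OF that] by (simp add: inv_dist_def)
  show ?thesis
  proof (cases "F = {}")
    case True
    have "ennreal (1 * 1 / 16) \<le> cell_area A x"
      unfolding cell_area_def
    \<comment> \<open>With no point nearby, \<open>e\<close> is a dummy at distance exactly 1, so
      that both side parameters equal 1.\<close>
    proof (rule voronoi_cell_area_ge[where c = 0 and e = "x + axis 1 1"])
      fix z assume "z \<in> insert 0 A"
      then show "z = 0 \<or> z = x + axis 1 1 \<or> 1 \<le> dist x z" using True far by auto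
    qed (simp_all add: dist_norm norm_axis_1)
    then have "inverse (cell_area A x) \<le> 16 * 1" by (rule inverse_le_of_ge) simp_all
    also have "\<dots> \<le> area_bound x A" unfolding area_bound_def by (intro mult_left_mono) (auto simp: add.assoc)
    finally show ?thesis .
  next
    case False
    define p where "p = arg_min_on (dist x) F"
    have p: "p \<in> F" "\<And>z. z \<in> F \<Longrightarrow> dist x p \<le> dist x z"
      unfolding p_def using arg_min_if_finite(1)[OF fin False, of "dist x"] arg_min_least[OF fin False, of _ "dist x"] by auto
    have pA: "p \<in> A" "dist x p \<le> 1" "0 < dist x p" using near[OF p(1)] pos by auto
    show ?thesis
    proof (cases "F - {p} = {}")
      case True
      have "ennreal (dist x p * 1 / 16) \<le> cell_area A x"
        unfolding cell_area_def
      proof (rule voronoi_cell_area_ge[where c = 0 and e = p])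
        fix z assume "z \<in> insert 0 A"
        then show "z = 0 \<or> z = p \<or> 1 \<le> dist x z" using True far by auto
      qed (use pA in simp_all)
      moreover have "inverse (ennreal (dist x p * 1)) \<le> near_sum x A"
        using nn_integral_ge_point[OF pA(1), of "inv_dist x"] near_inv[OF p(1)] by (simp add: near_sum_def)
      ultimately have "inverse (cell_area A x) \<le> 16 * near_sum x A"
        using pA by (intro inverse_le_of_ge) auto
      also have "\<dots> \<le> area_bound x A" unfolding area_bound_def
        by (intro mult_left_mono) (auto intro!: add_increasing2 add_increasing)
      finally show ?thesis .
    next
      case False
      have fin': "finite (F - {p})" using fin by simp
      define q where "q = arg_min_on (dist x) (F - {p})"
      have q: "q \<in> F - {p}" "\<And>z. z \<in> F - {p} \<Longrightarrow> dist x q \<le> dist x z"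
        unfolding q_def using arg_min_if_finite(1)[OF fin' False, of "dist x"]
          arg_min_least[OF fin' False, of _ "dist x"] by auto
      have qA: "q \<in> A" "dist x q \<le> 1" "0 < dist x q" using near[of q] pos q(1) by auto
      have pq: "dist x p \<le> dist x q" using p(2) q(1) by auto
      have "ennreal (dist x p * dist x q / 16) \<le> cell_area A x"
        unfolding cell_area_def
      proof (rule voronoi_cell_area_ge[where c = 0 and e = p])
        fix z assume "z \<in> insert 0 A"
        then show "z = 0 \<or> z = p \<or> dist x q \<le> dist x z" using q(2) far qA(2) by fastforce
      qed (use pA pq in simp_all)
      moreover have "inverse (ennreal (dist x p * dist x q)) \<le> near_pair_sum x A"
      proof -
        have "inverse (ennreal (dist x p * dist x q)) = inv_dist x p * inv_dist x q"
          using pA qA q(1) p(1) near_inv by (simp add: inverse_ennreal ennreal_mult[symmetric])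
        also have "inv_dist x q \<le> near_sum x (A - {p})"
          unfolding near_sum_def by (rule nn_integral_ge_point) (use q qA in auto)
        then have "inv_dist x p * inv_dist x q \<le> inv_dist x p * near_sum x (A - {p})"
          by (rule mult_left_mono) simp
        also have "\<dots> \<le> near_pair_sum x A"
          unfolding near_pair_sum_def using pA(1) by (rule nn_integral_ge_point)
        finally show ?thesis .
      qed
      ultimately have "inverse (cell_area A x) \<le> 16 * near_pair_sum x A"
        using pA qA by (intro inverse_le_of_ge) auto
      also have "\<dots> \<le> area_bound x A" unfolding area_bound_def
        by (intro mult_left_mono) (auto intro!: add_increasing)
      finally show ?thesis .
    qed
  qed
qed

definition inv_dist_integral :: ennreal where
  "inv_dist_integral = (\<integral>\<^sup>+z. inv_dist 0 z \<partial>lborel)"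

lemma nn_integral_inv_dist: "(\<integral>\<^sup>+z. inv_dist x z \<partial>lborel) = inv_dist_integral"
proof -
  have "inv_dist_integral = (\<integral>\<^sup>+z. inv_dist 0 z \<partial>distr lborel borel (\<lambda>y. y - x))"
    by (simp add: inv_dist_integral_def distr_lborel_translation)
  also have "\<dots> = (\<integral>\<^sup>+z. inv_dist 0 (z - x) \<partial>lborel)"
    by (rule nn_integral_distr) measurable
  also have "\<dots> = (\<integral>\<^sup>+z. inv_dist x z \<partial>lborel)"
    by (intro nn_integral_cong) (simp add: inv_dist_def indicator_def dist_norm norm_minus_commute)
  finally show ?thesis by simp
qed

text \<open>Dyadic decomposition: where \<open>norm z\<close> lies between
  \<open>(1/2) ^ Suc n\<close> and \<open>(1/2) ^ n\<close> the integrand is at most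
  \<open>2 ^ Suc n\<close>. The disk of radius \<open>(1/2) ^ n\<close> has area
  \<open>pi * (1/4) ^ n\<close>, so the terms form a geometric series of ratio 1/2.\<close>

lemma inv_dist_integral_finite: "inv_dist_integral < \<infinity>"
proof -
  define g :: "nat \<Rightarrow> plane \<Rightarrow> ennreal" where
    "g n z = ennreal (2 ^ Suc n) * indicator (cball 0 ((1/2) ^ n)) z" for n z
  have "inv_dist 0 z \<le> (\<Sum>n. g n z)" if "z \<noteq> 0" for z
  proof (cases "norm z \<le> 1")
    case True
    have ex: "\<exists>n. (1/2) ^ Suc n < norm z"
    proof -
      have "0 < norm z" using that by simp
      then obtain n where "(1/2) ^ n < norm z" using real_arch_pow_inv[of "norm z" "1/2"] by auto
      moreover have "(1/2 :: real) ^ Suc n \<le> (1/2) ^ n" by simp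
      ultimately show ?thesis by (intro exI[of _ n]) linarith
    qed
    \<comment> \<open>The index of the dyadic layer of \<open>z\<close>; minimality yields the outer
      bound \<open>norm z \<le> (1/2) ^ n\<close>.\<close>
    define n where "n = (LEAST n. (1/2) ^ Suc n < norm z)"
    have n: "(1/2) ^ Suc n < norm z" unfolding n_def by (rule LeastI_ex[OF ex])
    have "norm z \<le> (1/2) ^ n"
    proof (cases n)
      case 0 then show ?thesis using True by simp
    next
      case (Suc m)
      then have "\<not> (1/2) ^ Suc m < norm z" unfolding n_def by (metis lessI not_less_Least)
      then show ?thesis using Suc by simp
    qed
    have "inverse (norm z) \<le> inverse ((1/2) ^ Suc n)" using n by (intro le_imp_inverse_le) auto
    then have "inv_dist 0 z \<le> g n z"
      using that True \<open>norm z \<le> (1/2) ^ n\<close>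
      by (simp add: inv_dist_def g_def inverse_ennreal power_one_over ennreal_leI)
    also have "\<dots> \<le> (\<Sum>n. g n z)" using sum_le_suminf[OF summableI, of "{n}" "\<lambda>n. g n z"] by simp
    finally show ?thesis .
  qed (simp add: inv_dist_def)
  then have "inv_dist_integral \<le> (\<integral>\<^sup>+z. (\<Sum>n. g n z) \<partial>lborel)"
    unfolding inv_dist_integral_def
    by (intro nn_integral_mono_AE AE_mp[OF AE_lborel_singleton[of 0] AE_I2]) simp
  also have "\<dots> = (\<Sum>n. \<integral>\<^sup>+z. g n z \<partial>lborel)"
  proof (rule nn_integral_suminf)
    fix n
    have [measurable]: "cball 0 ((1/2) ^ n) \<in> sets (borel :: plane measure)" by simp
    show "g n \<in> borel_measurable lborel" unfolding g_def by measurable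
  qed
  also have "\<dots> = (\<Sum>n. ennreal (2 * pi * (1/2) ^ n))"
  proof (intro suminf_cong)
    fix n
    have "(\<integral>\<^sup>+z. g n z \<partial>lborel) = ennreal (2 ^ Suc n) * ennreal (pi * ((1/2) ^ n)\<^sup>2)"
      unfolding g_def by (subst nn_integral_cmult_indicator) (simp_all add: emeasure_cball unit_ball_vol_numeral)
    also have "\<dots> = ennreal (2 ^ Suc n * (pi * ((1/2) ^ n)\<^sup>2))" by (rule ennreal_mult[symmetric]) auto
    also have "2 ^ Suc n * (pi * ((1/2) ^ n)\<^sup>2) = 2 * pi * (1/2 :: real) ^ n"
      by (simp add: power2_eq_square power_one_over field_simps)
    finally show "(\<integral>\<^sup>+z. g n z \<partial>lborel) = ennreal (2 * pi * (1/2) ^ n)" .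
  qed
  also have "\<dots> = ennreal (\<Sum>n. 2 * pi * (1/2) ^ n)"
    by (rule suminf_ennreal2) (auto intro!: summable_mult summable_geometric)
  also have "\<dots> < \<infinity>" by simp
  finally show ?thesis .
qed

context poisson_law
begin

definition mean_bound :: ennreal where
  "mean_bound = 16 * (1 + ennreal lam * inv_dist_integral +
     ennreal lam * (ennreal lam * inv_dist_integral * inv_dist_integral))"

lemma mean_bound_finite: "mean_bound < \<infinity>"
  using inv_dist_integral_finite by (simp add: mean_bound_def ennreal_mult_less_top)

text \<open>Two applications of the Mecke formula split the pair sum into two separate integrals of
  \<open>1 / norm z\<close> over the unit disk. Translation invariance makes the result independent
  of \<open>x\<close>.\<close>

lemma mean_area_bound: "(\<integral>\<^sup>+A. area_bound x A \<partial>D) = mean_bound"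
proof -
  have 1: "(\<integral>\<^sup>+A. near_sum x A \<partial>D) = ennreal lam * inv_dist_integral"
    using mecke[of "\<lambda>z. inv_dist x (fst z)"] emeasure_space_1
    by (simp add: near_sum_def nn_integral_inv_dist)
  have "(\<integral>\<^sup>+A. near_pair_sum x A \<partial>D) = ennreal lam * (\<integral>\<^sup>+z. \<integral>\<^sup>+A. inv_dist x z * near_sum x A \<partial>D \<partial>lborel)"
    using mecke[of "\<lambda>z. inv_dist x (fst z) * near_sum x (snd z)"] by (simp add: near_pair_sum_def)
  also have "(\<integral>\<^sup>+z. \<integral>\<^sup>+A. inv_dist x z * near_sum x A \<partial>D \<partial>lborel) =
      (\<integral>\<^sup>+z. inv_dist x z * (ennreal lam * inv_dist_integral) \<partial>lborel)"
    by (intro nn_integral_cong) (simp add: nn_integral_cmult 1)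
  also have "\<dots> = inv_dist_integral * (ennreal lam * inv_dist_integral)"
    by (simp add: nn_integral_multc nn_integral_inv_dist)
  finally have 2: "(\<integral>\<^sup>+A. near_pair_sum x A \<partial>D) = ennreal lam * (ennreal lam * inv_dist_integral * inv_dist_integral)"
    by (simp add: mult_ac)
  show ?thesis
    using emeasure_space_1 unfolding area_bound_def mean_bound_def
    by (simp add: nn_integral_cmult nn_integral_add 1 2)
qed

end

section \<open>The density of users\<close>

lemma gaussian_integral_finite:
  fixes c :: real
  assumes "0 < c"
  shows "(\<integral>\<^sup>+w. ennreal (exp (- c * (norm (w :: plane))\<^sup>2)) \<partial>lborel) < \<infinity>"
proof -
  \<comment> \<open>The standard deviation for which \<open>exp (- c * t\<^sup>2)\<close> is an
    unnormalised normal density.\<close>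
  define s where "s = 1 / sqrt (2 * c)"
  have s: "0 < s" "s\<^sup>2 = 1 / (2 * c)" using assms by (simp_all add: s_def power_divide)
  have "exp (- c * t\<^sup>2) = sqrt (2 * pi * s\<^sup>2) * normal_density 0 s t" for t
    using s assms by (simp add: normal_density_def)
  then have "integrable lborel (\<lambda>t. exp (- c * t\<^sup>2))"
    using integrable_normal_density[OF s(1), of 0] by simp
  then have fin: "(\<integral>\<^sup>+t. ennreal (exp (- c * t\<^sup>2)) \<partial>lborel) < \<infinity>"
    by (subst nn_integral_eq_integral) auto
  have "(\<integral>\<^sup>+w. ennreal (exp (- c * (norm (w :: plane))\<^sup>2)) \<partial>lborel) =
      (\<integral>\<^sup>+w. (\<Prod>b\<in>Basis. ennreal (exp (- c * ((w :: plane) \<bullet> b)\<^sup>2))) \<partial>lborel)"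
  proof (intro nn_integral_cong)
    fix w :: plane
    have "(norm w)\<^sup>2 = (\<Sum>b\<in>Basis. (w \<bullet> b)\<^sup>2)"
      unfolding power2_norm_eq_inner by (subst euclidean_inner) (simp add: power2_eq_square)
    then show "ennreal (exp (- c * (norm w)\<^sup>2)) = (\<Prod>b\<in>Basis. ennreal (exp (- c * (w \<bullet> b)\<^sup>2)))"
      by (simp add: sum_distrib_left sum_negf[symmetric] exp_sum prod_ennreal)
  qed
  also have "\<dots> = (\<Prod>b\<in>(Basis :: plane set). \<integral>\<^sup>+t. ennreal (exp (- c * t\<^sup>2)) \<partial>lborel)"
    by (rule nn_integral_lborel_prod) auto
  also have "\<dots> < \<infinity>"
    using fin by (simp add: power_less_top_ennreal)
  finally show ?thesis .
qed

text \<open>The tangent to \<open>1 / v\<close> at \<open>s\<close>, arranged so that all terms are positive.\<close>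

lemma inverse_tangent:
  assumes "0 < s"
  shows "ennreal (2 / s) \<le> inverse v + ennreal (1 / s\<^sup>2) * v"
proof (cases v)
  case (real r)
  show ?thesis
  proof (cases "r = 0")
    case False
    with real have r: "0 < r" by simp
    have "0 \<le> (1 / sqrt r - sqrt r / s)\<^sup>2" by simp
    also have "\<dots> = 1 / r + r / s\<^sup>2 - 2 / s"
      using r by (simp add: power2_diff power_divide)
    finally have "2 / s \<le> inverse r + 1 / s\<^sup>2 * r" by (simp add: divide_inverse mult.commute)
    then show ?thesis
      using r assms by (simp add: real inverse_ennreal ennreal_mult[symmetric] ennreal_plus[symmetric] ennreal_leI del: ennreal_plus)
  qed (simp add: real)
qed (use assms in \<open>simp add: ennreal_mult_top\<close>)

text \<open>Away from ties all comparisons of distances are strict, hence stable under small changes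
  of \<open>y\<close>. Outside the cell one violated comparison suffices; inside it, local
  finiteness leaves only finitely many comparisons to preserve.\<close>

lemma eventually_in_voronoi_cell:
  assumes A: "A \<in> configurations"
    and x: "dist y x \<noteq> norm y" and ties: "\<And>z. z \<in> A \<Longrightarrow> dist y z \<noteq> dist y x"
  shows "\<forall>\<^sub>F y' in nhds y. y' \<in> voronoi_cell (insert 0 A) x \<longleftrightarrow> y \<in> voronoi_cell (insert 0 A) x"
proof (cases "y \<in> voronoi_cell (insert 0 A) x")
  case True
  have less: "dist y x < dist y z" if "z \<in> insert 0 A" for z
    using True that x ties[of z] by (auto simp: voronoi_cell_def less_le)
  \<comment> \<open>Moving \<open>y\<close> by less than 1 changes each distance by less than 1.
    Points outside this disk therefore remain farther away than \<open>x\<close>, which explains the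
    margin 2.\<close>
  define F where "F = insert 0 A \<inter> cball y (dist y x + 2)"
  have "finite F"
    unfolding F_def using configurations_insert[OF A] by (rule configurations_finite) simp
  moreover have "\<forall>\<^sub>F y' in nhds y. dist y' x < dist y' z" if "z \<in> F" for z
  proof -
    have "open {y'. dist y' x < dist y' z}" by (intro open_Collect_less continuous_intros)
    then show ?thesis using less[of z] that by (auto simp: F_def eventually_nhds)
  qed
  ultimately have "\<forall>\<^sub>F y' in nhds y. \<forall>z\<in>F. dist y' x < dist y' z"
    by (simp add: eventually_ball_finite)
  moreover have "\<forall>\<^sub>F y' in nhds y. y' \<in> ball y 1" by (rule eventually_nhds_in_open) auto
  ultimately show ?thesis
  proof eventually_elim
    case (elim y')
    have "dist y' x \<le> dist y' z" if z: "z \<in> insert 0 A" for z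
    proof (cases "z \<in> F")
      case False
      then have "dist y x + 2 < dist y z" using z by (auto simp: F_def)
      then show ?thesis using elim(2) dist_triangle[of y z y'] dist_triangle[of y' x y]
        by (simp add: dist_commute)
    qed (use elim(1) in auto)
    then show ?case using True unfolding voronoi_cell_def by blast
  qed
next
  case False
  then obtain z where z: "z \<in> insert 0 A" "dist y z < dist y x"
    unfolding voronoi_cell_def mem_Collect_eq Ball_def not_all not_imp not_le by blast
  have "open {y'. dist y' z < dist y' x}" by (intro open_Collect_less continuous_intros)
  then have "\<forall>\<^sub>F y' in nhds y. dist y' z < dist y' x"
    using z by (auto simp: eventually_nhds)
  then show ?thesis
    by eventually_elim (use False z in \<open>auto simp: voronoi_cell_def dest!: bspec[OF _ z(1)]\<close>)
qed

context poisson_law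
begin

section \<open>Upper and lower bounds for the density\<close>

lemma void_event:
  assumes B: "bounded_borel B"
  shows "{A \<in> configurations. A \<inter> B = {}} \<in> sets config_space"
    and "emeasure D {A \<in> configurations. A \<inter> B = {}} = ennreal (exp (- lam * measure lborel B))"
proof -
  have eq: "{A \<in> configurations. A \<inter> B = {}} = count_event {B} (\<lambda>_. 0)"
    using B by (auto simp: count_event_def configurations_finite)
  show "{A \<in> configurations. A \<inter> B = {}} \<in> sets config_space"
    unfolding eq using B by (intro sets_count_event) auto
  show "emeasure D {A \<in> configurations. A \<inter> B = {}} = ennreal (exp (- lam * measure lborel B))"
    unfolding eq using B by (subst emeasure_count_event) (auto simp: disjoint_def poisson_prob_def)
qed

lemma user_density_le: "user_density y \<le> ennreal lam * (ennreal (pi * (norm y)\<^sup>2) * mean_bound)"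
proof -
  have "(\<integral>\<^sup>+A. cell_density A x y \<partial>D) \<le> mean_bound * indicator (cball y (norm y)) x" for x
  proof (cases "x \<in> cball y (norm y)")
    case True
    have "(\<integral>\<^sup>+A. cell_density A x y \<partial>D) \<le> (\<integral>\<^sup>+A. area_bound x A \<partial>D)"
      using inverse_cell_area_le by (intro nn_integral_mono) (auto simp: cell_density_def indicator_def)
    then show ?thesis using True by (simp add: mean_area_bound)
  next
    case False
    then have "cell_density A x y = 0" for A
      by (auto simp: cell_density_def voronoi_cell_def)
    then show ?thesis by simp
  qed
  then have "(\<integral>\<^sup>+x. \<integral>\<^sup>+A. cell_density A x y \<partial>D \<partial>lborel) \<le> (\<integral>\<^sup>+x. mean_bound * indicator (cball y (norm y)) x \<partial>lborel)"
    by (intro nn_integral_mono)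
  also have "\<dots> = ennreal (pi * (norm y)\<^sup>2) * mean_bound"
    by (simp add: nn_integral_cmult_indicator emeasure_cball unit_ball_vol_numeral mult.commute)
  finally show ?thesis unfolding user_density_def by (rule mult_left_mono) simp
qed

lemma user_density_finite: "user_density y < \<infinity>"
  by (rule le_less_trans[OF user_density_le]) (use mean_bound_finite in \<open>simp add: ennreal_mult_less_top\<close>)

definition gaussian_integral :: real where
  "gaussian_integral = enn2real (\<integral>\<^sup>+w. ennreal (exp (- (lam * pi) * (norm (w :: plane))\<^sup>2)) \<partial>lborel)"

text \<open>By Fubini's theorem the mean area is the integral over \<open>w\<close> of the
  probability that \<open>w\<close> belongs to the cell. This forces the disk about \<open>w\<close>
  through \<open>x\<close> to be free of points in its interior, an event whose probability is
  Gaussian in \<open>w - x\<close>.\<close>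

lemma mean_cell_area_le: "(\<integral>\<^sup>+A. cell_area A x \<partial>D) \<le> ennreal gaussian_integral"
proof -
  interpret PS: pair_sigma_finite lborel D ..
  have "(\<integral>\<^sup>+A. cell_area A x \<partial>D) = (\<integral>\<^sup>+A. \<integral>\<^sup>+w. indicator (voronoi_cell (insert 0 A) x) w \<partial>lborel \<partial>D)"
    by (simp add: cell_area_def)
  also have "\<dots> = (\<integral>\<^sup>+w. \<integral>\<^sup>+A. indicator (voronoi_cell (insert 0 A) x) w \<partial>D \<partial>lborel)"
    by (rule PS.Fubini') measurable
  also have "\<dots> \<le> (\<integral>\<^sup>+w. ennreal (exp (- (lam * pi) * (norm (w - x))\<^sup>2)) \<partial>lborel)"
  proof (rule nn_integral_mono)
    fix w :: plane
    let ?B = "ball w (dist w x)"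
    have bb: "bounded_borel ?B" by simp
    have "(\<integral>\<^sup>+A. indicator (voronoi_cell (insert 0 A) x) w \<partial>D) \<le> (\<integral>\<^sup>+A. indicator {A \<in> configurations. A \<inter> ?B = {}} A \<partial>D)"
      by (intro nn_integral_mono) (auto simp: indicator_def voronoi_cell_def not_le disjoint_iff dest: leD)
    also have "\<dots> = ennreal (exp (- (lam * pi) * (norm (w - x))\<^sup>2))"
      using void_event[OF bb] by (simp add: sets_D content_ball unit_ball_vol_numeral dist_norm mult.assoc)
    finally show "(\<integral>\<^sup>+A. indicator (voronoi_cell (insert 0 A) x) w \<partial>D) \<le> ennreal (exp (- (lam * pi) * (norm (w - x))\<^sup>2))" .
  qed
  also have "\<dots> = (\<integral>\<^sup>+w. ennreal (exp (- (lam * pi) * (norm w)\<^sup>2)) \<partial>distr lborel borel (\<lambda>w. w - x))"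
    by (subst nn_integral_distr) measurable
  also have "\<dots> = ennreal gaussian_integral"
    using gaussian_integral_finite[of "lam * pi"] lam
    by (simp add: gaussian_integral_def distr_lborel_translation)
  finally show ?thesis .
qed

text \<open>On the event \<open>G\<close> that the disk about \<open>y\<close> through the origin is
  empty, \<open>y\<close> lies in the cell of every \<open>x\<close> in that disk. There the tangent
  inequality bounds \<open>2 / s\<close> by the density plus \<open>1 / s\<^sup>2\<close> times the
  area, and off \<open>G\<close> the left-hand side is zero. Taking means gives at least
  \<open>1 / s\<close> on the left and an area term of at most \<open>1 / (2 * s)\<close>, which
  leaves \<open>1 / (2 * s)\<close> for the density.\<close>

lemma user_density_ge:
  "\<exists>c r\<^sub>0. 0 < c \<and> 0 < r\<^sub>0 \<and> (\<forall>y. norm y < r\<^sub>0 \<longrightarrow> ennreal (c * (norm y)\<^sup>2) \<le> user_density y)"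
proof -
  \<comment> \<open>At least twice the mean area, so that the area term consumes no more than half
    of \<open>1 / s\<close>; the summand 1 makes \<open>s\<close> positive.\<close>
  define s where "s = 2 * (gaussian_integral + 1)"
  have g0: "0 \<le> gaussian_integral" by (simp add: gaussian_integral_def)
  then have s: "0 < s" "gaussian_integral \<le> s / 2" by (simp_all add: s_def)
  \<comment> \<open>A disk of this radius is empty with probability exactly 1/2.\<close>
  define r\<^sub>0 where "r\<^sub>0 = sqrt (ln 2 / (lam * pi))"
  have "0 < r\<^sub>0" using lam by (simp add: r\<^sub>0_def)
  have "ennreal (lam * pi / (2 * s) * (norm y)\<^sup>2) \<le> user_density y" if y: "norm y < r\<^sub>0" for y
  proof -
    define G where "G = {A \<in> configurations. A \<inter> ball y (norm y) = {}}"
    have "bounded_borel (ball y (norm y))" by simp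
    note G = void_event[OF this, folded G_def]
    have "(norm y)\<^sup>2 < r\<^sub>0\<^sup>2" using y by (intro power_strict_mono) auto
    also have "r\<^sub>0\<^sup>2 = ln 2 / (lam * pi)" using lam by (simp add: r\<^sub>0_def)
    finally have "lam * pi * (norm y)\<^sup>2 \<le> ln 2" using lam by (simp add: field_simps)
    then have "exp (- ln 2) \<le> exp (- (lam * pi * (norm y)\<^sup>2))" by simp
    then have "1 / 2 \<le> exp (- (lam * pi * (norm y)\<^sup>2))" by (simp add: exp_minus inverse_eq_divide)
    then have half: "ennreal (1 / 2) \<le> emeasure D G"
      unfolding G(2) by (intro ennreal_leI) (simp add: content_ball unit_ball_vol_numeral mult.assoc)
    have inner: "ennreal (1 / (2 * s)) \<le> (\<integral>\<^sup>+A. cell_density A x y \<partial>D)" if x: "x \<in> cball y (norm y)" for x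
    proof -
      have G_sets [measurable]: "G \<in> sets D" using G(1) by (simp add: sets_D)
      have "1 / s = 2 / s * (1 / 2)" by simp
      then have "ennreal (1 / s) = ennreal (2 / s) * ennreal (1 / 2)"
        using s by (simp only:) (rule ennreal_mult, simp_all)
      also have "\<dots> \<le> ennreal (2 / s) * emeasure D G" using half by (rule mult_left_mono) simp
      also have "\<dots> = (\<integral>\<^sup>+A. ennreal (2 / s) * indicator G A \<partial>D)"
        by (rule nn_integral_cmult_indicator[symmetric]) fact
      also have "\<dots> \<le> (\<integral>\<^sup>+A. cell_density A x y + ennreal (1 / s\<^sup>2) * cell_area A x \<partial>D)"
      proof (intro nn_integral_mono)
        fix A
        show "ennreal (2 / s) * indicator G A \<le> cell_density A x y + ennreal (1 / s\<^sup>2) * cell_area A x"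
        proof (cases "A \<in> G")
          case True
          then have "y \<in> voronoi_cell (insert 0 A) x"
            using x by (auto simp: G_def voronoi_cell_def disjoint_iff not_less dist_commute intro: order_trans)
          then show ?thesis using True inverse_tangent[OF s(1), of "cell_area A x"]
            by (simp add: cell_density_def)
        qed simp
      qed
      also have "\<dots> = (\<integral>\<^sup>+A. cell_density A x y \<partial>D) + ennreal (1 / s\<^sup>2) * (\<integral>\<^sup>+A. cell_area A x \<partial>D)"
        by (simp add: nn_integral_add nn_integral_cmult)
      also have "ennreal (1 / s\<^sup>2) * (\<integral>\<^sup>+A. cell_area A x \<partial>D) \<le> ennreal (1 / s\<^sup>2) * ennreal (s / 2)"
        by (intro mult_left_mono order_trans[OF mean_cell_area_le ennreal_leI[OF s(2)]]) simp
      also have "\<dots> = ennreal (1 / (2 * s))"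
        using s(1) by (simp add: ennreal_mult[symmetric] power2_eq_square)
      finally have "ennreal (1 / s) \<le> (\<integral>\<^sup>+A. cell_density A x y \<partial>D) + ennreal (1 / (2 * s))"
        by (simp add: add_left_mono)
      \<comment> \<open>Splitting into halves lets a finite summand be cancelled, in place of a
        truncated subtraction in \<open>ennreal\<close>.\<close>
      moreover have "ennreal (1 / s) = ennreal (1 / (2 * s)) + ennreal (1 / (2 * s))"
        using s(1) by (simp add: ennreal_plus[symmetric] del: ennreal_plus)
      ultimately show ?thesis by (simp add: ennreal_add_left_cancel_le add.commute)
    qed
    have "ennreal (lam * pi / (2 * s) * (norm y)\<^sup>2) = ennreal lam * (ennreal (1 / (2 * s)) * ennreal (pi * (norm y)\<^sup>2))"
      using lam s(1) by (simp add: ennreal_mult[symmetric])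
    also have "ennreal (1 / (2 * s)) * ennreal (pi * (norm y)\<^sup>2) = (\<integral>\<^sup>+x. ennreal (1 / (2 * s)) * indicator (cball y (norm y)) x \<partial>lborel)"
      by (subst nn_integral_cmult_indicator) (simp_all add: emeasure_cball unit_ball_vol_numeral)
    also have "\<dots> \<le> (\<integral>\<^sup>+x. \<integral>\<^sup>+A. cell_density A x y \<partial>D \<partial>lborel)"
      using inner by (intro nn_integral_mono) (auto simp: indicator_def)
    finally show ?thesis unfolding user_density_def by (simp add: mult_left_mono)
  qed
  with lam s(1) \<open>0 < r\<^sub>0\<close> show ?thesis
    by (intro exI[of _ "lam * pi / (2 * s)"] exI[of _ "r\<^sub>0"]) auto
qed

section \<open>Continuity of the density\<close>

lemma AE_no_tie:
  "AE z in lborel \<Otimes>\<^sub>M D. snd z \<in> configurations \<and> dist y (fst z) \<noteq> norm y \<and> (\<forall>p\<in>snd z. dist y p \<noteq> dist y (fst z))"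
proof -
  interpret PS: pair_sigma_finite lborel D ..
  define R where "R z \<longleftrightarrow> dist y (fst z) \<noteq> norm y \<and>
      (\<integral>\<^sup>+p. indicator {p. dist y p = dist y (fst z)} p \<partial>count_space (snd z)) = 0" for z :: "plane \<times> plane set"
  have R: "R z \<longleftrightarrow> dist y (fst z) \<noteq> norm y \<and> (\<forall>p\<in>snd z. dist y p \<noteq> dist y (fst z))" for z
    by (auto simp: R_def sum_config_eq_0_iff indicator_def)
  have sphere: "sphere y r \<in> null_sets lborel" for r :: real
    using negligible_sphere[of y r] by (auto simp: null_sets_completion_iff negligible_iff_null_sets)
  have "AE z in lborel \<Otimes>\<^sub>M D. R z"
  proof (rule PS.AE_pair_measure)
    show "{z \<in> space (lborel \<Otimes>\<^sub>M D). R z} \<in> sets (lborel \<Otimes>\<^sub>M D)"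
      unfolding R_def by measurable
    \<comment> \<open>The circle about \<open>y\<close> through \<open>x\<close> has area zero, so
      its void probability is \<open>exp 0 = 1\<close>.\<close>
    have "AE A in D. R (x, A)" if x: "dist y x \<noteq> norm y" for x
    proof -
      have bb: "bounded_borel (sphere y (dist y x))" by simp
      have "measure lborel (sphere y (dist y x)) = 0"
        using sphere[of "dist y x"] by (simp add: null_sets_def measure_def)
      then have "emeasure D {A \<in> configurations. A \<inter> sphere y (dist y x) = {}} = 1"
        using void_event(2)[OF bb] by simp
      then have "prob {A \<in> configurations. A \<inter> sphere y (dist y x) = {}} = 1"
        by (simp add: measure_def)
      then have "AE A in D. A \<in> {A \<in> configurations. A \<inter> sphere y (dist y x) = {}}"
        using void_event(1)[OF bb] by (subst AE_in_set_eq_1) (simp_all add: sets_D)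
      then show ?thesis
        by eventually_elim (use x in \<open>auto simp: R disjoint_iff\<close>)
    qed
    moreover have "AE x in lborel. dist y x \<noteq> norm y"
      using AE_not_in[OF sphere[of "norm y"]] by eventually_elim simp
    ultimately show "AE x in lborel. AE A in D. R (x, A)" by auto
  qed
  then show ?thesis
    using AE_space by eventually_elim (auto simp: R space_pair_measure)
qed

lemma user_density_pair:
  "user_density y = ennreal lam * (\<integral>\<^sup>+z. cell_density (snd z) (fst z) y \<partial>(lborel \<Otimes>\<^sub>M D))"
  unfolding user_density_def by (subst nn_integral_fst[symmetric]) simp_all

text \<open>Since ties are negligible, almost every integrand is eventually constant along
  \<open>Y\<close>. Dominated convergence on the product of Lebesgue measure and \<open>D\<close>
  does the rest.\<close>

lemma user_density_continuous:
  assumes "Y \<longlonglongrightarrow> y"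
  shows "(\<lambda>n. user_density (Y n)) \<longlonglongrightarrow> user_density y"
proof -
  from assms have "Bseq Y" by (intro convergent_imp_Bseq convergentI)
  then obtain b where b: "\<And>n. norm (Y n) \<le> b" by (auto simp: Bseq_def)
  \<comment> \<open>If \<open>Y n\<close> lies in the cell of \<open>x\<close>, then
    \<open>x\<close> is no farther from \<open>Y n\<close> than the origin is, so
    \<open>norm x \<le> 2 * b\<close>. The inverse area does not involve \<open>Y n\<close> at
    all.\<close>
  define w where "w z = indicator (cball 0 (2 * b)) (fst z) * area_bound (fst z) (snd z)" for z :: "plane \<times> plane set"
  have [measurable]: "cball 0 (2 * b) \<in> sets (borel :: plane measure)" by simp
  have "(\<lambda>n. \<integral>\<^sup>+z. cell_density (snd z) (fst z) (Y n) \<partial>(lborel \<Otimes>\<^sub>M D)) \<longlonglongrightarrow>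
     (\<integral>\<^sup>+z. cell_density (snd z) (fst z) y \<partial>(lborel \<Otimes>\<^sub>M D))"
  proof (rule nn_integral_dominated_convergence[where w = w])
    show "(\<lambda>z. cell_density (snd z) (fst z) (Y n)) \<in> borel_measurable (lborel \<Otimes>\<^sub>M D)" for n by measurable
    show "(\<lambda>z. cell_density (snd z) (fst z) y) \<in> borel_measurable (lborel \<Otimes>\<^sub>M D)" by measurable
    show w [measurable]: "w \<in> borel_measurable (lborel \<Otimes>\<^sub>M D)" unfolding w_def by measurable
    show "AE z in lborel \<Otimes>\<^sub>M D. cell_density (snd z) (fst z) (Y n) \<le> w z" for n
    proof (rule AE_I2)
      fix z :: "plane \<times> plane set" assume "z \<in> space (lborel \<Otimes>\<^sub>M D)"
      then have conf: "snd z \<in> configurations" by (auto simp: space_pair_measure)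
      show "cell_density (snd z) (fst z) (Y n) \<le> w z"
      proof (cases "Y n \<in> voronoi_cell (insert 0 (snd z)) (fst z)")
        case True
        then have "dist (Y n) (fst z) \<le> norm (Y n)" by (auto simp: voronoi_cell_def)
        then have "norm (fst z) \<le> 2 * b"
          using b[of n] norm_triangle_sub[of "fst z" "Y n"] by (simp add: dist_norm norm_minus_commute)
        then show ?thesis
          using True inverse_cell_area_le[OF conf] by (simp add: cell_density_def w_def)
      qed (simp add: cell_density_def)
    qed
    have "(\<integral>\<^sup>+z. w z \<partial>(lborel \<Otimes>\<^sub>M D)) = (\<integral>\<^sup>+x. \<integral>\<^sup>+A. w (x, A) \<partial>D \<partial>lborel)"
      by (rule nn_integral_fst[symmetric, OF w])
    also have "\<dots> = (\<integral>\<^sup>+x. mean_bound * indicator (cball (0::plane) (2 * b)) x \<partial>lborel)"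
      by (intro nn_integral_cong) (simp add: w_def nn_integral_cmult mean_area_bound mult.commute[of mean_bound])
    also have "\<dots> = mean_bound * emeasure lborel (cball (0::plane) (2 * b))"
      by (rule nn_integral_cmult_indicator) simp
    also have "\<dots> < \<infinity>"
      using mean_bound_finite emeasure_bounded_finite[of "cball (0::plane) (2 * b)"]
      by (simp add: ennreal_mult_less_top)
    finally show "(\<integral>\<^sup>+z. w z \<partial>(lborel \<Otimes>\<^sub>M D)) < \<infinity>" .
    show "AE z in lborel \<Otimes>\<^sub>M D. (\<lambda>n. cell_density (snd z) (fst z) (Y n)) \<longlonglongrightarrow> cell_density (snd z) (fst z) y"
      using AE_no_tie[of y]
    proof eventually_elim
      case (elim z)
      then have "\<forall>\<^sub>F y' in nhds y. y' \<in> voronoi_cell (insert 0 (snd z)) (fst z) \<longleftrightarrow>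
          y \<in> voronoi_cell (insert 0 (snd z)) (fst z)"
        by (intro eventually_in_voronoi_cell) auto
      then have "\<forall>\<^sub>F n in sequentially. Y n \<in> voronoi_cell (insert 0 (snd z)) (fst z) \<longleftrightarrow>
          y \<in> voronoi_cell (insert 0 (snd z)) (fst z)"
        using assms by (rule eventually_compose_filterlim)
      then have "\<forall>\<^sub>F n in sequentially. cell_density (snd z) (fst z) (Y n) = cell_density (snd z) (fst z) y"
        by eventually_elim (simp add: cell_density_def indicator_def)
      then show ?case by (rule tendsto_eventually)
    qed
  qed
  then show ?thesis
    unfolding user_density_pair by (rule ennreal_tendsto_cmult[rotated]) simp
qed

end

section \<open>Differentiating over disks\<close>

text \<open>The area measure of a disk is the only fact about polar coordinates that is needed: the mass
  of a thin annulus is squeezed between the extreme values of the radial density.\<close>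

lemma radial_integral_has_derivative:
  fixes h :: "plane \<Rightarrow> ennreal" and H :: "real \<Rightarrow> real"
  assumes h [measurable]: "h \<in> borel_measurable borel"
    and hH: "\<And>y. h y = ennreal (H (norm y))" and H0: "\<And>t. 0 \<le> H t"
    and cont: "isCont H r" and r: "0 < r"
    and fin: "\<And>s. (\<integral>\<^sup>+y. h y * indicator (cball 0 s) y \<partial>lborel) < \<infinity>"
  shows "((\<lambda>s. enn2real (\<integral>\<^sup>+y. h y * indicator (cball 0 s) y \<partial>lborel)) has_real_derivative 2 * pi * r * H r) (at r)"
proof -
  define I where "I s = (\<integral>\<^sup>+y. h y * indicator (cball 0 s) y \<partial>lborel)" for s
  define F where "F s = enn2real (I s)" for s
  have IF: "I s = ennreal (F s)" for s using fin[of s] by (simp add: I_def F_def)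
  have F0: "0 \<le> F s" for s by (simp add: F_def)
  have annulus: "m * (pi * (b\<^sup>2 - a\<^sup>2)) \<le> F b - F a \<and> F b - F a \<le> M * (pi * (b\<^sup>2 - a\<^sup>2))"
    if ab: "0 \<le> a" "a \<le> b" and m: "\<And>t. a \<le> t \<Longrightarrow> t \<le> b \<Longrightarrow> m \<le> H t \<and> H t \<le> M" for a b m M
  proof -
    define R where "R = cball (0::plane) b - cball 0 a"
    define X where "X = (\<integral>\<^sup>+y. h y * indicator R y \<partial>lborel)"
    have [measurable]: "R \<in> sets borel" "cball (0::plane) a \<in> sets borel" by (simp_all add: R_def)
    have ba: "0 \<le> b\<^sup>2 - a\<^sup>2" using ab by (simp add: power_mono)
    have "emeasure lborel R = emeasure lborel (cball (0::plane) b) - emeasure lborel (cball (0::plane) a)"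
      unfolding R_def using ab emeasure_bounded_finite[of "cball (0::plane) a"]
      by (intro emeasure_Diff) (auto simp: cball_subset_cball_iff less_top)
    also have "\<dots> = ennreal (pi * (b\<^sup>2 - a\<^sup>2))"
      using ab by (simp add: emeasure_cball unit_ball_vol_numeral ennreal_minus right_diff_distrib)
    finally have area: "emeasure lborel R = ennreal (pi * (b\<^sup>2 - a\<^sup>2))" .
    have "I b = (\<integral>\<^sup>+y. h y * indicator (cball 0 a) y + h y * indicator R y \<partial>lborel)"
      unfolding I_def using ab by (intro nn_integral_cong) (auto simp: R_def indicator_def)
    also have "\<dots> = I a + X"
      unfolding I_def X_def by (rule nn_integral_add) measurable
    finally have Iab: "I b = I a + X" .
    then have "X \<noteq> \<infinity>" using IF[of b] by (auto simp: ennreal_add_eq_top)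
    then obtain \<xi> where \<xi>: "X = ennreal \<xi>" "0 \<le> \<xi>" by (cases X) auto
    have "F b = F a + \<xi>"
      using Iab \<xi> F0 by (simp add: IF ennreal_plus[symmetric] del: ennreal_plus)
    moreover have inR: "m \<le> H (norm y) \<and> H (norm y) \<le> M" if "y \<in> R" for y
      using that by (intro m) (auto simp: R_def)
    moreover have "m * (pi * (b\<^sup>2 - a\<^sup>2)) \<le> \<xi>"
    \<comment> \<open>The lower bound will be \<open>H r - e / 2\<close>, which may be negative and
      would then be truncated by \<open>ennreal\<close>.\<close>
    proof (cases "0 \<le> m")
      case True
      have "ennreal (m * (pi * (b\<^sup>2 - a\<^sup>2))) = (\<integral>\<^sup>+y. ennreal m * indicator R y \<partial>lborel)"
        using True ba by (subst nn_integral_cmult_indicator) (simp_all add: area ennreal_mult)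
      also have "\<dots> \<le> X"
        unfolding X_def using inR by (intro nn_integral_mono) (auto simp: indicator_def hH ennreal_leI)
      finally show ?thesis using \<xi> by simp
    next
      case False
      then have "m * (pi * (b\<^sup>2 - a\<^sup>2)) \<le> 0" using ba by (simp add: mult_nonpos_nonneg)
      then show ?thesis using \<xi>(2) by linarith
    qed
    moreover have "\<xi> \<le> M * (pi * (b\<^sup>2 - a\<^sup>2))"
    proof -
      have M: "0 \<le> M" using m[of a] ab H0[of a] by force
      have "X \<le> (\<integral>\<^sup>+y. ennreal M * indicator R y \<partial>lborel)"
        unfolding X_def using inR by (intro nn_integral_mono) (auto simp: indicator_def hH ennreal_leI)
      also have "\<dots> = ennreal (M * (pi * (b\<^sup>2 - a\<^sup>2)))"
        using M ba by (subst nn_integral_cmult_indicator) (simp_all add: area ennreal_mult)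
      finally show ?thesis using \<xi> M ba by (simp add: ennreal_le_iff)
    qed
    ultimately show ?thesis by simp
  qed
  \<comment> \<open>This is the derivative with respect to the area of the disk; multiplying by
    \<open>pi * (s + r)\<close> turns it into the derivative with respect to the radius.\<close>
  have "((\<lambda>s. (F s - F r) / (pi * (s\<^sup>2 - r\<^sup>2))) \<longlongrightarrow> H r) (at r)"
  proof (rule tendstoI)
    fix e :: real assume "0 < e"
    then obtain d where d: "0 < d" "\<And>t. \<bar>t - r\<bar> < d \<Longrightarrow> \<bar>H t - H r\<bar> < e / 2"
      using cont unfolding continuous_at_eps_delta dist_real_def by (metis half_gt_zero)
    \<comment> \<open>The minimum with \<open>r\<close> keeps \<open>s\<close> positive, as required
      of the inner radius of an annulus.\<close>
    define \<delta> where "\<delta> = min d r"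
    have "dist ((F s - F r) / (pi * (s\<^sup>2 - r\<^sup>2))) (H r) < e" if s: "s \<noteq> r" "\<bar>s - r\<bar> < \<delta>" for s
    proof -
      have s0: "0 < s" using s(2) by (auto simp: \<delta>_def abs_less_iff)
      have near: "H r - e / 2 \<le> H t \<and> H t \<le> H r + e / 2" if "min r s \<le> t" "t \<le> max r s" for t
      proof -
        have "\<bar>t - r\<bar> < d"
          using that s(2) by (auto simp: \<delta>_def abs_less_iff min_def max_def split: if_splits)
        from d(2)[OF this] show ?thesis unfolding abs_less_iff by (intro conjI) linarith+
      qed
      define q where "q = (F s - F r) / (pi * (s\<^sup>2 - r\<^sup>2))"
      have "H r - e / 2 \<le> q \<and> q \<le> H r + e / 2"
      proof (cases "r < s")
        case True
        then have "0 < pi * (s\<^sup>2 - r\<^sup>2)" using r by (simp add: power_strict_mono)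
        with annulus[of r s "H r - e / 2" "H r + e / 2"] near True r show ?thesis
          unfolding q_def by (simp add: le_divide_eq divide_le_eq)
      next
        case False
        with s(1) have "s < r" by simp
        then have "0 < pi * (r\<^sup>2 - s\<^sup>2)" using s0 by (simp add: power_strict_mono)
        moreover have "q = (F r - F s) / (pi * (r\<^sup>2 - s\<^sup>2))"
          unfolding q_def by (metis minus_diff_eq minus_divide_divide mult_minus_right)
        ultimately show ?thesis
          using annulus[of s r "H r - e / 2" "H r + e / 2"] near \<open>s < r\<close> s0
          by (simp add: le_divide_eq divide_le_eq)
      qed
      then show ?thesis using \<open>0 < e\<close> by (simp add: q_def[symmetric] dist_real_def abs_if)
    qed
    moreover have "0 < \<delta>" using d r by (simp add: \<delta>_def)
    ultimately show "\<forall>\<^sub>F s in at r. dist ((F s - F r) / (pi * (s\<^sup>2 - r\<^sup>2))) (H r) < e"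
      unfolding eventually_at dist_real_def by auto
  qed
  then have "((\<lambda>s. (F s - F r) / (pi * (s\<^sup>2 - r\<^sup>2)) * (pi * (s + r))) \<longlongrightarrow> H r * (pi * (r + r))) (at r)"
    by (intro tendsto_intros)
  moreover have "\<forall>\<^sub>F s in at r. (F s - F r) / (pi * (s\<^sup>2 - r\<^sup>2)) * (pi * (s + r)) = (F s - F r) / (s - r)"
  proof -
    have "\<forall>\<^sub>F s in at r. s \<noteq> r \<and> 0 < s"
      using r order_tendstoD(1)[OF tendsto_ident_at, of 0 r UNIV]
      by (simp add: eventually_conj_iff eventually_neq_at_within)
    then show ?thesis
    proof eventually_elim
      case (elim s)
      have "s\<^sup>2 - r\<^sup>2 = (s - r) * (s + r)" by (simp add: power2_eq_square algebra_simps)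
      moreover have "s + r \<noteq> 0" using elim r by simp
      ultimately show ?case using elim by simp
    qed
  qed
  ultimately have "((\<lambda>s. (F s - F r) / (s - r)) \<longlongrightarrow> H r * (pi * (r + r))) (at r)"
    by (simp add: filterlim_cong)
  then have "(F has_real_derivative H r * (pi * (r + r))) (at r)"
    by (simp add: has_field_derivative_iff)
  also have "H r * (pi * (r + r)) = 2 * pi * r * H r" by simp
  finally show ?thesis by (simp add: F_def I_def)
qed

section \<open>Uniform points in the cells\<close>

text \<open>The Mecke formula reduces a statement about all points of the process to one fixed
  \<open>x\<close>. For that \<open>x\<close>, the area and the bound for its inverse both have
  finite mean, so both are almost surely finite.\<close>

lemma (in poisson_law) AE_cell_area: "AE A in D. \<forall>x\<in>A. 0 < cell_area A x \<and> cell_area A x < \<infinity>"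
proof -
  define f :: "plane \<times> plane set \<Rightarrow> ennreal" where
    "f z = indicator {z. cell_area (snd z) (fst z) = 0 \<or> cell_area (snd z) (fst z) = \<infinity>} z" for z
  have f [measurable]: "f \<in> borel_measurable (borel \<Otimes>\<^sub>M config_space)"
    unfolding f_def by measurable
  have rem: "f (x, A - {x}) = f (x, A)" for x A
    by (simp add: f_def indicator_def cell_area_def voronoi_cell_remove)
  have "(\<integral>\<^sup>+A. f (x, A) \<partial>D) = 0" for x
  proof -
    have "AE A in D. cell_area A x \<noteq> \<infinity>"
      using mean_cell_area_le[of x] by (intro nn_integral_PInf_AE) (auto simp: top_unique)
    moreover have "AE A in D. area_bound x A \<noteq> \<infinity>"
      using mean_area_bound[of x] mean_bound_finite by (intro nn_integral_PInf_AE) auto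
    ultimately have "AE A in D. f (x, A) = 0"
      using AE_space
    proof eventually_elim
      case (elim A)
      then have "inverse (cell_area A x) \<noteq> \<infinity>"
        using inverse_cell_area_le[of A x] by (auto simp: top_unique)
      with elim show ?case by (auto simp: f_def)
    qed
    then show ?thesis by (subst nn_integral_0_iff_AE) simp_all
  qed
  with mecke[OF f] have "(\<integral>\<^sup>+A. \<integral>\<^sup>+x. f (x, A - {x}) \<partial>count_space A \<partial>D) = 0"
    by simp
  then have "AE A in D. (\<integral>\<^sup>+x. f (x, A) \<partial>count_space A) = 0"
    unfolding rem by (subst (asm) nn_integral_0_iff_AE) simp_all
  then show ?thesis
  proof eventually_elim
    case (elim A)
    show ?case
    proof
      fix x assume "x \<in> A"
      with elim have "f (x, A) = 0" by (simp add: sum_config_eq_0_iff)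
      then show "0 < cell_area A x \<and> cell_area A x < \<infinity>"
        by (auto simp: f_def less_top zero_less_iff_neq_zero split: split_indicator_asm)
    qed
  qed
qed

text \<open>The Palm hypothesis enters only through its two consequences \<open>origin\<close> and
  \<open>law\<close>, and one listing \<open>X\<close> of the points is fixed.\<close>

locale cell_users = poisson_law D lam + N: prob_space N
  for D lam and N :: "'v measure" +
  fixes Po :: "'v \<Rightarrow> plane set" and U :: "'v \<Rightarrow> plane set \<Rightarrow> plane" and X :: "nat \<Rightarrow> 'v \<Rightarrow> plane"
  assumes Po [measurable]: "Po \<in> N \<rightarrow>\<^sub>M config_space"
    and origin: "AE v in N. 0 \<in> Po v"
    and law: "distr N config_space (\<lambda>v. Po v - {0}) = D"
    and X: "\<And>i. X i \<in> borel_measurable (generated_algebra N Po)"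
    and bij: "AE v in N. bij_betw (\<lambda>i. X i v) UNIV (Po v - {0})"
    and U [measurable]: "\<And>i. (\<lambda>v. U v (voronoi_cell (Po v) (X i v))) \<in> borel_measurable N"
    and cond: "\<And>n B. (\<And>i. i < n \<Longrightarrow> B i \<in> sets borel) \<Longrightarrow>
       AE v in N.
         real_cond_exp N (generated_algebra N Po)
           (indicator {v \<in> space N. \<forall>i<n. U v (voronoi_cell (Po v) (X i v)) \<in> B i}) v =
         (\<Prod>i<n. measure (uniform_measure lborel (voronoi_cell (Po v) (X i v))) (B i))"
begin

definition others :: "'v \<Rightarrow> plane set" where "others v = Po v - {0}"

definition user :: "nat \<Rightarrow> 'v \<Rightarrow> plane" where "user i v = U v (voronoi_cell (Po v) (X i v))"

text \<open>The conditional probability, given \<open>Po\<close>, that the \<open>i\<close>th user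
  falls in \<open>B\<close>, written through the density so that Fubini's theorem applies to
  it.\<close>

definition cell_prob :: "nat \<Rightarrow> 'v \<Rightarrow> plane set \<Rightarrow> ennreal" where
  "cell_prob i v B = (\<integral>\<^sup>+y. cell_density (others v) (X i v) y * indicator B y \<partial>lborel)"

lemma measurable_others [measurable]: "others \<in> N \<rightarrow>\<^sub>M config_space"
  unfolding others_def by measurable

lemma distr_others: "distr N config_space others = D"
  using law unfolding others_def[abs_def] .

lemma measurable_user [measurable]: "user i \<in> borel_measurable N"
  unfolding user_def by (rule U)

lemma subalgebra: "subalgebra N (generated_algebra N Po)"
  unfolding subalgebra_def generated_algebra_def
  using sets_image_in_sets[OF refl Po] by simp

lemma measurable_X [measurable]: "X i \<in> borel_measurable N"
  by (rule measurable_from_subalg[OF subalgebra X])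

lemma measurable_cell_prob [measurable]:
  assumes [measurable]: "B \<in> sets borel"
  shows "(\<lambda>v. cell_prob i v B) \<in> borel_measurable N"
  unfolding cell_prob_def by measurable

lemma AE_others: "AE v in N. \<forall>i. X i v \<in> others v \<and>
    voronoi_cell (Po v) (X i v) = voronoi_cell (insert 0 (others v)) (X i v) \<and>
    0 < cell_area (others v) (X i v) \<and> cell_area (others v) (X i v) < \<infinity>"
proof -
  have "AE v in N. \<forall>x\<in>others v. 0 < cell_area (others v) x \<and> cell_area (others v) x < \<infinity>"
  proof -
    have "AE A in distr N config_space others. \<forall>x\<in>A. 0 < cell_area A x \<and> cell_area A x < \<infinity>"
      using AE_cell_area by (simp only: distr_others)
    then show ?thesis by (rule AE_distrD[OF measurable_others])
  qed
  with origin bij show ?thesis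
  proof eventually_elim
    case (elim v)
    have "insert 0 (others v) = Po v" using elim(1) by (auto simp: others_def)
    moreover have "X i v \<in> others v" for i
      using elim(2) by (auto simp: others_def bij_betw_def)
    ultimately show ?case using elim(3) by simp
  qed
qed

text \<open>A single null set serves all \<open>i\<close> and \<open>B\<close>, because the
  identities hold as soon as every cell has positive finite area.\<close>

lemma AE_measure_cell: "AE v in N. \<forall>i. \<forall>B\<in>sets borel.
    ennreal (measure (uniform_measure lborel (voronoi_cell (Po v) (X i v))) B) = cell_prob i v B \<and>
    cell_prob i v UNIV = 1"
  using AE_others
proof eventually_elim
  case (elim v)
  show ?case
  proof (intro allI ballI conjI)
    fix i and B :: "plane set" assume B: "B \<in> sets borel"
    let ?V = "voronoi_cell (insert 0 (others v)) (X i v)"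
    have V: "voronoi_cell (Po v) (X i v) = ?V" "emeasure lborel ?V \<noteq> 0" "emeasure lborel ?V \<noteq> \<infinity>"
      using spec[OF elim, of i] by (auto simp: cell_area_def)
    have "prob_space (uniform_measure lborel ?V)"
      using V by (intro prob_space_uniform_measure) auto
    then have "ennreal (measure (uniform_measure lborel ?V) B) = emeasure (uniform_measure lborel ?V) B"
      by (simp add: prob_space_def finite_measure.emeasure_eq_measure)
    also have "\<dots> = emeasure lborel (?V \<inter> B) / emeasure lborel ?V"
      using B by simp
    also have "\<dots> = cell_prob i v B"
      unfolding cell_prob_def by (subst nn_integral_cell_density[OF B]) (simp add: cell_area_def)
    finally show "ennreal (measure (uniform_measure lborel (voronoi_cell (Po v) (X i v))) B) = cell_prob i v B"
      by (simp only: V(1))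
    show "cell_prob i v UNIV = 1"
      unfolding cell_prob_def using V by (subst nn_integral_cell_density) (simp_all add: cell_area_def less_top)
  qed
qed

lemma emeasure_users:
  assumes B: "\<And>i. i < n \<Longrightarrow> B i \<in> sets borel"
  shows "emeasure N {v \<in> space N. \<forall>i<n. user i v \<in> B i} = (\<integral>\<^sup>+v. (\<Prod>i<n. cell_prob i v (B i)) \<partial>N)"
proof -
  interpret F: finite_measure_subalgebra N "generated_algebra N Po"
    by unfold_locales (rule subalgebra)
  define S where "S = {v \<in> space N. \<forall>i<n. user i v \<in> B i}"
  have S: "S \<in> sets N"
  proof -
    have "{v \<in> space N. \<forall>i\<in>{..<n}. user i v \<in> B i} \<in> sets N"
    proof (rule sets.sets_Collect_finite_All)
      fix i assume "i \<in> {..<n}"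
      then have [measurable]: "B i \<in> sets borel" using B by simp
      show "{v \<in> space N. user i v \<in> B i} \<in> sets N" by measurable
    qed simp
    also have "{v \<in> space N. \<forall>i\<in>{..<n}. user i v \<in> B i} = S" by (auto simp: S_def)
    finally show ?thesis .
  qed
  let ?c = "real_cond_exp N (generated_algebra N Po) (indicator S)"
  have AE_c: "AE v in N. ?c v = (\<Prod>i<n. measure (uniform_measure lborel (voronoi_cell (Po v) (X i v))) (B i))"
    using cond[OF B] by (simp add: S_def user_def)
  have int: "integrable N (indicator S :: 'v \<Rightarrow> real)"
    using S by (simp add: N.emeasure_eq_measure)
  have "emeasure N S = ennreal (\<integral>v. indicator S v \<partial>N)"
    using S by (simp add: N.emeasure_eq_measure)
  also have "(\<integral>v. indicator S v \<partial>N) = (\<integral>v. ?c v \<partial>N)"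
    using F.real_cond_exp_int(2)[OF int] by simp
  also have "ennreal \<dots> = (\<integral>\<^sup>+v. ennreal (?c v) \<partial>N)"
  proof (rule nn_integral_eq_integral[symmetric])
    show "integrable N ?c" by (rule F.real_cond_exp_int(1)[OF int])
    show "AE v in N. 0 \<le> ?c v" using AE_c by eventually_elim (simp add: prod_nonneg)
  qed
  also have "\<dots> = (\<integral>\<^sup>+v. (\<Prod>i<n. cell_prob i v (B i)) \<partial>N)"
  proof (rule nn_integral_cong_AE)
    show "AE v in N. ennreal (?c v) = (\<Prod>i<n. cell_prob i v (B i))"
      using AE_c AE_measure_cell
    proof eventually_elim
      case (elim v)
      have "ennreal (?c v) = (\<Prod>i<n. ennreal (measure (uniform_measure lborel (voronoi_cell (Po v) (X i v))) (B i)))"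
        unfolding elim(1) by (simp add: prod_ennreal)
      also have "\<dots> = (\<Prod>i<n. cell_prob i v (B i))"
        using elim(2) B by (intro prod.cong) auto
      finally show ?case .
    qed
  qed
  finally show ?thesis by (simp add: S_def)
qed

lemma emeasure_user_pair:
  assumes ij: "i < j" and B: "B \<in> sets borel" "C \<in> sets borel"
  shows "emeasure N {v \<in> space N. user i v \<in> B \<and> user j v \<in> C} = (\<integral>\<^sup>+v. cell_prob i v B * cell_prob j v C \<partial>N)"
proof -
  \<comment> \<open>The hypothesis concerns initial segments of the listing. The remaining users
    below \<open>Suc j\<close> are left unrestricted and contribute factors 1.\<close>
  define E where "E k = (if k = i then B else if k = j then C else UNIV)" for k
  have "{v \<in> space N. user i v \<in> B \<and> user j v \<in> C} = {v \<in> space N. \<forall>k<Suc j. user k v \<in> E k}"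
    using ij by (auto simp: E_def less_Suc_eq)
  also have "emeasure N \<dots> = (\<integral>\<^sup>+v. (\<Prod>k<Suc j. cell_prob k v (E k)) \<partial>N)"
    by (rule emeasure_users) (simp add: E_def B)
  also have "\<dots> = (\<integral>\<^sup>+v. cell_prob i v B * cell_prob j v C \<partial>N)"
  proof (rule nn_integral_cong_AE)
    show "AE v in N. (\<Prod>k<Suc j. cell_prob k v (E k)) = cell_prob i v B * cell_prob j v C"
      using AE_measure_cell
    proof eventually_elim
      case (elim v)
      then have "cell_prob k v UNIV = 1" for k by blast
      then have "(\<Prod>k<j. cell_prob k v (E k)) = (\<Prod>k<j. if k = i then cell_prob i v B else 1)"
        by (intro prod.cong) (auto simp: E_def)
      also have "\<dots> = cell_prob i v B" using ij by simp
      finally show ?case using ij by (simp add: E_def)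
    qed
  qed
  finally show ?thesis .
qed

lemma emeasure_user:
  assumes B: "B \<in> sets borel"
  shows "emeasure N {v \<in> space N. user i v \<in> B} = (\<integral>\<^sup>+v. cell_prob i v B \<partial>N)"
proof -
  have "emeasure N {v \<in> space N. user i v \<in> B} = (\<integral>\<^sup>+v. cell_prob i v B * cell_prob (Suc i) v UNIV \<partial>N)"
    using emeasure_user_pair[of i "Suc i" B UNIV] B by simp
  also have "\<dots> = (\<integral>\<^sup>+v. cell_prob i v B \<partial>N)"
  proof (rule nn_integral_cong_AE)
    show "AE v in N. cell_prob i v B * cell_prob (Suc i) v UNIV = cell_prob i v B"
      using AE_measure_cell
    proof eventually_elim
      case (elim v)
      then have "cell_prob (Suc i) v UNIV = 1" by blast
      then show ?case by simp
    qed
  qed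
  finally show ?thesis .
qed

text \<open>The joint law of two users has a density, and the diagonal is a Lebesgue null set.\<close>

lemma AE_users_distinct:
  assumes ij: "i < j"
  shows "AE v in N. user i v \<noteq> user j v"
proof -
  interpret PS: pair_sigma_finite N lborel ..
  \<comment> \<open>Given \<open>Po\<close> the two users are independent with these densities;
    averaging over \<open>Po\<close> gives the joint density.\<close>
  define \<phi> where "\<phi> z = (\<integral>\<^sup>+v. cell_density (others v) (X i v) (fst z) * cell_density (others v) (X j v) (snd z) \<partial>N)"
    for z :: "plane \<times> plane"
  have \<phi> [measurable]: "\<phi> \<in> borel_measurable (borel \<Otimes>\<^sub>M borel)"
    unfolding \<phi>_def by measurable
  have [measurable]: "\<phi> \<in> borel_measurable (lborel \<Otimes>\<^sub>M lborel)"
    by measurable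
  define \<pi> where "\<pi> = distr N (borel \<Otimes>\<^sub>M borel) (\<lambda>v. (user i v, user j v))"
  have sets_eq: "sets (lborel \<Otimes>\<^sub>M lborel) = sets (borel \<Otimes>\<^sub>M (borel :: plane measure))"
    by (intro sets_pair_measure_cong) simp_all
  have \<pi>_eq: "\<pi> = density (lborel \<Otimes>\<^sub>M lborel) \<phi>"
  proof (rule measure_eqI_generator_eq[OF Int_stable_pair_measure_generator[of borel borel], where \<Omega> = UNIV and A = "\<lambda>_. UNIV"])
    show "{a \<times> b | a b. a \<in> sets (borel :: plane measure) \<and> b \<in> sets (borel :: plane measure)} \<subseteq> Pow UNIV" by simp
    show "sets \<pi> = sigma_sets UNIV {a \<times> b | a b. a \<in> sets borel \<and> b \<in> sets borel}"
      by (simp add: \<pi>_def sets_pair_measure)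
    show "sets (density (lborel \<Otimes>\<^sub>M lborel) \<phi>) = sigma_sets UNIV {a \<times> b | a b. a \<in> sets (borel :: plane measure) \<and> b \<in> sets (borel :: plane measure)}"
      unfolding sets_density sets_eq by (simp add: sets_pair_measure)
    show "range (\<lambda>_. UNIV) \<subseteq> {a \<times> b | a b. a \<in> sets (borel :: plane measure) \<and> b \<in> sets (borel :: plane measure)}"
      by (auto intro!: exI[of _ UNIV] simp: UNIV_Times_UNIV)
    have "prob_space \<pi>" unfolding \<pi>_def by (rule N.prob_space_distr) measurable
    then interpret P: prob_space \<pi> .
    show "emeasure \<pi> UNIV \<noteq> \<infinity>" by (simp add: P.emeasure_finite)
    fix W assume "W \<in> {a \<times> b | a b. a \<in> sets (borel :: plane measure) \<and> b \<in> sets (borel :: plane measure)}"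
    then obtain B C where W: "W = B \<times> C" and [measurable]: "B \<in> sets borel" "C \<in> sets borel" by auto
    have "emeasure \<pi> W = emeasure N {v \<in> space N. user i v \<in> B \<and> user j v \<in> C}"
      unfolding \<pi>_def W by (subst emeasure_distr) (auto intro!: arg_cong[where f = "emeasure N"])
    also have "\<dots> = (\<integral>\<^sup>+v. cell_prob i v B * cell_prob j v C \<partial>N)"
      by (rule emeasure_user_pair[OF ij]) measurable
    also have "\<dots> = (\<integral>\<^sup>+v. \<integral>\<^sup>+a. \<integral>\<^sup>+b. (cell_density (others v) (X i v) a * indicator B a) *
        (cell_density (others v) (X j v) b * indicator C b) \<partial>lborel \<partial>lborel \<partial>N)"
    proof (intro nn_integral_cong)
      fix v
      let ?f = "\<lambda>a. cell_density (others v) (X i v) a * indicator B a"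
      let ?g = "\<lambda>b. cell_density (others v) (X j v) b * indicator C b"
      have "(\<integral>\<^sup>+a. \<integral>\<^sup>+b. ?f a * ?g b \<partial>lborel \<partial>lborel) = (\<integral>\<^sup>+a. ?f a * (\<integral>\<^sup>+b. ?g b \<partial>lborel) \<partial>lborel)"
        by (intro nn_integral_cong nn_integral_cmult) measurable
      also have "\<dots> = (\<integral>\<^sup>+a. ?f a \<partial>lborel) * (\<integral>\<^sup>+b. ?g b \<partial>lborel)"
        by (rule nn_integral_multc) measurable
      finally show "cell_prob i v B * cell_prob j v C = (\<integral>\<^sup>+a. \<integral>\<^sup>+b. ?f a * ?g b \<partial>lborel \<partial>lborel)"
        by (simp only: cell_prob_def)
    qed
    also have "\<dots> = (\<integral>\<^sup>+a. \<integral>\<^sup>+v. \<integral>\<^sup>+b. (cell_density (others v) (X i v) a * indicator B a) *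
        (cell_density (others v) (X j v) b * indicator C b) \<partial>lborel \<partial>N \<partial>lborel)"
      by (rule PS.Fubini'[symmetric]) measurable
    also have "\<dots> = (\<integral>\<^sup>+a. \<integral>\<^sup>+b. \<integral>\<^sup>+v. (cell_density (others v) (X i v) a * indicator B a) *
        (cell_density (others v) (X j v) b * indicator C b) \<partial>N \<partial>lborel \<partial>lborel)"
      by (intro nn_integral_cong PS.Fubini'[symmetric]) measurable
    also have "\<dots> = (\<integral>\<^sup>+a. \<integral>\<^sup>+b. \<phi> (a, b) * indicator W (a, b) \<partial>lborel \<partial>lborel)"
    proof (intro nn_integral_cong)
      fix a b
      have "\<phi> (a, b) * indicator W (a, b) =
          (\<integral>\<^sup>+v. cell_density (others v) (X i v) a * cell_density (others v) (X j v) b * indicator W (a, b) \<partial>N)"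
        unfolding \<phi>_def fst_conv snd_conv by (rule nn_integral_multc[symmetric]) measurable
      then show "(\<integral>\<^sup>+v. (cell_density (others v) (X i v) a * indicator B a) *
          (cell_density (others v) (X j v) b * indicator C b) \<partial>N) = \<phi> (a, b) * indicator W (a, b)"
        by (simp add: W indicator_times mult_ac)
    qed
    also have "\<dots> = (\<integral>\<^sup>+z. \<phi> z * indicator W z \<partial>(lborel \<Otimes>\<^sub>M lborel))"
      by (rule lborel.nn_integral_fst) (simp add: W)
    also have "\<dots> = emeasure (density (lborel \<Otimes>\<^sub>M lborel) \<phi>) W"
      by (rule emeasure_density[symmetric]) (simp_all add: W)
    finally show "emeasure \<pi> W = emeasure (density (lborel \<Otimes>\<^sub>M lborel) \<phi>) W" .
  qed simp
  define \<Delta> where "\<Delta> = {z :: plane \<times> plane. fst z = snd z}"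
  have \<Delta> [measurable]: "\<Delta> \<in> sets (borel \<Otimes>\<^sub>M borel)"
  proof -
    have "{z \<in> space (borel \<Otimes>\<^sub>M borel). fst z = (snd z :: plane)} \<in> sets (borel \<Otimes>\<^sub>M borel)"
      by measurable
    then show ?thesis by (simp add: \<Delta>_def space_pair_measure)
  qed
  have "emeasure (density (lborel \<Otimes>\<^sub>M lborel) \<phi>) \<Delta> = (\<integral>\<^sup>+a. \<integral>\<^sup>+b. \<phi> (a, b) * indicator \<Delta> (a, b) \<partial>lborel \<partial>lborel)"
    by (subst emeasure_density) (simp_all add: sets_eq lborel.nn_integral_fst[symmetric])
  also have "\<dots> = (\<integral>\<^sup>+a. \<integral>\<^sup>+b. 0 \<partial>(lborel :: plane measure) \<partial>(lborel :: plane measure))"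
  proof (rule nn_integral_cong, rule nn_integral_cong_AE)
    fix a :: plane
    show "AE b in lborel. \<phi> (a, b) * indicator \<Delta> (a, b) = 0"
      using AE_lborel_singleton[of a] by eventually_elim (auto simp: \<Delta>_def)
  qed
  finally have "emeasure \<pi> \<Delta> = 0" by (simp add: \<pi>_eq)
  moreover have "emeasure \<pi> \<Delta> = emeasure N ((\<lambda>v. (user i v, user j v)) -` \<Delta> \<inter> space N)"
    unfolding \<pi>_def by (rule emeasure_distr) measurable
  moreover have "(\<lambda>v. (user i v, user j v)) -` \<Delta> \<inter> space N = {v \<in> space N. user i v = user j v}"
    by (auto simp: \<Delta>_def)
  ultimately have "emeasure N {v \<in> space N. user i v = user j v} = 0"
    by simp
  then show ?thesis
    by (subst AE_iff_measurable[OF _ refl]) simp_all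
qed

text \<open>Distinctness makes the number of elements of the set \<open>bs_users\<close> in the disk
  equal to a sum over indices, with mean the sum of the \<open>cell_prob\<close>. Reindexing by the
  points of the process makes the listing disappear, after which the law of \<open>others\<close>
  allows \<open>sum_cell_density\<close> to be applied.\<close>

lemma expected_count_users:
  "expected_count N (bs_users Po U) r = (\<integral>\<^sup>+y. user_density y * indicator (cball 0 r) y \<partial>lborel)"
proof -
  define C where "C = cball (0::plane) r"
  have C [measurable]: "C \<in> sets borel" by (simp add: C_def)
  define g where "g A x = emeasure lborel (voronoi_cell (insert 0 A) x \<inter> C) / cell_area A x" for A x
  have cp: "cell_prob i v C = g (others v) (X i v)" for i v
    unfolding cell_prob_def g_def by (rule nn_integral_cell_density) measurable
  have "AE v in N. \<forall>i j. i < j \<longrightarrow> user i v \<noteq> user j v"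
    using AE_users_distinct by (simp add: AE_all_countable)
  with bij have "AE v in N. emeasure (count_space UNIV) (bs_users Po U v \<inter> C) = (\<Sum>i. indicator C (user i v))"
  proof eventually_elim
    case (elim v)
    have eq: "bs_users Po U v = range (\<lambda>i. user i v)"
    proof -
      have "bs_users Po U v = (\<lambda>x. U v (voronoi_cell (Po v) x)) ` (Po v - {0})"
        by (auto simp: bs_users_def)
      also have "Po v - {0} = range (\<lambda>i. X i v)" using elim(1) by (simp add: bij_betw_def)
      finally show ?thesis by (simp add: image_image user_def)
    qed
    have "inj (\<lambda>i. user i v)"
      using elim(2) by (intro injI) (metis nat_neq_iff)
    then have "bij_betw (\<lambda>i. user i v) UNIV (range (\<lambda>i. user i v))"
      by (simp add: bij_betw_def)
    from nn_integral_bij_count_space[OF this, of "indicator C"]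
    have "(\<Sum>i. indicator C (user i v)) = (\<integral>\<^sup>+y. indicator C y * 1 \<partial>count_space (range (\<lambda>i. user i v)))"
      by (simp add: nn_integral_count_space_nat)
    also have "\<dots> = emeasure (count_space UNIV) (range (\<lambda>i. user i v) \<inter> C)"
      unfolding nn_integral_count_space_restrict by (simp add: emeasure_count_space)
    finally show ?case by (simp add: eq)
  qed
  then have "expected_count N (bs_users Po U) r = (\<integral>\<^sup>+v. (\<Sum>i. indicator C (user i v)) \<partial>N)"
    unfolding expected_count_def C_def[symmetric] by (rule nn_integral_cong_AE)
  also have "\<dots> = (\<Sum>i. \<integral>\<^sup>+v. indicator C (user i v) \<partial>N)"
    by (rule nn_integral_suminf) measurable
  also have "\<dots> = (\<Sum>i. \<integral>\<^sup>+v. cell_prob i v C \<partial>N)"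
  proof (rule suminf_cong)
    fix i
    have "(\<integral>\<^sup>+v. indicator C (user i v) \<partial>N) = (\<integral>\<^sup>+v. indicator {v \<in> space N. user i v \<in> C} v \<partial>N)"
      by (intro nn_integral_cong) (simp add: indicator_def)
    also have "\<dots> = (\<integral>\<^sup>+v. cell_prob i v C \<partial>N)"
      by (simp add: emeasure_user[OF C])
    finally show "(\<integral>\<^sup>+v. indicator C (user i v) \<partial>N) = (\<integral>\<^sup>+v. cell_prob i v C \<partial>N)" .
  qed
  also have "\<dots> = (\<integral>\<^sup>+v. (\<Sum>i. cell_prob i v C) \<partial>N)"
    by (rule nn_integral_suminf[symmetric]) measurable
  also have "\<dots> = (\<integral>\<^sup>+v. \<integral>\<^sup>+x. g (others v) x \<partial>count_space (others v) \<partial>N)"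
  proof (rule nn_integral_cong_AE)
    show "AE v in N. (\<Sum>i. cell_prob i v C) = (\<integral>\<^sup>+x. g (others v) x \<partial>count_space (others v))"
      using bij
    proof eventually_elim
      case (elim v)
      then have "bij_betw (\<lambda>i. X i v) UNIV (others v)" by (simp add: others_def)
      from nn_integral_bij_count_space[OF this, of "g (others v)"]
      show ?case by (simp add: cp nn_integral_count_space_nat)
    qed
  qed
  also have "\<dots> = (\<integral>\<^sup>+A. \<integral>\<^sup>+x. g A x \<partial>count_space A \<partial>distr N config_space others)"
  proof (rule nn_integral_distr[symmetric])
    have "(\<lambda>(A, x). g A x) \<in> borel_measurable (config_space \<Otimes>\<^sub>M borel)"
      unfolding g_def nn_integral_cell_density[OF C, symmetric] by measurable
    then show "(\<lambda>A. \<integral>\<^sup>+x. g A x \<partial>count_space A) \<in> borel_measurable (distr N config_space others)"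
      by measurable
  qed measurable
  also note distr_others
  also have "(\<integral>\<^sup>+A. \<integral>\<^sup>+x. g A x \<partial>count_space A \<partial>D) = (\<integral>\<^sup>+y. user_density y * indicator C y \<partial>lborel)"
    unfolding g_def by (rule sum_cell_density[OF C])
  finally show ?thesis by (simp add: C_def)
qed

end

text \<open>Finiteness and differentiability belong to the conclusion because
  \<open>enn2real\<close> sends infinity to 0 and \<open>deriv\<close> carries no information where
  no derivative exists.\<close>

theorem lemma2:
  fixes M :: "'w measure" and N :: "'v measure" and lam :: real
    and P :: "'w \<Rightarrow> plane set" and Po :: "'v \<Rightarrow> plane set"
    and U :: "'v \<Rightarrow> plane set \<Rightarrow> plane"
  assumes "lam > 0"
    and "poisson_process M lam P"
    and "palm_version M lam P N Po"
    and "uniform_in_cells N Po U"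
  shows "\<exists>c1 c2 r0 :: real. c1 > 0 \<and> c2 > 0 \<and> r0 > 0 \<and>
    (\<forall>r. 0 < r \<and> r < r0 \<longrightarrow>
       expected_count N (bs_users Po U) r < \<infinity> \<and>
       K_fun N (bs_users Po U) field_differentiable (at r) \<and>
       c1 * r\<^sup>2 \<le> pair_correlation N (bs_users Po U) r \<and>
       pair_correlation N (bs_users Po U) r \<le> c2 * r\<^sup>2)"
proof -
  define D where "D = distr M config_space P"
  interpret poisson_law D lam
    unfolding D_def using assms(1,2) by (rule poisson_process_law)
  have P: "P \<in> M \<rightarrow>\<^sub>M config_space"
    using assms(2) by (simp add: poisson_process_def point_process_def)
  have N: "prob_space N" and Po: "Po \<in> N \<rightarrow>\<^sub>M config_space"
    using assms(3) by (simp_all add: palm_version_def point_process_def)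
  obtain X :: "nat \<Rightarrow> 'v \<Rightarrow> plane" where X:
    "\<forall>i. X i \<in> borel_measurable (generated_algebra N Po)"
    "AE v in N. bij_betw (\<lambda>i. X i v) UNIV (Po v - {0})"
    "\<forall>i. (\<lambda>v. U v (voronoi_cell (Po v) (X i v))) \<in> borel_measurable N"
    "\<forall>n B. (\<forall>i<n. B i \<in> sets borel) \<longrightarrow>
       (AE v in N.
          real_cond_exp N (generated_algebra N Po)
            (indicator {v \<in> space N. \<forall>i<n. U v (voronoi_cell (Po v) (X i v)) \<in> B i}) v =
          (\<Prod>i<n. measure (uniform_measure lborel (voronoi_cell (Po v) (X i v))) (B i)))"
    using assms(4) unfolding uniform_in_cells_def by (elim exE conjE) (rule that)
  interpret cell_users D lam N Po U X
  proof (intro cell_users.intro cell_users_axioms.intro)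
    show "poisson_law D lam" by unfold_locales
    show "prob_space N" by fact
    show "Po \<in> N \<rightarrow>\<^sub>M config_space" by fact
    show "AE v in N. 0 \<in> Po v" by (rule palm_origin[OF assms(1,3)])
    show "distr N config_space (\<lambda>v. Po v - {0}) = D" by (rule palm_law[OF D_def P assms(3)])
  qed (use X in simp_all)
  \<comment> \<open>The radial profile along a fixed axis; defining it for all real \<open>t\<close>
    gives a function whose continuity can be stated at every real point.\<close>
  define h where "h t = enn2real (user_density (t *\<^sub>R axis 1 1))" for t
  have density: "user_density y = ennreal (h (norm y))" for y
  proof -
    have "user_density y = user_density (norm y *\<^sub>R axis 1 1)"
      by (rule user_density_radial) (simp add: norm_axis_1)
    then show ?thesis
      using user_density_finite by (simp add: h_def)
  qed
  have h0: "0 \<le> h t" for t by (simp add: h_def)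
  have h_cont: "isCont h r" for r
    unfolding continuous_at_sequentially o_def
  proof (intro allI impI)
    fix t assume "t \<longlonglongrightarrow> r"
    then have "(\<lambda>n. user_density (t n *\<^sub>R axis 1 1)) \<longlonglongrightarrow> user_density (r *\<^sub>R axis 1 1)"
      by (intro user_density_continuous tendsto_intros)
    also have "user_density (r *\<^sub>R axis 1 1) = ennreal (h r)"
      using user_density_finite by (simp add: h_def)
    finally show "(\<lambda>n. h (t n)) \<longlonglongrightarrow> h r"
      unfolding h_def[of "t _"] by (rule tendsto_enn2real) (rule h0)
  qed
  have mean_bound: "mean_bound = ennreal (enn2real mean_bound)"
    using mean_bound_finite by simp
  have upper: "h r \<le> (lam * pi * enn2real mean_bound) * r\<^sup>2" if "0 < r" for r
  proof -
    have "ennreal (h r) \<le> ennreal lam * (ennreal (pi * r\<^sup>2) * ennreal (enn2real mean_bound))"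
      using user_density_le[of "r *\<^sub>R axis 1 1"] density[of "r *\<^sub>R axis 1 1"] that
      by (simp add: norm_axis_1 flip: mean_bound)
    also have "\<dots> = ennreal ((lam * pi * enn2real mean_bound) * r\<^sup>2)"
      using lam by (simp add: ennreal_mult[symmetric] mult_ac)
    finally show ?thesis
      using lam by (subst (asm) ennreal_le_iff) auto
  qed
  obtain c r\<^sub>0 where c: "0 < c" "0 < r\<^sub>0" "\<And>y. norm y < r\<^sub>0 \<Longrightarrow> ennreal (c * (norm y)\<^sup>2) \<le> user_density y"
    using user_density_ge by blast
  have lower: "c * r\<^sup>2 \<le> h r" if "0 < r" "r < r\<^sub>0" for r
    using c(3)[of "r *\<^sub>R axis 1 1"] density[of "r *\<^sub>R axis 1 1"] that h0[of r]
    by (simp add: norm_axis_1)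
  have count: "expected_count N (bs_users Po U) r < \<infinity>" for r
  proof -
    have "expected_count N (bs_users Po U) r \<le>
        (\<integral>\<^sup>+y. ennreal lam * (ennreal (pi * r\<^sup>2) * mean_bound) * indicator (cball (0::plane) r) y \<partial>lborel)"
      unfolding expected_count_users
    proof (intro nn_integral_mono)
      fix y :: plane
      have "user_density y \<le> ennreal lam * (ennreal (pi * r\<^sup>2) * mean_bound)" if "norm y \<le> r"
        by (rule order_trans[OF user_density_le])
          (intro mult_left_mono mult_right_mono ennreal_leI power_mono that, auto)
      then show "user_density y * indicator (cball 0 r) y \<le>
          ennreal lam * (ennreal (pi * r\<^sup>2) * mean_bound) * indicator (cball 0 r) y"
        by (simp add: indicator_def)
    qed
    also have "\<dots> = ennreal lam * (ennreal (pi * r\<^sup>2) * mean_bound) * emeasure lborel (cball (0::plane) r)"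
      by (rule nn_integral_cmult_indicator) simp
    also have "\<dots> < \<infinity>"
      using mean_bound_finite emeasure_bounded_finite[of "cball (0::plane) r"]
      by (simp add: ennreal_mult_less_top)
    finally show ?thesis .
  qed
  have deriv: "(K_fun N (bs_users Po U) has_real_derivative 2 * pi * r * h r) (at r)" if "0 < r" for r
  proof -
    have "K_fun N (bs_users Po U) = (\<lambda>s. enn2real (\<integral>\<^sup>+y. user_density y * indicator (cball 0 s) y \<partial>lborel))"
      by (simp add: fun_eq_iff K_fun_def expected_count_users)
    moreover have "(\<integral>\<^sup>+y. user_density y * indicator (cball 0 s) y \<partial>lborel) < \<infinity>" for s
      using count[of s] by (simp add: expected_count_users)
    ultimately show ?thesis
      using radial_integral_has_derivative[OF measurable_user_density density h0 h_cont that] by simp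
  qed
  have pair: "pair_correlation N (bs_users Po U) r = h r" if "0 < r" for r
    using DERIV_imp_deriv[OF deriv[OF that]] that by (simp add: pair_correlation_def)
  define c' where "c' = lam * pi * enn2real mean_bound"
  have "0 < c'"
  proof -
    \<comment> \<open>The constant term of \<open>mean_bound\<close> is 16, so the upper constant is
      strictly positive.\<close>
    have "mean_bound \<noteq> 0" by (simp add: mean_bound_def)
    then have "0 < enn2real mean_bound"
      using mean_bound_finite by (simp add: enn2real_positive_iff zero_less_iff_neq_zero)
    then show ?thesis using lam by (simp add: c'_def)
  qed
  show ?thesis
  proof (intro exI conjI allI impI)
    show "0 < c" "0 < c'" "0 < r\<^sub>0" by fact+
    fix r assume r: "0 < r \<and> r < r\<^sub>0"
    show "expected_count N (bs_users Po U) r < \<infinity>" by (rule count)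
    show "K_fun N (bs_users Po U) field_differentiable (at r)"
      using deriv r by (auto simp: field_differentiable_def)
    show "c * r\<^sup>2 \<le> pair_correlation N (bs_users Po U) r" using r lower pair by simp
    show "pair_correlation N (bs_users Po U) r \<le> c' * r\<^sup>2" using r upper pair by (simp add: c'_def)
  qed
qed

end
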